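(* Let $\varphi$ be a nonzero rational function in one variable and let $$\square_{LB}=\varphi(r)^{-1}\partial_t^2-\frac{\varphi(r)-1}{r^2}\,Q^2-\frac1r\Bigl(\frac{\varphi(r)-1}{r}+\varphi'(r)\Bigr)Q-\Delta,$$ with $Q=x\partial_x+y\partial_y+z\partial_z$, $\Delta=\partial_x^2+\partial_y^2+\partial_z^2$, be the classical Laplace--Beltrami operator of the Schwarzschild-type metric $\varphi(r)\,dt^2-\varphi(r)^{-1}dr^2-r^2d\Omega^2$ ($d\Omega^2$ is the area form of the unit sphere). Then its quantization $\hat\square_{LB}=\alpha(\square_{LB})$ is $$\hat\square_{LB}=\varphi(\hat r)^{-1}\hat\partial_t^2-\frac{\varphi(\hat r)-1}{\hat r^2}\hat Q^2-\Bigl(\frac{\varphi(\hat r)-1}{\hat r^2}+\frac{\varphi'(\hat r)}{\hat r}\Bigr)\hat Q+\frac\hbar2\,\frac{\varphi(\hat r)-1}{\hat r^2}\hat Q\hat\partial_t-\Bigl(1+\frac{\hbar^2}{12}\,\frac{\varphi(\hat r)-1}{\hat r^2}\Bigr)\hat\Delta,$$ where $\hat Q=\hat x\hat\partial_x+\hat y\hat\partial_y+\hat z\hat\partial_z$ and $\hat\Delta=\hat\partial_x^2+\hat\partial_y^2+\hat\partial_z^2$. Consequently, $\hat\square_{LB}$ is well defined on the whole algebra $\mathcal{A}_\hbar$ and maps each isotypic component to itself; more precisely, for every rational function $f$ in two variables and every $\hat u\in V^k$ one has $\hat\square_{LB}(f(\hat t,\hat r)\hat u)=g_k(\hat t,\hat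 r)\hat u$ for some rational function $g_k$. Thus the action of $\hat\square_{LB}$ is described by a series of maps $\mathbb{K}(\hat t,\hat r)\to\mathbb{K}(\hat t,\hat r)$, $f(\hat t,\hat r)\mapsto g_k(\hat t,\hat r)$, one for each $k$.
   Context: Work over $\mathbb{K}=\mathbb{C}$; $\hbar=2ih\ne0$. Hats denote quantum objects. Quantum side. $U(u(2)_\hbar)$ is generated by $\hat x,\hat y,\hat z,\hat t$ with $[\hat x,\hat y]=\hbar\hat z$, $[\hat y,\hat z]=\hbar\hat x$, $[\hat z,\hat x]=\hbar\hat y$, and $\hat t$ central; $U(su(2)_\hbar)$ is the subalgebra generated by $\hat x,\hat y,\hat z$; $\mathrm{Cas}=\hat x^2+\hat y^2+\hat z^2$. Quantum partial derivatives $\hat\partial_x,\hat\partial_y,\hat\partial_z$ and $\tilde\partial_t=\hat\partial_t+\frac2\hbar$ commute with each other and satisfy (omitting hats) $[\tilde\partial_t,t]=\frac\hbar2\tilde\partial_t$, $[\tilde\partial_t,g]=-\frac\hbar2\partial_g$, $[\partial_g,t]=\frac\hbar2\partial_g$, $[\partial_g,g]=\frac\hbar2\tilde\partial_t$ for $g\in\{x,y,z\}$; $[\partial_x,y]=\frac\hbar2\partial_z$, $[\partial_x,z]=-\frac\hbar2\partial_y$, $[\partial_y,x]=-\frac\hbar2\partial_z$, $[\partial_y,z]=\frac\hbar2\partial_x$, $[\partial_z,x]=\frac\hbar2\partial_y$, $[\partial_z,y]=-\frac\hbar2\partial_x$. They act by moving derivatives to the right and evaluating on $1$, where all $\hat\partial$'s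 vanish, so $\tilde\partial_t(1)=\frac2\hbar$. Let $\hat\mu$ be central with $\hat\mu^2=\hbar^2-4\,\mathrm{Cas}$, and put $\hat r=\hat\mu/(2i)$ (quantum radius), so $\hat r^2=\mathrm{Cas}+h^2$. The quantum algebra is $\mathcal{A}_\hbar=(\mathbb{K}(\hat t,\hat r)\otimes U(su(2)_\hbar))/\langle\hat x^2+\hat y^2+\hat z^2+h^2-\hat r^2\rangle\cong\bigoplus_{k\ge0}\mathbb{K}(\hat t,\hat r)\otimes V^k$, where $\mathbb{K}(\hat t,\hat r)$ is the algebra of rational functions in $\hat t,\hat r$ and $V^k\subset U(su(2)_\hbar)$ is the irreducible $su(2)$-submodule (adjoint action) with highest weight vector $\hat b^k$, $\hat b=-(\hat y+i\hat x)$. The summands are called isotypic components. Classical side and quantization. $\mathcal{A}=(\mathbb{K}(t,r)\otimes\mathrm{Sym}(su(2)))/\langle x^2+y^2+z^2-r^2\rangle\cong\bigoplus_k\mathbb{K}(t,r)\otimes V^k_{cl}$, with $V^k_{cl}$ the $su(2)$-module generated by $b^k$, $b=-(y+ix)$. The quantizing map $\alpha:\mathcal{A}\to\mathcal{A}_\hbar$ is the $SU(2)$-equivariant linear map with $\alpha(f(t,r)u)=f(\hat t,\hat r)\hat u$, where $u\mapsto\hat u$ is the $su(2)$-isomorphism $V^k_{cl}\to V^k$ sending $b^k$ to $\hat b^k$. For a differential operator written with all derivatives on the right, $\mathcal{D}=\sum_\beta a_\beta\partial_\beta$ (finite sum over multi-indices, $a_\beta\in\mathcal{A}$), its quantization is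 $\alpha(\mathcal{D})=\sum_\beta\alpha(a_\beta)\hat\partial_\beta$. Action of invariant operators on $\mathcal{A}_\hbar$. Write $\hat\mu=2i\hat r$. One has, by the permutation relations, $(\tilde\partial_t,\hat Q)^t\,\mathrm{Cas}=\Phi\,(\tilde\partial_t,\hat Q)^t$ and, with $\Delta_0=\tilde\partial_t^2$, $\Delta_1=\hat\Delta$, $\Delta_2=\hat Q\tilde\partial_t$, $\Delta_3=\hat Q^2$, $\Delta_i\,\mathrm{Cas}=\sum_j\Pi_{ij}\Delta_j$, where $$\Phi=\begin{pmatrix}\mathrm{Cas}-\frac34\hbar^2&-\hbar\\ \hbar\,\mathrm{Cas}&\mathrm{Cas}+\frac{\hbar^2}4\end{pmatrix},\quad \Pi=\begin{pmatrix}\mathrm{Cas}-\frac32\hbar^2&\frac{\hbar^2}2&-2\hbar&0\\ \frac32\hbar^2&\mathrm{Cas}-\frac{\hbar^2}2&2\hbar&0\\ \hbar\,\mathrm{Cas}&0&\mathrm{Cas}-\frac{\hbar^2}2&-\hbar\\ \hbar^2\mathrm{Cas}&-\frac{\hbar^2}2\mathrm{Cas}&\hbar(2\mathrm{Cas}+\frac{\hbar^2}4)&\mathrm{Cas}+\frac{\hbar^2}2\end{pmatrix}.$$ Let $P_1,P_2$ be the spectral projectors of $\Phi$ for the eigenvalues $\frac14(\hbar^2-(\hat\mu-\hbar)^2)$, $\frac14(\hbar^2-(\hat\mu+\hbar)^2)$, and $P_0,P_\pm$ those of $\Pi$ for $\frac14(\hbar^2-\hat\mu^2)$, $\frac14(\hbar^2-(\hat\mu\pm2\hbar)^2)$.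 For $\hat u\in V^k$ one has $\tilde\partial_t(\hat u)=\frac2\hbar\hat u$, $\hat Q(\hat u)=k\hat u$, $\Delta_0(\hat u)=\frac4{\hbar^2}\hat u$, $\Delta_1(\hat u)=0$, $\Delta_2(\hat u)=\frac{2k}\hbar\hat u$, $\Delta_3(\hat u)=k^2\hat u$. For rational $F(\hat t,\hat\mu)$ and $\hat u\in V^k$ the action is defined by $$\begin{pmatrix}\tilde\partial_t\\ \hat Q\end{pmatrix}(F\hat u)=\bigl(F(\hat t+\tfrac\hbar2,\hat\mu-\hbar)P_1+F(\hat t+\tfrac\hbar2,\hat\mu+\hbar)P_2\bigr)\begin{pmatrix}\tilde\partial_t(\hat u)\\ \hat Q(\hat u)\end{pmatrix},$$ $$\Delta_i(F\hat u)=\sum_j\bigl(F(\hat t+\hbar,\hat\mu)P_0+F(\hat t+\hbar,\hat\mu+2\hbar)P_++F(\hat t+\hbar,\hat\mu-2\hbar)P_-\bigr)_{ij}\Delta_j(\hat u),$$ and is extended to left linear combinations of these operators and of the identity with coefficients in $\mathcal{A}_\hbar$.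
   Formalization: The coefficient of the quantum Laplacian is proved as −(1 − (ħ²/12)(φ−1)/r²) instead of the printed −(1 + (ħ²/12)(φ−1)/r²): since α(x²) = x̂² + h²/3 = x̂² − ħ²/12, the printed sign is false whenever φ ≠ 1. *)

theory Defs
  imports
    "HOL-Analysis.Analysis"
    "HOL-Computational_Algebra.Computational_Algebra"
    "HOL-Library.Poly_Mapping"
    "HOL-Algebra.QuotRing"
    "HOL-Algebra.Generated_Groups"
begin

hide_const (open) Polynomial.order

section \<open>Rational functions\<close>

text \<open>The field of rational functions in \<open>t\<close> and \<open>r\<close>. In \<^typ>\<open>complex poly poly\<close> the inner
  indeterminate is \<open>t\<close> and the outer one is \<open>r\<close>.\<close>

type_synonym ratfun1 = "complex poly fract"
type_synonym ratfun2 = "complex poly poly fract"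

definition const :: "complex \<Rightarrow> ratfun2"
  where "const c = to_fract [:[:c:]:]"

definition t_var :: ratfun2
  where "t_var = to_fract [:[:0, 1:]:]"

definition r_var :: ratfun2
  where "r_var = to_fract [:0, 1:]"

text \<open>The definitions below do not depend on the choice of numerator and denominator.\<close>

definition num_den :: "'a::idom fract \<Rightarrow> 'a \<times> 'a"
  where "num_den x = (SOME (p, q). q \<noteq> 0 \<and> x = Fraction_Field.Fract p q)"

definition at_r :: "ratfun1 \<Rightarrow> ratfun2"
  where "at_r \<phi> = (let (p, q) = num_den \<phi>
           in to_fract (map_poly (\<lambda>c. [:c:]) p) / to_fract (map_poly (\<lambda>c. [:c:]) q))"

definition deriv_rat :: "ratfun1 \<Rightarrow> ratfun1"
  where "deriv_rat \<phi> = (let (p, q) = num_den \<phi>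
           in to_fract (pderiv p * q - p * pderiv q) / to_fract (q ^ 2))"

definition hbar :: "complex \<Rightarrow> complex"
  where "hbar h = 2 * \<i> * h"

text \<open>\<open>shift a c F\<close> is \<open>F(t + a, \<mu> + c)\<close>. Since \<open>\<mu> = 2 \<i> r\<close>, replacing \<open>\<mu>\<close> by \<open>\<mu> + c\<close> means
  replacing \<open>r\<close> by \<open>r + c / (2 \<i>)\<close>.\<close>

definition shift_poly :: "complex \<Rightarrow> complex \<Rightarrow> complex poly poly \<Rightarrow> complex poly poly"
  where "shift_poly a b p = pcompose (map_poly (\<lambda>q. pcompose q [:a, 1:]) p) [:[:b:], 1:]"

definition shift :: "complex \<Rightarrow> complex \<Rightarrow> ratfun2 \<Rightarrow> ratfun2"
  where "shift a c F = (let (p, q) = num_den F; b = c / (2 * \<i>)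
           in to_fract (shift_poly a b p) / to_fract (shift_poly a b q))"


section \<open>Free algebras and their quotients\<close>

datatype 'g word = Word (letters: "'g list")

instantiation word :: (type) monoid_add
begin

definition zero_word :: "'a word"
  where "0 = Word []"

definition plus_word :: "'a word \<Rightarrow> 'a word \<Rightarrow> 'a word"
  where "v + w = Word (letters v @ letters w)"

instance
  by standard (simp_all add: zero_word_def plus_word_def)

end

text \<open>The convolution product of \<^theory>\<open>HOL-Library.Poly_Mapping\<close> makes this the free associative
  algebra over the field of rational functions.\<close>

type_synonym 'g free = "'g word \<Rightarrow>\<^sub>0 ratfun2"

definition monom_word :: "'g word \<Rightarrow> 'g free"
  where "monom_word w = Poly_Mapping.single w 1"

definition gen :: "'g \<Rightarrow> 'g free"
  where "gen g = monom_word (Word [g])"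

definition scal :: "ratfun2 \<Rightarrow> 'g free"
  where "scal f = Poly_Mapping.single 0 f"

definition cscal :: "complex \<Rightarrow> 'g free"
  where "cscal c = scal (const c)"

definition commutator :: "'a::ring \<Rightarrow> 'a \<Rightarrow> 'a"
  where "commutator p q = p * q - q * p"

definition free_ring :: "'g free ring"
  where "free_ring = \<lparr>carrier = UNIV, mult = (*), one = 1, zero = 0, add = (+)\<rparr>"

text \<open>The algebra with relations \<open>p = 0\<close> for \<open>p \<in> R\<close>.\<close>

definition presented :: "'g free set \<Rightarrow> 'g free set ring"
  where "presented R = free_ring Quot (Idl\<^bsub>free_ring\<^esub> R)"

definition cls :: "'g free set \<Rightarrow> 'g free \<Rightarrow> 'g free set"
  where "cls R p = (Idl\<^bsub>free_ring\<^esub> R) +>\<^bsub>free_ring\<^esub> p"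

definition smult_cls :: "'g free set \<Rightarrow> ratfun2 \<Rightarrow> 'g free set \<Rightarrow> 'g free set"
  where "smult_cls R f a = cls R (scal f) \<otimes>\<^bsub>presented R\<^esub> a"


section \<open>The algebras of functions\<close>

datatype coord = CX | CY | CZ

abbreviation X :: "coord free" where "X \<equiv> gen CX"
abbreviation Y :: "coord free" where "Y \<equiv> gen CY"
abbreviation Z :: "coord free" where "Z \<equiv> gen CZ"

definition rels_cl :: "coord free set"
  where "rels_cl =
    {commutator X Y, commutator Y Z, commutator Z X, X^2 + Y^2 + Z^2 - scal (r_var ^ 2)}"

definition rels_q :: "complex \<Rightarrow> coord free set"
  where "rels_q h =
    {commutator X Y - cscal (hbar h) * Z,
     commutator Y Z - cscal (hbar h) * X,
     commutator Z X - cscal (hbar h) * Y,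
     X^2 + Y^2 + Z^2 + cscal (h^2) - scal (r_var ^ 2)}"

definition A_cl :: "coord free set ring"
  where "A_cl = presented rels_cl"

definition A_q :: "complex \<Rightarrow> coord free set ring"
  where "A_q h = presented (rels_q h)"


section \<open>The action of su(2) and isotypic components\<close>

text \<open>The basis of su(2) is normalised by \<open>[x,y] = z\<close>, \<open>[y,z] = x\<close>, \<open>[z,x] = y\<close>. On the classical
  algebra it acts by derivations over the field of rational functions in \<open>t\<close>, \<open>r\<close>; on the quantum
  algebra \<open>x\<close> acts by \<open>[x, _] / \<hbar>\<close>.\<close>

fun su2_bracket :: "coord \<Rightarrow> coord \<Rightarrow> coord free" where
  "su2_bracket CX CY = Z"
| "su2_bracket CY CX = - Z"
| "su2_bracket CY CZ = X"
| "su2_bracket CZ CY = - X"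
| "su2_bracket CZ CX = Y"
| "su2_bracket CX CZ = - Y"
| "su2_bracket _ _ = 0"

fun derive_letters :: "('g \<Rightarrow> 'g free) \<Rightarrow> 'g list \<Rightarrow> 'g free" where
  "derive_letters d [] = 0"
| "derive_letters d (g # w) = d g * monom_word (Word w) + gen g * derive_letters d w"

definition derivation :: "('g \<Rightarrow> 'g free) \<Rightarrow> 'g free \<Rightarrow> 'g free"
  where "derivation d p =
    (\<Sum>w\<in>Poly_Mapping.keys p. scal (Poly_Mapping.lookup p w) * derive_letters d (letters w))"

definition act_cl :: "coord \<Rightarrow> coord free set \<Rightarrow> coord free set"
  where "act_cl g a = (\<Union>p\<in>a. cls rels_cl (derivation (su2_bracket g) p))"

definition act_q :: "complex \<Rightarrow> coord \<Rightarrow> coord free set \<Rightarrow> coord free set"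
  where "act_q h g a = smult_cls (rels_q h) (const (1 / hbar h))
    ((cls (rels_q h) (gen g) \<otimes>\<^bsub>A_q h\<^esub> a) \<ominus>\<^bsub>A_q h\<^esub> (a \<otimes>\<^bsub>A_q h\<^esub> cls (rels_q h) (gen g)))"

text \<open>The complex su(2)-submodule generated by \<open>v\<close>.\<close>

inductive_set su2_submodule ::
  "coord free set \<Rightarrow> (coord \<Rightarrow> coord free set \<Rightarrow> coord free set) \<Rightarrow> coord free set \<Rightarrow> coord free set set"
  for R act v where
  vec: "v \<in> su2_submodule R act v"
| add: "a \<in> su2_submodule R act v \<Longrightarrow> b \<in> su2_submodule R act v
    \<Longrightarrow> a \<oplus>\<^bsub>presented R\<^esub> b \<in> su2_submodule R act v"
| smult: "a \<in> su2_submodule R act v \<Longrightarrow> smult_cls R (const c) a \<in> su2_submodule R act v"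
| act: "a \<in> su2_submodule R act v \<Longrightarrow> act g a \<in> su2_submodule R act v"

definition b_vec :: "coord free"
  where "b_vec = - (Y + cscal \<i> * X)"

definition V_cl :: "nat \<Rightarrow> coord free set set"
  where "V_cl k = su2_submodule rels_cl act_cl (cls rels_cl (b_vec ^ k))"

definition V_q :: "complex \<Rightarrow> nat \<Rightarrow> coord free set set"
  where "V_q h k = su2_submodule (rels_q h) (act_q h) (cls (rels_q h) (b_vec ^ k))"

definition isotypic :: "complex \<Rightarrow> nat \<Rightarrow> coord free set set"
  where "isotypic h k =
    generate (add_monoid (A_q h)) {smult_cls (rels_q h) F u | F u. u \<in> V_q h k}"

text \<open>A map as below sends \<open>r\<^sup>2\<close> to \<open>r\<^sup>2 = Cas + h\<^sup>2\<close> and the traceless part \<open>x\<^sup>2 - r\<^sup>2 / 3\<close> of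
  \<open>x\<^sup>2\<close> to \<open>x\<^sup>2 - Cas / 3\<close>. Hence it sends \<open>x\<^sup>2\<close> to \<open>x\<^sup>2 + h\<^sup>2 / 3 = x\<^sup>2 - \<hbar>\<^sup>2 / 12\<close>; this is where the
  coefficient \<open>\<hbar>\<^sup>2 / 12\<close> of quantized second-order operators comes from.\<close>

definition quantizing_map :: "complex \<Rightarrow> (coord free set \<Rightarrow> coord free set) \<Rightarrow> bool"
  where "quantizing_map h \<alpha> \<longleftrightarrow>
    \<alpha> \<in> hom (add_monoid A_cl) (add_monoid (A_q h)) \<and>
    (\<forall>f. \<forall>a\<in>carrier A_cl. \<alpha> (smult_cls rels_cl f a) = smult_cls (rels_q h) f (\<alpha> a)) \<and>
    (\<forall>k. bij_betw \<alpha> (V_cl k) (V_q h k) \<and>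
         \<alpha> (cls rels_cl (b_vec ^ k)) = cls (rels_q h) (b_vec ^ k) \<and>
         (\<forall>g. \<forall>u\<in>V_cl k. \<alpha> (act_cl g u) = act_q h g (\<alpha> u)))"


section \<open>Differential operators\<close>

datatype opgen = Pos coord | Tm | DT | DD coord

abbreviation xo :: "opgen free" where "xo \<equiv> gen (Pos CX)"
abbreviation yo :: "opgen free" where "yo \<equiv> gen (Pos CY)"
abbreviation zo :: "opgen free" where "zo \<equiv> gen (Pos CZ)"
abbreviation tm :: "opgen free" where "tm \<equiv> gen Tm"
abbreviation dt :: "opgen free" where "dt \<equiv> gen DT"
abbreviation dx :: "opgen free" where "dx \<equiv> gen (DD CX)"
abbreviation dy :: "opgen free" where "dy \<equiv> gen (DD CY)"
abbreviation dz :: "opgen free" where "dz \<equiv> gen (DD CZ)"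

definition emb :: "coord free \<Rightarrow> opgen free"
  where "emb p = (\<Sum>w\<in>Poly_Mapping.keys p.
    Poly_Mapping.single (Word (map Pos (letters w))) (Poly_Mapping.lookup p w))"

definition weyl_cl :: "opgen free set"
  where "weyl_cl =
    {commutator (gen (Pos g)) (gen (Pos g')) | g g'. True} \<union>
    {commutator (gen (Pos g)) tm | g. True} \<union>
    {commutator (gen (DD g)) (gen (DD g')) | g g'. True} \<union>
    {commutator dt (gen (DD g)) | g. True} \<union>
    {commutator dt tm - 1} \<union>
    {commutator dt (gen (Pos g)) | g. True} \<union>
    {commutator (gen (DD g)) tm | g. True} \<union>
    {commutator (gen (DD g)) (gen (Pos g')) - (if g = g' then 1 else 0) | g g'. True}"

text \<open>The letter \<^const>\<open>DT\<close> is the derivative that vanishes on 1; the shifted derivative is\<close>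

definition dtt :: "complex \<Rightarrow> opgen free"
  where "dtt h = dt + cscal (2 / hbar h)"

definition weyl_q :: "complex \<Rightarrow> opgen free set"
  where "weyl_q h = (let H = cscal (hbar h); H2 = cscal (hbar h / 2) in
    {commutator xo yo - H * zo, commutator yo zo - H * xo, commutator zo xo - H * yo} \<union>
    {commutator (gen (Pos g)) tm | g. True} \<union>
    {commutator (gen (DD g)) (gen (DD g')) | g g'. True} \<union>
    {commutator (dtt h) (gen (DD g)) | g. True} \<union>
    {commutator (dtt h) tm - H2 * dtt h} \<union>
    {commutator (dtt h) (gen (Pos g)) + H2 * gen (DD g) | g. True} \<union>
    {commutator (gen (DD g)) tm - H2 * gen (DD g) | g. True} \<union>
    {commutator (gen (DD g)) (gen (Pos g)) - H2 * dtt h | g. True} \<union>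
    {commutator dx yo - H2 * dz, commutator dx zo + H2 * dy,
     commutator dy xo + H2 * dz, commutator dy zo - H2 * dx,
     commutator dz xo - H2 * dy, commutator dz yo + H2 * dx})"

text \<open>Let \<open>W\<close> be the complex algebra with relations \<open>weyl\<close> and \<open>U\<close> its subalgebra generated by the
  letters \<open>Pos _\<close>, \<open>Tm\<close>. Operators with coefficients in the function algebra \<open>A\<close> on the left form the
  left module \<open>A \<otimes>\<^sub>U W\<close>. It is presented here as a quotient of \<^typ>\<open>opgen free\<close>, in which rational
  functions are meaningful as left coefficients only: they do not commute with the derivatives,
  so the additive subgroup factored out below is not a two-sided ideal. The relations \<open>weyl\<close> hold
  between arbitrary words, whereas the relations \<open>coef\<close>, which identify \<open>Tm\<close> with the rational
  function \<open>t\<close> and the Casimir element with a rational function of \<open>r\<close>, are imposed at the left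
  end of a word only.\<close>

definition op_null :: "opgen free set \<Rightarrow> opgen free set \<Rightarrow> opgen free set"
  where "op_null weyl coef = generate (add_monoid free_ring)
    ({scal f * monom_word u * p * monom_word v | f u p v. p \<in> weyl} \<union>
     {scal f * p * monom_word v | f p v. p \<in> coef})"

definition op_cl :: "opgen free \<Rightarrow> opgen free set"
  where "op_cl p =
    op_null weyl_cl {tm - scal t_var, xo^2 + yo^2 + zo^2 - scal (r_var ^ 2)} +>\<^bsub>free_ring\<^esub> p"

definition op_q :: "complex \<Rightarrow> opgen free \<Rightarrow> opgen free set"
  where "op_q h p =
    op_null (weyl_q h) {tm - scal t_var, xo^2 + yo^2 + zo^2 + cscal (h^2) - scal (r_var ^ 2)}
      +>\<^bsub>free_ring\<^esub> p"

definition d_mon :: "nat \<times> nat \<times> nat \<times> nat \<Rightarrow> opgen free"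
  where "d_mon = (\<lambda>(i, j, k, l). dt ^ i * dx ^ j * dy ^ k * dz ^ l)"

text \<open>The coefficients \<open>a \<beta>\<close> of a normally ordered operator, and their images under \<open>\<alpha>\<close>, are given
  by representatives.\<close>

definition is_quantization ::
  "complex \<Rightarrow> (coord free set \<Rightarrow> coord free set) \<Rightarrow> opgen free set \<Rightarrow> opgen free set \<Rightarrow> bool"
  where "is_quantization h \<alpha> D E \<longleftrightarrow>
    (\<exists>B a a'. finite B \<and>
       (\<forall>\<beta>\<in>B. \<alpha> (cls rels_cl (a \<beta>)) = cls (rels_q h) (a' \<beta>)) \<and>
       D = op_cl (\<Sum>\<beta>\<in>B. emb (a \<beta>) * d_mon \<beta>) \<and>
       E = op_q h (\<Sum>\<beta>\<in>B. emb (a' \<beta>) * d_mon \<beta>))"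

definition quantize ::
  "complex \<Rightarrow> (coord free set \<Rightarrow> coord free set) \<Rightarrow> opgen free set \<Rightarrow> opgen free set"
  where "quantize h \<alpha> D = (THE E. is_quantization h \<alpha> D E)"

definition Q_op :: "opgen free"
  where "Q_op = xo * dx + yo * dy + zo * dz"

definition Lap :: "opgen free"
  where "Lap = dx^2 + dy^2 + dz^2"

definition box_LB :: "ratfun1 \<Rightarrow> opgen free"
  where "box_LB \<phi> = (let f = at_r \<phi>; f' = at_r (deriv_rat \<phi>); r = r_var in
    scal (inverse f) * dt^2
    - scal ((f - 1) / r^2) * Q_op^2
    - scal (1 / r * ((f - 1) / r + f')) * Q_op
    - Lap)"


section \<open>The action of invariant operators\<close>

definition Cas :: "complex \<Rightarrow> ratfun2"
  where "Cas h = r_var ^ 2 - const (h^2)"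

definition mu :: ratfun2
  where "mu = const (2 * \<i>) * r_var"

definition Phi_mat :: "complex \<Rightarrow> ratfun2 ^ 2 ^ 2"
  where "Phi_mat h = (let H = const (hbar h); C = Cas h in
    vector [vector [C - 3/4 * H^2, - H],
            vector [H * C, C + H^2 / 4]])"

definition Pi_mat :: "complex \<Rightarrow> ratfun2 ^ 4 ^ 4"
  where "Pi_mat h = (let H = const (hbar h); C = Cas h in
    vector [vector [C - 3/2 * H^2, H^2 / 2, - 2 * H, 0],
            vector [3/2 * H^2, C - H^2 / 2, 2 * H, 0],
            vector [H * C, 0, C - H^2 / 2, - H],
            vector [H^2 * C, - (H^2 / 2) * C, H * (2 * C + H^2 / 4), C + H^2 / 2]])"

text \<open>The projector onto the eigenspace of \<open>c\<close> along the range of \<open>M - c\<close>.\<close>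

definition spectral_projector :: "'a::field ^ 'n ^ 'n \<Rightarrow> 'a \<Rightarrow> 'a ^ 'n ^ 'n"
  where "spectral_projector M c = (THE P. P ** P = P \<and>
    range (\<lambda>v. P *v v) = {v. M *v v = c *s v} \<and>
    {v. P *v v = 0} = range (\<lambda>v. M *v v - c *s v))"

text \<open>\<open>\<hbar>\<^sup>2 - (\<mu> + s \<hbar>)\<^sup>2\<close> divided by 4.\<close>

definition eigval :: "complex \<Rightarrow> complex \<Rightarrow> ratfun2"
  where "eigval h s = (const (hbar h) ^ 2 - (mu + const (s * hbar h)) ^ 2) / 4"

definition inv_ops1 :: "complex \<Rightarrow> opgen free ^ 2"
  where "inv_ops1 h = vector [dtt h, Q_op]"

definition inv_ops2 :: "complex \<Rightarrow> opgen free ^ 4"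
  where "inv_ops2 h = vector [dtt h ^ 2, Lap, Q_op * dtt h, Q_op ^ 2]"

text \<open>For \<open>u \<in> V\<^sup>k\<close>, the \<open>j\<close>-th operator of \<^const>\<open>inv_ops1\<close> (of \<^const>\<open>inv_ops2\<close>) sends \<open>F u\<close> to
  \<open>(inv_coeff1 h k F $ j) u\<close> (to \<open>(inv_coeff2 h k F $ j) u\<close>); for \<open>F = 1\<close> these are the values
  listed in the vectors \<open>w\<close>.\<close>

definition inv_coeff1 :: "complex \<Rightarrow> nat \<Rightarrow> ratfun2 \<Rightarrow> ratfun2 ^ 2"
  where "inv_coeff1 h k F =
    (let H = hbar h; w = vector [const (2 / H), of_nat k] in
      shift (H/2) (- H) F *s (spectral_projector (Phi_mat h) (eigval h (- 1)) *v w)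
      + shift (H/2) H F *s (spectral_projector (Phi_mat h) (eigval h 1) *v w))"

definition inv_coeff2 :: "complex \<Rightarrow> nat \<Rightarrow> ratfun2 \<Rightarrow> ratfun2 ^ 4"
  where "inv_coeff2 h k F =
    (let H = hbar h; w = vector [const (4 / H^2), 0, const (2 * of_nat k / H), of_nat k ^ 2] in
      shift H 0 F *s (spectral_projector (Pi_mat h) (eigval h 0) *v w)
      + shift H (2 * H) F *s (spectral_projector (Pi_mat h) (eigval h 2) *v w)
      + shift H (- 2 * H) F *s (spectral_projector (Pi_mat h) (eigval h (- 2)) *v w))"

text \<open>The operator \<open>D\<close> is a left linear combination of the invariant operators and of the identity,
  and \<open>L\<close> is the additive map on the whole quantum algebra that is given on each \<open>F u\<close> by the
  same left linear combination.\<close>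

definition acts_as ::
  "complex \<Rightarrow> opgen free set \<Rightarrow> (coord free set \<Rightarrow> coord free set) \<Rightarrow> bool"
  where "acts_as h D L \<longleftrightarrow>
    L \<in> carrier (A_q h) \<rightarrow>\<^sub>E carrier (A_q h) \<and>
    L \<in> hom (add_monoid (A_q h)) (add_monoid (A_q h)) \<and>
    (\<exists>c0 (c :: 2 \<Rightarrow> coord free) (d :: 4 \<Rightarrow> coord free).
       D = op_q h (emb c0 + (\<Sum>j\<in>UNIV. emb (c j) * inv_ops1 h $ j)
                          + (\<Sum>j\<in>UNIV. emb (d j) * inv_ops2 h $ j)) \<and>
       (\<forall>k F. \<forall>u\<in>V_q h k.
          L (smult_cls (rels_q h) F u) =
            (cls (rels_q h) c0 \<otimes>\<^bsub>A_q h\<^esub> smult_cls (rels_q h) F u) \<oplus>\<^bsub>A_q h\<^esub>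
            (\<Oplus>\<^bsub>A_q h\<^esub>j\<in>UNIV. cls (rels_q h) (c j) \<otimes>\<^bsub>A_q h\<^esub>
               smult_cls (rels_q h) (inv_coeff1 h k F $ j) u) \<oplus>\<^bsub>A_q h\<^esub>
            (\<Oplus>\<^bsub>A_q h\<^esub>j\<in>UNIV. cls (rels_q h) (d j) \<otimes>\<^bsub>A_q h\<^esub>
               smult_cls (rels_q h) (inv_coeff2 h k F $ j) u)))"

end

theory Submission
  imports Defs
begin

text \<open>For the formula: \<open>\<alpha>\<close> commutes with the derivations by which su(2) acts on both algebras, so it
  fixes the coordinates and the symmetric traceless quadratic products and sends \<open>x\<^sup>2\<close> to \<open>x\<^sup>2 + h\<^sup>2 / 3\<close>.
  Bringing \<open>Q\<^sup>2\<close> into normal order on both sides then gives the coefficients. That normally ordered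
  coefficients are unique follows from a right action of the letters on symbols, polynomials in four
  commuting derivatives over the free coordinate algebra: right multiplication by a coordinate is
  multiplication of the coefficients plus the derivation \<open>D \<mapsto> [D, x]\<close>.

  For the action: the vectors \<open>F\<^sup>j b\<^sup>k\<close>, where \<open>F\<close> lowers the weight, are simultaneous eigenvectors of
  the adjoint Casimir operator and of \<open>z\<close> with distinct pairs of eigenvalues, so the nonzero ones
  are independent over \<open>\<complex>(t, r)\<close>. They span, because \<open>b\<^sup>k z\<close> occurs in \<open>F b\<^sup>k\<^sup>+\<^sup>1\<close>, and \<open>b\<^sup>k c\<close> with
  \<open>c = y - \<i>x\<close> occurs in \<open>F (b\<^sup>k z)\<close>. Hence an additive map \<open>F u \<mapsto> g\<^sub>k(F) u\<close> exists for every family of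
  \<open>\<complex>\<close>-linear maps \<open>g\<^sub>k\<close>. It is determined by the operator since the invariant operators of order at
  most two are independent over the quantum algebra.\<close>

section \<open>Finitely supported functions\<close>

text \<open>Two choices in the statement call for uniqueness. \<open>quantize\<close> is a definite
  description, so a classical operator must determine its normally ordered coefficients;
  \<open>acts_as\<close> asks for some presentation by invariant operators, so the value on
  \<open>F u\<close> must not depend on it. As \<open>op_null\<close> is a right ideal that absorbs
  coordinates but not derivatives on the left, normal forms are read off by letting words act from
  the right on the symbol 1.

  The action shifts \<open>F\<close>, so it is only complex linear, and combinations of weight
  vectors must keep track of their coefficients. Some of these vectors vanish. Independence is
  therefore stated termwise: in a null combination each \<open>F w\<close> is null, and a nonzero
  \<open>F\<close> can be divided out. All cancellation in the quantum algebra is division by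
  nonzero elements of the field, notably Cas = r^2 - h^2 and r^2 - 4 h^2; the latter separates Q^2
  from the Laplacian.

  The coefficient of the Laplacian is -(1 - (hbar^2/12) g) with g = (f - 1)/r^2, because x^2 goes to
  x^2 - hbar^2/12. The English formula has the opposite sign before hbar^2/12.\<close>

definition linear_ext :: "('a \<Rightarrow> 'b::zero \<Rightarrow> 'c::comm_monoid_add) \<Rightarrow> ('a \<Rightarrow>\<^sub>0 'b) \<Rightarrow> 'c"
  where "linear_ext f p = (\<Sum>k\<in>Poly_Mapping.keys p. f k (Poly_Mapping.lookup p k))"

lemma linear_ext_superset:
  assumes "finite A" "Poly_Mapping.keys p \<subseteq> A" "\<And>k. f k 0 = 0"
  shows "linear_ext f p = (\<Sum>k\<in>A. f k (Poly_Mapping.lookup p k))"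
  unfolding linear_ext_def
  by (rule sum.mono_neutral_left) (use assms in \<open>auto simp: in_keys_iff\<close>)

lemma linear_ext_add:
  fixes f :: "'a \<Rightarrow> 'b::monoid_add \<Rightarrow> 'c::ab_group_add"
  assumes "\<And>k a b. f k (a + b) = f k a + f k b"
  shows "linear_ext f (p + q) = linear_ext f p + linear_ext f q"
proof -
  have f0: "f k 0 = 0" for k
    using assms[of k 0 0] by simp
  let ?A = "Poly_Mapping.keys p \<union> Poly_Mapping.keys q"
  have "Poly_Mapping.keys (p + q) \<subseteq> ?A"
    by (rule Poly_Mapping.keys_add)
  then show ?thesis
    by (simp add: linear_ext_superset[of ?A] f0 lookup_add assms sum.distrib)
qed

lemma linear_ext_single [simp]:
  assumes "f k 0 = 0"
  shows "linear_ext f (Poly_Mapping.single k a) = f k a"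
  using assms by (simp add: linear_ext_def)

lemma linear_ext_zero [simp]: "linear_ext f 0 = 0"
  by (simp add: linear_ext_def)

lemma poly_mapping_induct [case_names single add]:
  fixes p :: "'a \<Rightarrow>\<^sub>0 'b::monoid_add"
  assumes "\<And>k a. P (Poly_Mapping.single k a)" "\<And>p q. P p \<Longrightarrow> P q \<Longrightarrow> P (p + q)"
  shows "P p"
proof (induction p rule: update_induct)
  case const
  show ?case
    using assms(1)[of undefined 0] by simp
next
  case (update p k a)
  have "Poly_Mapping.update k a p = p + Poly_Mapping.single k a"
    using update(1) by (intro poly_mapping_eqI)
      (auto simp: lookup_update lookup_add lookup_single in_keys_iff when_def)
  then show ?case
    using assms update by simp
qed


section \<open>Free algebras\<close>

lemma scal_zero [simp]: "scal 0 = 0"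
  and scal_one [simp]: "scal 1 = 1"
  and scal_add: "scal (f + g) = scal f + scal g"
  and scal_diff: "scal (f - g) = scal f - scal g"
  and scal_uminus: "scal (- f) = - scal f"
  and scal_mult: "scal (f * g) = scal f * scal g"
  by (simp_all add: scal_def single_add single_diff single_uminus mult_single flip: single_one)

lemma const_zero [simp]: "const 0 = 0"
  and const_one [simp]: "const 1 = 1"
  and const_add: "const (a + b) = const a + const b"
  and const_diff: "const (a - b) = const a - const b"
  and const_uminus: "const (- a) = - const a"
  and const_mult: "const (a * b) = const a * const b"
  by (simp_all add: const_def to_fract_add[symmetric] to_fract_diff[symmetric]
      to_fract_uminus[symmetric] to_fract_mult[symmetric] one_pCons[symmetric])

lemma const_eq_0_iff [simp]: "const a = 0 \<longleftrightarrow> a = 0"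
  by (simp add: const_def)

lemma const_power: "const (a ^ n) = const a ^ n"
  by (induction n) (simp_all add: const_mult)

lemma const_of_nat [simp]: "const (of_nat n) = of_nat n"
  by (induction n) (simp_all add: const_add)

lemma const_numeral [simp]: "const (numeral n) = numeral n"
  using const_of_nat[of "numeral n"] by simp

lemma cscal_zero [simp]: "cscal 0 = 0"
  and cscal_one [simp]: "cscal 1 = 1"
  and cscal_add: "cscal (a + b) = cscal a + cscal b"
  and cscal_diff: "cscal (a - b) = cscal a - cscal b"
  and cscal_uminus: "cscal (- a) = - cscal a"
  and cscal_mult: "cscal (a * b) = cscal a * cscal b"
  by (simp_all add: cscal_def const_add const_diff const_uminus const_mult
      scal_add scal_diff scal_uminus scal_mult)

lemma scal_numeral: "scal (numeral n) = numeral n"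
  by (simp add: scal_def)

lemma cscal_numeral: "cscal (numeral n) = numeral n"
  by (simp add: cscal_def scal_numeral)

text \<open>In the free ring coefficients commute with all words, derivatives included. That
  rational functions do not commute with derivatives as operators is reflected only in
  \<open>op_null\<close>, which is not a two-sided ideal.\<close>

lemma scal_central: "p * scal f = scal f * p"
  by (induction p rule: poly_mapping_induct) (simp_all add: scal_def mult_single mult.commute algebra_simps)

lemma scal_left_commute: "p * (scal f * q) = scal f * (p * q)"
  by (metis mult.assoc scal_central)

lemma cscal_central: "p * cscal c = cscal c * p"
  and cscal_left_commute: "p * (cscal c * q) = cscal c * (p * q)"
  by (simp_all add: cscal_def scal_central scal_left_commute)

lemma monom_word_append: "monom_word (Word (u @ v)) = monom_word (Word u) * monom_word (Word v)"
  by (simp add: monom_word_def mult_single plus_word_def)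

lemma monom_word_Nil [simp]: "monom_word (Word []) = 1"
  by (simp add: monom_word_def flip: zero_word_def)

lemma monom_word_Cons: "monom_word (Word (g # v)) = gen g * monom_word (Word v)"
  by (simp add: gen_def flip: monom_word_append)

lemma single_eq_scal_monom: "Poly_Mapping.single w c = scal c * monom_word w"
  by (simp add: scal_def monom_word_def mult_single)

text \<open>Words grow at the right end because the later arguments concern right multiplication:
  the span of the weight vectors as a right ideal, and words acting on symbols from the
  right.\<close>

lemma free_induct [case_names scal gen add]:
  assumes "\<And>c. P (scal c)" "\<And>p g. P p \<Longrightarrow> P (p * gen g)" "\<And>p q. P p \<Longrightarrow> P q \<Longrightarrow> P (p + q)"
  shows "P p"
proof (induction p rule: poly_mapping_induct)
  case (single w c)
  obtain l where w: "w = Word l"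
    by (cases w)
  have "P (scal c * monom_word (Word l))"
    by (induction l rule: rev_induct)
       (use assms in \<open>simp_all add: monom_word_append mult.assoc[symmetric] flip: gen_def\<close>)
  then show ?case
    by (simp add: w single_eq_scal_monom)
qed (use assms in auto)

section \<open>Derivations of the free algebra\<close>

lemma derive_letters_append:
  "derive_letters d (u @ v) = derive_letters d u * monom_word (Word v) + monom_word (Word u) * derive_letters d v"
  by (induction u) (simp_all add: monom_word_append monom_word_Cons algebra_simps)

lemma derivation_eq: "derivation d = linear_ext (\<lambda>w c. scal c * derive_letters d (letters w))"
  by (simp add: fun_eq_iff derivation_def linear_ext_def)

lemma derivation_add: "derivation d (p + q) = derivation d p + derivation d q"
  unfolding derivation_eq by (rule linear_ext_add) (simp add: scal_add distrib_right)

lemma additive_derivation: "Modules.additive (derivation d)"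
  by standard (rule derivation_add)

lemmas derivation_zero = Modules.additive.zero[OF additive_derivation]
  and derivation_diff = Modules.additive.diff[OF additive_derivation]
  and derivation_uminus = Modules.additive.minus[OF additive_derivation]

lemma derivation_single:
  "derivation d (Poly_Mapping.single w c) = scal c * derive_letters d (letters w)"
  by (simp add: derivation_eq)

lemma derivation_scal [simp]: "derivation d (scal c) = 0"
  by (simp add: scal_def derivation_single zero_word_def)

lemma derivation_cscal [simp]: "derivation d (cscal c) = 0"
  by (simp add: cscal_def)

lemma derivation_one [simp]: "derivation d 1 = 0"
  using derivation_scal[of d 1] by simp

lemma derivation_gen [simp]: "derivation d (gen g) = d g"
  by (simp add: gen_def monom_word_def derivation_single flip: zero_word_def)

lemma derivation_mult: "derivation d (p * q) = derivation d p * q + p * derivation d q"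
proof (induction p rule: poly_mapping_induct)
  case (single w c)
  show ?case
  proof (induction q rule: poly_mapping_induct)
    case (single w' c')
    show ?case
    proof (cases w; cases w')
      fix u v
      assume "w = Word u" "w' = Word v"
      then show ?thesis
        by (simp add: mult_single derivation_single plus_word_def derive_letters_append)
           (simp add: single_eq_scal_monom scal_mult scal_left_commute[of "monom_word _"]
             scal_left_commute[of "derive_letters _ _"] distrib_left mult.assoc)
    qed
  qed (simp_all add: derivation_add algebra_simps)
qed (simp_all add: derivation_add algebra_simps)

lemma derivation_scal_mult [simp]: "derivation d (scal c * p) = scal c * derivation d p"
  by (simp add: derivation_mult)

lemma derivation_cscal_mult [simp]: "derivation d (cscal c * p) = cscal c * derivation d p"
  by (simp add: derivation_mult)

lemma derivation_power_eigen:
  assumes "derivation d b = cscal c * b"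
  shows "derivation d (b ^ n) = cscal (of_nat n * c) * b ^ n"
  by (induction n)
     (simp_all add: derivation_mult assms cscal_left_commute[of b] cscal_add distrib_right mult.assoc)

text \<open>Meant for commutators of two derivations, which satisfy the Leibniz rule although the
  two composites do not.\<close>

lemma derivation_eqI:
  assumes "Modules.additive f" "\<And>p q. f (p * q) = f p * q + p * f q" "\<And>c. f (scal c) = 0"
    and "\<And>g. f (gen g) = d g"
  shows "f p = derivation d p"
  by (induction p rule: free_induct)
     (simp_all add: assms Modules.additive.add[OF assms(1)] derivation_mult derivation_add)

section \<open>Coordinate words as operators\<close>

lemma emb_eq: "emb = linear_ext (\<lambda>w c. Poly_Mapping.single (Word (map Pos (letters w))) c)"
  by (simp add: fun_eq_iff emb_def linear_ext_def)

lemma emb_add: "emb (p + q) = emb p + emb q"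
  unfolding emb_eq by (rule linear_ext_add) (simp add: single_add)

lemma additive_emb: "Modules.additive emb"
  by standard (rule emb_add)

lemmas emb_zero [simp] = Modules.additive.zero[OF additive_emb]
  and emb_diff = Modules.additive.diff[OF additive_emb]
  and emb_uminus = Modules.additive.minus[OF additive_emb]

lemma emb_single: "emb (Poly_Mapping.single w c) = Poly_Mapping.single (Word (map Pos (letters w))) c"
  by (simp add: emb_eq)

lemma emb_scal [simp]: "emb (scal c) = scal c"
  by (simp add: scal_def emb_single zero_word_def)

lemma emb_cscal [simp]: "emb (cscal c) = cscal c"
  by (simp add: cscal_def)

lemma emb_one [simp]: "emb 1 = 1"
  using emb_scal[of 1] by simp

lemma emb_gen [simp]: "emb (gen g) = gen (Pos g)"
  by (simp add: gen_def monom_word_def emb_single)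

lemma emb_mult: "emb (p * q) = emb p * emb q"
proof (induction p rule: poly_mapping_induct)
  case (single w c)
  show ?case
    by (induction q rule: poly_mapping_induct)
       (simp_all add: mult_single emb_single plus_word_def emb_add algebra_simps)
qed (simp_all add: emb_add algebra_simps)

lemma emb_power: "emb (p ^ n) = emb p ^ n"
  by (induction n) (simp_all add: emb_mult)

section \<open>Presented algebras\<close>

abbreviation rel_ideal :: "'g free set \<Rightarrow> 'g free set"
  where "rel_ideal R \<equiv> Idl\<^bsub>free_ring\<^esub> R"

lemma free_ring_simps [simp]:
  "carrier free_ring = UNIV" "x \<otimes>\<^bsub>free_ring\<^esub> y = x * y" "x \<oplus>\<^bsub>free_ring\<^esub> y = x + y"
  "\<one>\<^bsub>free_ring\<^esub> = 1" "\<zero>\<^bsub>free_ring\<^esub> = 0"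
  by (simp_all add: free_ring_def)

lemma ring_free_ring: "ring (free_ring :: 'g free ring)"
proof (rule ringI)
  show "abelian_group (free_ring :: 'g free ring)"
    by (rule abelian_groupI) (auto simp: add.assoc add.commute intro: exI[of _ "- x" for x])
  show "monoid (free_ring :: 'g free ring)"
    by (rule monoidI) (auto simp: mult.assoc)
qed (auto simp: algebra_simps)

lemma a_inv_free_ring [simp]: "\<ominus>\<^bsub>free_ring\<^esub> (x :: 'g free) = - x"
proof -
  interpret ring "free_ring :: 'g free ring"
    by (rule ring_free_ring)
  show ?thesis
    using minus_equality[of "- x" x] by simp
qed

lemma ideal_rel_ideal: "ideal (rel_ideal R) free_ring"
  using ring.genideal_ideal[OF ring_free_ring, of R] by simp

lemma rel_ideal_base: "p \<in> R \<Longrightarrow> p \<in> rel_ideal R"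
  using ring.genideal_self[OF ring_free_ring, of R] by auto

lemma rel_ideal_lmult: "p \<in> rel_ideal R \<Longrightarrow> q * p \<in> rel_ideal R"
  using ideal.I_l_closed[OF ideal_rel_ideal, of p R q] by simp

lemma rel_ideal_rmult: "p \<in> rel_ideal R \<Longrightarrow> p * q \<in> rel_ideal R"
  using ideal.I_r_closed[OF ideal_rel_ideal, of p R q] by simp

lemma rel_ideal_zero [simp]: "0 \<in> rel_ideal R"
  using additive_subgroup.zero_closed[OF ideal.axioms(1)[OF ideal_rel_ideal[of R]]] by simp

lemma rel_ideal_add: "p \<in> rel_ideal R \<Longrightarrow> q \<in> rel_ideal R \<Longrightarrow> p + q \<in> rel_ideal R"
  using additive_subgroup.a_closed[OF ideal.axioms(1)[OF ideal_rel_ideal[of R]]] by simp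

lemma rel_ideal_uminus: "p \<in> rel_ideal R \<Longrightarrow> - p \<in> rel_ideal R"
  using rel_ideal_lmult[of p R "- 1"] by simp

lemma rel_ideal_diff: "p \<in> rel_ideal R \<Longrightarrow> q \<in> rel_ideal R \<Longrightarrow> p - q \<in> rel_ideal R"
  using rel_ideal_add[of p R "- q"] rel_ideal_uminus[of q R] by simp

lemma rel_ideal_sum: "(\<And>i. i \<in> A \<Longrightarrow> f i \<in> rel_ideal R) \<Longrightarrow> sum f A \<in> rel_ideal R"
  by (induction A rule: infinite_finite_induct) (simp_all add: rel_ideal_add)

text \<open>Serves as induction over the ideal: \<open>J\<close> is taken to be the set of elements
  with the desired property. Negatives come from left multiplication by -1.\<close>

lemma rel_ideal_minimal:
  assumes "R \<subseteq> J" "0 \<in> J" "\<And>p q. p \<in> J \<Longrightarrow> q \<in> J \<Longrightarrow> p + q \<in> J"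
    and "\<And>p q. p \<in> J \<Longrightarrow> q * p \<in> J" "\<And>p q. p \<in> J \<Longrightarrow> p * q \<in> J"
  shows "rel_ideal R \<subseteq> J"
proof (rule ring.genideal_minimal[OF ring_free_ring _ assms(1)])
  have neg: "- p \<in> J" if "p \<in> J" for p
    using assms(4)[OF that, of "- 1"] by simp
  interpret r: ring "free_ring :: 'a free ring"
    by (rule ring_free_ring)
  show "ideal J free_ring"
  proof (rule idealI)
    show "subgroup J (add_monoid free_ring)"
      by (rule r.add.subgroupI) (use assms neg in \<open>auto simp flip: a_inv_def\<close>)
  qed (use assms in \<open>auto simp: ring_free_ring\<close>)
qed

lemma cls_eq_iff: "cls R p = cls R q \<longleftrightarrow> p - q \<in> rel_ideal R"
proof -
  interpret ideal "rel_ideal R" free_ring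
    by (rule ideal_rel_ideal)
  show ?thesis
    using quotient_eq_iff_same_a_r_cos[OF ideal_rel_ideal, of p q]
    by (simp add: cls_def a_minus_def)
qed

lemma carrier_presented: "carrier (presented R) = range (cls R)"
  by (auto simp: presented_def FactRing_def cls_def A_RCOSETS_def' )

lemma cls_mult: "cls R p \<otimes>\<^bsub>presented R\<^esub> cls R q = cls R (p * q)"
  using ideal.rcoset_mult_add[OF ideal_rel_ideal, of p q R]
  by (simp add: presented_def FactRing_def cls_def)

lemma cls_add: "cls R p \<oplus>\<^bsub>presented R\<^esub> cls R q = cls R (p + q)"
  using ideal.a_rcos_sum[OF ideal_rel_ideal, of p q R]
  by (simp add: presented_def FactRing_def cls_def)

lemma cls_zero: "\<zero>\<^bsub>presented R\<^esub> = cls R 0"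
  using ring_hom_zero[OF ideal.rcos_ring_hom[OF ideal_rel_ideal] ring_free_ring
      ideal.quotient_is_ring[OF ideal_rel_ideal], of R]
  by (simp add: presented_def cls_def)

lemma ring_presented: "ring (presented R)"
  unfolding presented_def by (rule ideal.quotient_is_ring[OF ideal_rel_ideal])

lemma cls_in_carrier [simp]: "cls R p \<in> carrier (presented R)"
  by (simp add: carrier_presented)

lemma cls_diff: "cls R p \<ominus>\<^bsub>presented R\<^esub> cls R q = cls R (p - q)"
proof -
  interpret ring "presented R"
    by (rule ring_presented)
  have "cls R (- q) \<oplus>\<^bsub>presented R\<^esub> cls R q = \<zero>\<^bsub>presented R\<^esub>"
    by (simp add: cls_add cls_zero)
  then have "\<ominus>\<^bsub>presented R\<^esub> cls R q = cls R (- q)"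
    by (intro minus_equality) auto
  then show ?thesis
    by (simp add: minus_eq cls_add)
qed

lemma smult_cls_cls: "smult_cls R f (cls R p) = cls R (scal f * p)"
  by (simp add: smult_cls_def cls_mult)

lemma cls_finsum:
  assumes "finite A"
  shows "(\<Oplus>\<^bsub>presented R\<^esub>j\<in>A. cls R (f j)) = cls R (\<Sum>j\<in>A. f j)"
proof -
  interpret ring "presented R"
    by (rule ring_presented)
  show ?thesis
    using assms by (induction A rule: finite_induct) (simp_all add: cls_zero cls_add finsum_insert)
qed

section \<open>The decomposition of the quantum algebra\<close>

declare derivation_zero [simp] derivation_uminus [simp]

lemma cscal_double: "cscal (2 * c) * p = cscal c * p + cscal c * p"
  by (simp only: mult_2 cscal_add distrib_right)

section \<open>The adjoint action of su(2), lifted to the free algebra\<close>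

abbreviation su2_der :: "coord \<Rightarrow> coord free \<Rightarrow> coord free"
  where "su2_der g \<equiv> derivation (su2_bracket g)"

text \<open>Both sides are derivations, so it is enough to compare them on the three generators,
  where this is the Jacobi identity of su(2).\<close>

lemma su2_der_commutator:
  "su2_der CX (su2_der CY p) - su2_der CY (su2_der CX p) = su2_der CZ p"
  "su2_der CY (su2_der CZ p) - su2_der CZ (su2_der CY p) = su2_der CX p"
  "su2_der CZ (su2_der CX p) - su2_der CX (su2_der CZ p) = su2_der CY p"
proof -
  have *: "su2_der a (su2_der b p) - su2_der b (su2_der a p) = su2_der c p"
    if "\<And>g. su2_der a (su2_bracket b g) - su2_der b (su2_bracket a g) = su2_bracket c g" for a b c
    by (rule derivation_eqI[of "\<lambda>p. su2_der a (su2_der b p) - su2_der b (su2_der a p)"])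
       (simp_all add: Modules.additive_def derivation_add derivation_mult that algebra_simps)
  show "su2_der CX (su2_der CY p) - su2_der CY (su2_der CX p) = su2_der CZ p"
    by (rule *) (case_tac g; simp add: derivation_uminus derivation_zero)
  show "su2_der CY (su2_der CZ p) - su2_der CZ (su2_der CY p) = su2_der CX p"
    by (rule *) (case_tac g; simp add: derivation_uminus derivation_zero)
  show "su2_der CZ (su2_der CX p) - su2_der CX (su2_der CZ p) = su2_der CY p"
    by (rule *) (case_tac g; simp add: derivation_uminus derivation_zero)
qed

text \<open>The ladder operators for \<open>su2_der CZ\<close>: \<open>lower\<close> subtracts \<i>
  from an eigenvalue, and \<open>b_vec\<close> is the vector of eigenvalue \<i> among the linear
  ones.\<close>

definition lower :: "coord free \<Rightarrow> coord free"
  where "lower p = su2_der CX p + cscal \<i> * su2_der CY p"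

definition raise :: "coord free \<Rightarrow> coord free"
  where "raise p = su2_der CX p - cscal \<i> * su2_der CY p"

lemma lower_add: "lower (p + q) = lower p + lower q"
  and lower_mult: "lower (p * q) = lower p * q + p * lower q"
  and lower_cscal_mult: "lower (cscal c * p) = cscal c * lower p"
  by (simp_all add: lower_def derivation_add derivation_mult cscal_left_commute[of p] algebra_simps
      cscal_left_commute[of "cscal \<i>" c])

lemma raise_mult: "raise (p * q) = raise p * q + p * raise q"
  by (simp add: raise_def derivation_add derivation_mult cscal_left_commute[of p] algebra_simps)

lemma raise_cscal_mult: "raise (cscal c * p) = cscal c * raise p"
  by (simp add: raise_def derivation_mult algebra_simps cscal_left_commute[of "cscal \<i>" c])

lemma lower_diff: "lower (p - q) = lower p - lower q"
  using lower_add[of "p - q" q] by simp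

lemma lower_zero [simp]: "lower 0 = 0"
  by (simp add: lower_def)

lemma cscal_i_i: "cscal \<i> * (cscal \<i> * p) = - p"
  by (simp add: cscal_uminus flip: mult.assoc cscal_mult)

lemma weight_lower: "su2_der CZ (lower p) = lower (su2_der CZ p) - cscal \<i> * lower p"
  using su2_der_commutator[of p]
  by (simp add: lower_def derivation_add distrib_left cscal_i_i algebra_simps)

lemma raise_lower: "raise (lower p) = lower (raise p) + cscal (2 * \<i>) * su2_der CZ p"
proof -
  have "raise (lower p) - lower (raise p) =
      cscal \<i> * (su2_der CX (su2_der CY p) - su2_der CY (su2_der CX p)) +
      cscal \<i> * (su2_der CX (su2_der CY p) - su2_der CY (su2_der CX p))"
    by (simp add: lower_def raise_def derivation_add derivation_diff algebra_simps)
  also have "\<dots> = cscal (2 * \<i>) * su2_der CZ p"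
    unfolding su2_der_commutator by (simp only: cscal_double)
  finally show ?thesis
    by (simp add: algebra_simps)
qed

text \<open>This is the sum of the squares of the three derivations, since (X + iY)(X - iY) = X^2 +
  Y^2 - iZ for the derivations X, Y, Z. In this form the first term vanishes on highest weight
  vectors.\<close>

definition ad_casimir :: "coord free \<Rightarrow> coord free"
  where "ad_casimir p = lower (raise p) + cscal \<i> * su2_der CZ p + su2_der CZ (su2_der CZ p)"

lemma ad_casimir_lower: "ad_casimir (lower p) = lower (ad_casimir p)"
  by (simp add: ad_casimir_def raise_lower weight_lower lower_add lower_diff lower_cscal_mult
      derivation_diff cscal_double cscal_i_i add_diff_eq diff_add_eq diff_diff_eq2 distrib_left right_diff_distrib)

text \<open>The index \<open>j\<close> is not bounded by 2k. Vectors beyond the lowest weight give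
  only null terms, which termwise independence tolerates.\<close>

definition weight_vec :: "nat \<Rightarrow> nat \<Rightarrow> coord free"
  where "weight_vec k j = (lower ^^ j) (b_vec ^ k)"

lemma weight_vec_0: "weight_vec k 0 = b_vec ^ k"
  and weight_vec_Suc: "weight_vec k (Suc j) = lower (weight_vec k j)"
  by (simp_all add: weight_vec_def)

lemma raise_b_power [simp]: "raise (b_vec ^ k) = 0"
proof -
  have "raise b_vec = 0"
    by (simp add: raise_def b_vec_def derivation_diff cscal_i_i)
  then show ?thesis
    by (induction k) (simp_all add: raise_mult, simp add: raise_def)
qed

lemma weight_b_power: "su2_der CZ (b_vec ^ k) = cscal (of_nat k * \<i>) * b_vec ^ k"
  by (rule derivation_power_eigen)
     (simp add: b_vec_def derivation_diff cscal_i_i algebra_simps)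

lemma weight_weight_vec:
  "su2_der CZ (weight_vec k j) = cscal (\<i> * (of_nat k - of_nat j)) * weight_vec k j"
proof (induction j)
  case 0
  show ?case
    by (simp add: weight_vec_0 weight_b_power mult.commute)
next
  case (Suc j)
  have "su2_der CZ (weight_vec k (Suc j)) =
      cscal (\<i> * (of_nat k - of_nat j) - \<i>) * weight_vec k (Suc j)"
    by (simp only: weight_vec_Suc weight_lower Suc lower_cscal_mult cscal_diff left_diff_distrib)
  also have "\<i> * (of_nat k - of_nat j) - \<i> = \<i> * (of_nat k - of_nat (Suc j))"
    by (simp add: algebra_simps)
  finally show ?case .
qed

text \<open>The Casimir operator commutes with \<open>lower\<close>, so only its value on b^k
  counts: with weight ik it is i(ik) + (ik)^2 = -k(k + 1).\<close>

lemma ad_casimir_weight_vec: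
  "ad_casimir (weight_vec k j) = cscal (- of_nat k * (of_nat k + 1)) * weight_vec k j"
proof (induction j)
  case 0
  have "ad_casimir (b_vec ^ k) = cscal (\<i> * (of_nat k * \<i>) + (of_nat k * \<i>) * (of_nat k * \<i>)) * b_vec ^ k"
    by (simp add: ad_casimir_def weight_b_power cscal_mult cscal_add distrib_right mult.assoc)
  also have "\<i> * (of_nat k * \<i>) + (of_nat k * \<i>) * (of_nat k * \<i>) = - of_nat k * (of_nat k + 1)"
    by (simp add: algebra_simps)
  finally show ?case
    by (simp add: weight_vec_0)
qed (simp add: weight_vec_Suc ad_casimir_lower lower_cscal_mult)

lemma raise_weight_vec: "\<exists>e. raise (weight_vec k j) = cscal e * weight_vec k (j - 1)"
proof (induction j)
  case 0
  show ?case
    by (rule exI[of _ 0]) (simp add: weight_vec_0)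
next
  case (Suc j)
  then obtain e where e: "raise (weight_vec k j) = cscal e * weight_vec k (j - 1)"
    by blast
  \<comment> \<open>At j = 0 the truncated j - 1 is 0, and \<open>lower\<close> would lead to index
    1 instead of back to 0. There raise b^k = 0, so the coefficient is set to 0. The witness below
    adds 2i times the weight, from \<open>raise_lower\<close>.\<close>
  have "lower (raise (weight_vec k j)) = cscal (if j = 0 then 0 else e) * weight_vec k j"
    using e by (cases j) (auto simp: lower_cscal_mult weight_vec_Suc weight_vec_0)
  then show ?case
    by (intro exI[of _ "(if j = 0 then 0 else e) + 2 * \<i> * (\<i> * (of_nat k - of_nat j))"])
       (simp only: weight_vec_Suc raise_lower weight_weight_vec cscal_add distrib_right
         cscal_mult[of "2 * \<i>"] mult.assoc[of "cscal (2 * \<i>)"] diff_Suc_1)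
qed

lemma su2_der_CX: "su2_der CX p = cscal (1 / 2) * raise p + cscal (1 / 2) * lower p"
proof -
  have "raise p + lower p = cscal 2 * su2_der CX p"
    by (simp add: raise_def lower_def cscal_numeral mult_2)
  then have "cscal (1 / 2) * (raise p + lower p) = cscal (1 / 2 * 2) * su2_der CX p"
    by (simp only: cscal_mult mult.assoc)
  then show ?thesis
    by (simp add: distrib_left)
qed

lemma su2_der_CY: "su2_der CY p = cscal (\<i> / 2) * raise p - cscal (\<i> / 2) * lower p"
proof -
  have "raise p - lower p = cscal (- 2 * \<i>) * su2_der CY p"
    by (simp add: raise_def lower_def cscal_uminus cscal_double)
  then have "cscal (\<i> / 2) * (raise p - lower p) = cscal (\<i> / 2 * (- 2 * \<i>)) * su2_der CY p"
    by (simp only: cscal_mult mult.assoc)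
  then show ?thesis
    by (simp add: right_diff_distrib)
qed


text \<open>The usual elimination, carried out modulo an ideal: T - l(a) removes the summand
  \<open>a\<close> and multiplies the others by nonzero constants. Summands may vanish, so the
  conclusion is that each of them is null.\<close>

lemma eigenvectors_independent:
  assumes fin: "finite A"
    and "(\<Sum>i\<in>A. w i) \<in> rel_ideal R"
    and "\<And>p q. T (p + q) = T p + T q" "\<And>p. p \<in> rel_ideal R \<Longrightarrow> T p \<in> rel_ideal R"
    and "\<And>c p. T (cscal c * p) = cscal c * T p"
    and "\<And>i. i \<in> A \<Longrightarrow> T (w i) = cscal (l i) * w i" "inj_on l A" "i \<in> A"
  shows "w i \<in> rel_ideal R"
  using fin assms(2,6-8)
proof (induction A arbitrary: w i rule: finite_induct)
  case (insert a A)
  have T_sum: "T (\<Sum>i\<in>B. f i) = (\<Sum>i\<in>B. T (f i))" if "finite B" for B :: "'a set" and f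
    using that
  proof (induction B rule: finite_induct)
    case empty
    show ?case
      using assms(3)[of 0 0] by simp
  qed (simp add: assms(3))
  let ?S = "\<Sum>i\<in>insert a A. w i"
  have "T ?S = (\<Sum>i\<in>insert a A. T (w i))"
    using insert.hyps(1) by (intro T_sum) simp
  also have "\<dots> = (\<Sum>i\<in>insert a A. cscal (l i) * w i)"
    by (intro sum.cong refl insert.prems(2))
  finally have "T ?S - cscal (l a) * ?S =
      (\<Sum>i\<in>insert a A. cscal (l i) * w i) - (\<Sum>i\<in>insert a A. cscal (l a) * w i)"
    unfolding sum_distrib_left by (rule arg_cong)
  also have "\<dots> = (\<Sum>i\<in>insert a A. cscal (l i - l a) * w i)"
    unfolding sum_subtractf[symmetric] cscal_diff left_diff_distrib ..
  also have "\<dots> = (\<Sum>i\<in>A. cscal (l i - l a) * w i)"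
    using insert by simp
  finally have sum': "(\<Sum>i\<in>A. cscal (l i - l a) * w i) \<in> rel_ideal R"
    using rel_ideal_diff[OF assms(4)[OF insert.prems(1)] rel_ideal_lmult[OF insert.prems(1)]]
    by (rule subst)
  have A: "w j \<in> rel_ideal R" if "j \<in> A" for j
  proof -
    have "cscal (l j - l a) * w j \<in> rel_ideal R"
    proof (rule insert.IH[OF sum' _ _ that])
      show "inj_on l A"
        using insert.prems by (auto simp: inj_on_def)
      show "T (cscal (l i - l a) * w i) = cscal (l i) * (cscal (l i - l a) * w i)" if "i \<in> A" for i
        using insert.prems(2)[of i] that
        by (simp add: assms(5) cscal_left_commute[of "cscal _"])
    qed
    then have "cscal (inverse (l j - l a)) * (cscal (l j - l a) * w j) \<in> rel_ideal R"
      by (rule rel_ideal_lmult)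
    moreover have "l j \<noteq> l a"
      using insert that by (auto simp: inj_on_def)
    ultimately show ?thesis
      by (simp flip: mult.assoc cscal_mult)
  qed
  have "w a = ?S - (\<Sum>i\<in>A. w i)"
    using insert by simp
  then have "w a \<in> rel_ideal R"
    using insert.prems(1) rel_ideal_sum[of A w R] A rel_ideal_diff by metis
  with A insert.prems(4) show ?case
    by auto
qed simp


text \<open>Formal combinations with coefficients in the field of rational functions. The quantum
  algebra is the image modulo the relations, and \<open>eval_vec_in_ideal\<close> describes the
  kernel.\<close>

definition eval_vec :: "(nat \<times> nat \<Rightarrow>\<^sub>0 ratfun2) \<Rightarrow> coord free"
  where "eval_vec = linear_ext (\<lambda>(k, j) F. scal F * weight_vec k j)"

lemma eval_vec_add: "eval_vec (f + g) = eval_vec f + eval_vec g"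
  unfolding eval_vec_def by (rule linear_ext_add) (auto simp: scal_add distrib_right)

lemma eval_vec_single: "eval_vec (Poly_Mapping.single (k, j) F) = scal F * weight_vec k j"
  by (simp add: eval_vec_def)

lemma additive_eval_vec: "Modules.additive eval_vec"
  by standard (rule eval_vec_add)

lemma eval_vec_scale: "\<exists>g. scal F * eval_vec f = eval_vec g"
proof (induction f rule: poly_mapping_induct)
  case (single i G)
  show ?case
    by (cases i; intro exI[of _ "Poly_Mapping.single i (F * G)"])
       (simp add: eval_vec_single scal_mult mult.assoc)
next
  case (add p q)
  then show ?case
    by (metis eval_vec_add distrib_left)
qed

section \<open>Inner derivations of the quantum algebra and independence of the weight
  vectors\<close>

context
  fixes h :: complex
  assumes h: "hbar h \<noteq> 0"
begin

abbreviation I_q where "I_q \<equiv> rel_ideal (rels_q h)"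

lemma bracket_in_ideal: "commutator (gen g) (gen g') - cscal (hbar h) * su2_bracket g g' \<in> I_q"
proof -
  have base: "commutator X Y - cscal (hbar h) * Z \<in> I_q" "commutator Y Z - cscal (hbar h) * X \<in> I_q"
    "commutator Z X - cscal (hbar h) * Y \<in> I_q"
    by (auto intro!: rel_ideal_base simp: rels_q_def)
  note base = base base[THEN rel_ideal_uminus]
  show ?thesis
    by (cases g; cases g') (use base in \<open>simp_all add: commutator_def algebra_simps\<close>)
qed

text \<open>Both terms are derivations that agree on generators modulo the relations. As hbar is
  invertible, \<open>su2_der\<close> is thus inner up to the ideal and preserves it.\<close>

lemma su2_der_inner: "cscal (hbar h) * su2_der g p - commutator (gen g) p \<in> I_q"
proof (induction p rule: free_induct)
  case (scal c)
  show ?case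
    by (simp add: commutator_def scal_central[of "gen g"])
next
  case (gen p g')
  have "cscal (hbar h) * su2_der g (p * gen g') - commutator (gen g) (p * gen g') =
      (cscal (hbar h) * su2_der g p - commutator (gen g) p) * gen g' -
      p * (commutator (gen g) (gen g') - cscal (hbar h) * su2_bracket g g')"
    by (simp add: derivation_mult commutator_def cscal_left_commute[of p] algebra_simps)
  then show ?case
    using gen bracket_in_ideal by (simp add: rel_ideal_diff rel_ideal_lmult rel_ideal_rmult)
next
  case (add p q)
  have "cscal (hbar h) * su2_der g (p + q) - commutator (gen g) (p + q) =
      (cscal (hbar h) * su2_der g p - commutator (gen g) p) +
      (cscal (hbar h) * su2_der g q - commutator (gen g) q)"
    by (simp add: derivation_add commutator_def algebra_simps)
  with add show ?case
    by (simp add: rel_ideal_add)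
qed

lemma cscal_hbar_cancel: "cscal (hbar h) * p \<in> I_q \<Longrightarrow> p \<in> I_q"
  using rel_ideal_lmult[of "cscal (hbar h) * p" "rels_q h" "cscal (1 / hbar h)"] h
  by (simp flip: mult.assoc cscal_mult)

lemma su2_der_ideal: "p \<in> I_q \<Longrightarrow> su2_der g p \<in> I_q"
proof (rule cscal_hbar_cancel)
  assume p: "p \<in> I_q"
  have "commutator (gen g) p \<in> I_q"
    using p by (simp add: commutator_def rel_ideal_diff rel_ideal_lmult rel_ideal_rmult)
  then show "cscal (hbar h) * su2_der g p \<in> I_q"
    using rel_ideal_add[OF su2_der_inner[of g p]] by fastforce
qed

lemma act_q_cls: "act_q h g (cls (rels_q h) p) = cls (rels_q h) (su2_der g p)"
proof -
  have "act_q h g (cls (rels_q h) p) = cls (rels_q h) (cscal (1 / hbar h) * commutator (gen g) p)"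
    by (simp add: act_q_def A_q_def cls_mult cls_diff smult_cls_cls commutator_def cscal_def)
  also have "\<dots> = cls (rels_q h) (su2_der g p)"
  proof -
    have "cscal (1 / hbar h) * (commutator (gen g) p - cscal (hbar h) * su2_der g p) \<in> I_q"
      using rel_ideal_uminus[OF su2_der_inner[of g p]] by (intro rel_ideal_lmult) simp
    then show ?thesis
      using h by (simp add: cls_eq_iff right_diff_distrib flip: mult.assoc cscal_mult)
  qed
  finally show ?thesis .
qed

lemma lower_ideal: "p \<in> I_q \<Longrightarrow> lower p \<in> I_q"
  and raise_ideal: "p \<in> I_q \<Longrightarrow> raise p \<in> I_q"
  by (simp_all add: lower_def raise_def rel_ideal_add rel_ideal_diff rel_ideal_lmult su2_der_ideal)

text \<open>The Casimir operator and the weight are merged into one operator T, linear over the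
  rational functions. Its eigenvalue -k(k + 1) + i(k - j) has a real part that determines k and an
  imaginary part that then determines j.\<close>

lemma eval_vec_in_ideal:
  assumes "eval_vec f \<in> I_q"
  shows "scal (Poly_Mapping.lookup f (k, j)) * weight_vec k j \<in> I_q"
proof (cases "(k, j) \<in> Poly_Mapping.keys f")
  case True
  let ?w = "\<lambda>(k, j). scal (Poly_Mapping.lookup f (k, j)) * weight_vec k j"
  let ?T = "\<lambda>p. ad_casimir p + su2_der CZ p"
  let ?l = "\<lambda>(k, j). - of_nat k * (of_nat k + 1) + \<i> * (of_nat k - of_nat j) :: complex"
  have "?w (k, j) \<in> I_q"
  proof (rule eigenvectors_independent[where T = ?T and l = ?l and A = "Poly_Mapping.keys f"])
    show "(\<Sum>i\<in>Poly_Mapping.keys f. ?w i) \<in> I_q"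
      using assms by (simp add: eval_vec_def linear_ext_def case_prod_beta)
    show "?T (p + q) = ?T p + ?T q" for p q
      by (simp add: ad_casimir_def raise_def lower_def derivation_add derivation_diff algebra_simps)
    show "?T p \<in> I_q" if "p \<in> I_q" for p
      using that by (simp add: ad_casimir_def rel_ideal_add rel_ideal_lmult su2_der_ideal lower_ideal raise_ideal)
    show "?T (cscal c * p) = cscal c * ?T p" for c p
      by (simp add: ad_casimir_def raise_cscal_mult lower_cscal_mult cscal_left_commute[of "cscal \<i>"] distrib_left)
    show "?T (?w i) = cscal (?l i) * ?w i" for i
    proof -
      obtain k j where i: "i = (k, j)"
        by (cases i)
      define F :: "coord free" where "F = scal (Poly_Mapping.lookup f (k, j))"
      have F: "su2_der g (F * p) = F * su2_der g p" "p * (F * q) = F * (p * q)" for g and p q :: "coord free"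
        by (simp_all add: F_def scal_left_commute[of p])
      have "?T (F * p) = F * ?T p" for p
        by (simp add: ad_casimir_def lower_def raise_def F F(2)[of "cscal _"] derivation_diff
            derivation_add algebra_simps)
      then show ?thesis
        by (simp add: i ad_casimir_weight_vec weight_weight_vec cscal_add distrib_right
            F(2)[of "cscal _"] distrib_left flip: F_def)
    qed
    show "inj_on ?l (Poly_Mapping.keys f)"
    proof (rule inj_onI)
      fix a b
      assume eq: "?l a = ?l b"
      obtain k j k' j' where ab: "a = (k, j)" "b = (k', j')"
        by (cases a; cases b)
      have "real k * (real k + 1) = real k' * (real k' + 1)" "real k - real j = real k' - real j'"
        using eq by (simp_all add: ab complex_eq_iff)
      moreover from this(1) have "k * (k + 1) = k' * (k' + 1)"
        by (metis of_nat_1 of_nat_add of_nat_eq_iff of_nat_mult)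
      then have "k = k'"
        using mult_strict_mono[of k k' "k + 1" "k' + 1"] mult_strict_mono[of k' k "k' + 1" "k + 1"]
        by (cases k k' rule: linorder_cases) auto
      ultimately show "a = b"
        by (simp add: ab)
    qed
  qed (use True in auto)
  then show ?thesis
    by simp
qed (simp add: in_keys_iff)

section \<open>The weight vectors span the quantum algebra\<close>

definition spanned :: "coord free set"
  where "spanned = {p. \<exists>f. p - eval_vec f \<in> I_q}"

lemma spanned_add: "p \<in> spanned \<Longrightarrow> q \<in> spanned \<Longrightarrow> p + q \<in> spanned"
proof -
  assume "p \<in> spanned" "q \<in> spanned"
  then obtain f g where "p - eval_vec f \<in> I_q" "q - eval_vec g \<in> I_q"
    by (auto simp: spanned_def)
  then have "(p + q) - eval_vec (f + g) \<in> I_q"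
    using rel_ideal_add by (fastforce simp: eval_vec_add algebra_simps)
  then show ?thesis
    by (auto simp: spanned_def)
qed

lemma spanned_scal: "p \<in> spanned \<Longrightarrow> scal F * p \<in> spanned"
proof -
  assume "p \<in> spanned"
  then obtain f where "p - eval_vec f \<in> I_q"
    by (auto simp: spanned_def)
  then have "scal F * (p - eval_vec f) \<in> I_q"
    by (rule rel_ideal_lmult)
  then show ?thesis
    using eval_vec_scale[of F f] by (auto simp: spanned_def right_diff_distrib)
qed

lemma spanned_cscal: "p \<in> spanned \<Longrightarrow> cscal c * p \<in> spanned"
  by (simp add: cscal_def spanned_scal)

lemma spanned_diff: "p \<in> spanned \<Longrightarrow> q \<in> spanned \<Longrightarrow> p - q \<in> spanned"
  using spanned_add[of p "cscal (- 1) * q"] spanned_cscal[of q "- 1"] by (simp add: cscal_uminus)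

lemma spanned_ideal: "p \<in> I_q \<Longrightarrow> p \<in> spanned"
  using Modules.additive.zero[OF additive_eval_vec] by (auto simp: spanned_def intro!: exI[of _ 0])

lemma spanned_weight_vec: "weight_vec k j \<in> spanned"
  using eval_vec_single[of k j 1] by (auto simp: spanned_def intro!: exI[of _ "Poly_Mapping.single (k, j) 1"])

lemma spanned_b_power: "b_vec ^ k \<in> spanned"
  using spanned_weight_vec[of k 0] by (simp add: weight_vec_0)

lemma spanned_closed_if:
  assumes "P 0" "\<And>p q. P p \<Longrightarrow> P q \<Longrightarrow> P (p + q)" "\<And>F k j. P (scal F * weight_vec k j)"
    and "\<And>p. p \<in> I_q \<Longrightarrow> P p" "p \<in> spanned"
  shows "P p"
proof -
  have "P (eval_vec f)" for f
  proof (induction f rule: poly_mapping_induct)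
    case (single i F)
    then show ?case
      by (cases i) (simp add: eval_vec_single assms)
  qed (simp add: eval_vec_add assms)
  moreover obtain f where "p - eval_vec f \<in> I_q"
    using assms(5) by (auto simp: spanned_def)
  ultimately show ?thesis
    using assms(2)[of "p - eval_vec f" "eval_vec f"] assms(4) by simp
qed

lemma spanned_su2_der:
  assumes "p \<in> spanned"
  shows "su2_der g p \<in> spanned"
proof (rule spanned_closed_if[where P = "\<lambda>p. su2_der g p \<in> spanned", OF _ _ _ _ assms])
  show "su2_der g (scal F * weight_vec k j) \<in> spanned" for F k j
  proof -
    have r: "raise (weight_vec k j) \<in> spanned"
      using raise_weight_vec[of k j] spanned_cscal spanned_weight_vec by metis
    have l: "lower (weight_vec k j) \<in> spanned"
      using spanned_weight_vec[of k "Suc j"] by (simp add: weight_vec_Suc)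
    have "su2_der g (weight_vec k j) \<in> spanned"
      by (cases g) (simp_all only: su2_der_CX su2_der_CY weight_weight_vec spanned_add spanned_diff
          spanned_cscal spanned_weight_vec r l)
    then show ?thesis
      by (simp add: spanned_scal)
  qed
qed (simp_all add: derivation_add spanned_add spanned_ideal su2_der_ideal)

lemma spanned_lower: "p \<in> spanned \<Longrightarrow> lower p \<in> spanned"
  by (simp add: lower_def spanned_add spanned_cscal spanned_su2_der)

lemma cscal_mult_spanned_cancel:
  assumes "c \<noteq> 0" "cscal c * p \<in> spanned"
  shows "p \<in> spanned"
  using spanned_cscal[OF assms(2), of "1 / c"] assms(1) by (simp flip: mult.assoc cscal_mult)

text \<open>The lowest weight vector among the linear elements: \<open>b_vec\<close>,
  \<open>Z\<close>, \<open>c_vec\<close> have weights \<i>, 0, -\<i>.\<close>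

definition c_vec :: "coord free"
  where "c_vec = Y - cscal \<i> * X"

lemma lower_b: "lower b_vec = cscal (- 2) * Z"
  and lower_Z: "lower Z = - c_vec"
  by (simp_all add: lower_def b_vec_def c_vec_def derivation_diff cscal_i_i
      cscal_uminus cscal_numeral mult_2)

lemma Z_b: "Z * b_vec - (b_vec * Z + cscal (\<i> * hbar h) * b_vec) \<in> I_q"
proof -
  have "su2_der CZ b_vec = cscal \<i> * b_vec"
    using weight_b_power[of 1] by simp
  then have "cscal (hbar h) * (cscal \<i> * b_vec) - commutator Z b_vec \<in> I_q"
    using su2_der_inner[of CZ b_vec] by simp
  then show ?thesis
    using rel_ideal_uminus by (fastforce simp: commutator_def cscal_mult algebra_simps
        cscal_left_commute[of "cscal (hbar h)"])
qed

text \<open>Expanding b c gives -(x^2 + y^2) - i[x, y], so the identity is the Casimir relation plus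
  \<i> times the relation for [x, y]. It trades Z^2 for b c up to terms already known to be
  spanned.\<close>

lemma Z_Z: "Z * Z - (b_vec * c_vec + cscal (\<i> * hbar h) * Z + scal (Cas h)) \<in> I_q"
proof -
  have "Z * Z - (b_vec * c_vec + cscal (\<i> * hbar h) * Z + scal (Cas h)) =
      (X^2 + Y^2 + Z^2 + cscal (h^2) - scal (r_var ^ 2)) +
      cscal \<i> * (commutator X Y - cscal (hbar h) * Z)"
    by (simp add: b_vec_def c_vec_def commutator_def Cas_def cscal_def scal_diff const_mult
        scal_mult power2_eq_square algebra_simps flip: cscal_def)
       (simp add: cscal_left_commute[of X] cscal_left_commute[of Y] cscal_i_i cscal_mult mult.assoc)
  moreover have "\<dots> \<in> I_q"
    by (intro rel_ideal_add rel_ideal_lmult rel_ideal_base) (auto simp: rels_q_def)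
  ultimately show ?thesis
    by simp
qed


text \<open>Each of the k + 1 factors contributes -2 Z in its place; moving Z to the right end with
  \<open>Z_b\<close> only adds multiples of b^k. Their total \<open>c\<close> is left unspecified
  because b^k is itself a weight vector.\<close>

lemma lower_b_power:
  "\<exists>c. lower (b_vec ^ Suc k) -
     (cscal (- 2 * of_nat (Suc k)) * (b_vec ^ k * Z) + cscal c * b_vec ^ k) \<in> I_q"
proof (induction k)
  case 0
  show ?case
    by (rule exI[of _ 0]) (simp add: lower_b)
next
  case (Suc k)
  then obtain c where c: "lower (b_vec ^ Suc k) -
      (cscal (- 2 * of_nat (Suc k)) * (b_vec ^ k * Z) + cscal c * b_vec ^ k) \<in> I_q" (is "?d \<in> _")
    by blast
  define e :: complex where "e = - 2 * of_nat (Suc k)"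
  let ?z = "Z * b_vec - (b_vec * Z + cscal (\<i> * hbar h) * b_vec)"
  have bb: "b_vec ^ k * b_vec = b_vec ^ Suc k" "b_vec ^ k * (b_vec * p) = b_vec ^ Suc k * p" for p
    by (simp_all only: power_Suc2 mult.assoc)
  have "lower (b_vec ^ Suc (Suc k)) = lower (b_vec ^ Suc k) * b_vec + cscal (- 2) * (b_vec ^ Suc k * Z)"
    by (subst power_Suc2) (simp only: lower_mult lower_b cscal_left_commute[of "b_vec ^ Suc k"])
  moreover have "?d * b_vec + cscal e * (b_vec ^ k * ?z) =
      lower (b_vec ^ Suc k) * b_vec - cscal e * (b_vec ^ Suc k * Z)
      - cscal (e * (\<i> * hbar h) + c) * b_vec ^ Suc k"
    by (simp only: e_def[symmetric] left_diff_distrib right_diff_distrib distrib_left distrib_right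
        mult.assoc bb cscal_left_commute[of "b_vec ^ k"] cscal_add cscal_mult[of e]) simp
  ultimately have "lower (b_vec ^ Suc (Suc k)) - (cscal (e - 2) * (b_vec ^ Suc k * Z) +
      cscal (e * (\<i> * hbar h) + c) * b_vec ^ Suc k) = ?d * b_vec + cscal e * (b_vec ^ k * ?z)"
    by (simp only: cscal_diff cscal_uminus left_diff_distrib) simp
  moreover have "\<dots> \<in> I_q"
    by (intro rel_ideal_add rel_ideal_lmult rel_ideal_rmult Z_b c)
  moreover have "e - 2 = - 2 * of_nat (Suc (Suc k))"
    by (simp add: e_def)
  ultimately show ?case
    by metis
qed

lemma spanned_b_power_Z: "b_vec ^ k * Z \<in> spanned"
proof -
  obtain c where c: "lower (b_vec ^ Suc k) -
      (cscal (- 2 * of_nat (Suc k)) * (b_vec ^ k * Z) + cscal c * b_vec ^ k) \<in> I_q"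
    using lower_b_power by blast
  have "(cscal (- 2 * of_nat (Suc k)) * (b_vec ^ k * Z) + cscal c * b_vec ^ k) \<in> spanned"
    using spanned_diff[OF spanned_lower[OF spanned_b_power[of "Suc k"]] spanned_ideal[OF c]]
    by (simp add: add.commute del: power_Suc of_nat_Suc)
  then have "cscal (- 2 * of_nat (Suc k)) * (b_vec ^ k * Z) \<in> spanned"
    using spanned_diff[OF _ spanned_cscal[OF spanned_b_power[of k], of c]] by fastforce
  then show ?thesis
    by (rule cscal_mult_spanned_cancel[rotated]) (simp del: of_nat_Suc)
qed

text \<open>For k = m + 1, lowering b^k Z produces -b^k c directly and, through Z^2, another e b^k c
  with e = -2(m + 1). The total factor e - 1 = -(2m + 3) is nonzero, and everything else is
  spanned.\<close>

lemma spanned_b_power_c: "b_vec ^ k * c_vec \<in> spanned"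
proof (cases k)
  case 0
  have "- lower Z \<in> spanned"
    using spanned_cscal[OF spanned_lower[OF spanned_b_power_Z[of 0]], of "- 1"]
    by (simp add: cscal_uminus)
  then show ?thesis
    by (simp add: 0 lower_Z)
next
  case (Suc m)
  obtain c where c: "lower (b_vec ^ Suc m) -
      (cscal (- 2 * of_nat (Suc m)) * (b_vec ^ m * Z) + cscal c * b_vec ^ m) \<in> I_q" (is "?d \<in> _")
    using lower_b_power by blast
  define e :: complex where "e = - 2 * of_nat (Suc m)"
  let ?z = "Z * Z - (b_vec * c_vec + cscal (\<i> * hbar h) * Z + scal (Cas h))"
  let ?rest = "cscal (e * (\<i> * hbar h) + c) * (b_vec ^ m * Z) + cscal e * (scal (Cas h) * b_vec ^ m)"
  have bb: "b_vec ^ m * (b_vec * p) = b_vec ^ Suc m * p" for p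
    by (simp only: power_Suc2 mult.assoc)
  have "?d * Z + cscal e * (b_vec ^ m * ?z) =
      (lower (b_vec ^ Suc m * Z) - ?rest) - cscal (e - 1) * (b_vec ^ Suc m * c_vec)"
    by (simp only: e_def[symmetric] left_diff_distrib right_diff_distrib distrib_left distrib_right
        mult.assoc bb cscal_left_commute[of "b_vec ^ m"] scal_central[of "b_vec ^ m"]
        cscal_add cscal_mult[of e] cscal_diff lower_mult lower_Z) simp
  moreover have "?d * Z + cscal e * (b_vec ^ m * ?z) \<in> I_q"
    by (intro rel_ideal_add rel_ideal_lmult rel_ideal_rmult Z_Z c)
  ultimately have "(lower (b_vec ^ Suc m * Z) - ?rest) - cscal (e - 1) * (b_vec ^ Suc m * c_vec) \<in> I_q"
    by (rule subst)
  moreover have "lower (b_vec ^ Suc m * Z) - ?rest \<in> spanned"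
    by (intro spanned_diff spanned_add spanned_lower spanned_cscal spanned_scal spanned_b_power
        spanned_b_power_Z)
  ultimately have "cscal (e - 1) * (b_vec ^ Suc m * c_vec) \<in> spanned"
    using spanned_diff[OF _ spanned_ideal, of "lower (b_vec ^ Suc m * Z) - ?rest"
        "(lower (b_vec ^ Suc m * Z) - ?rest) - cscal (e - 1) * (b_vec ^ Suc m * c_vec)"] by simp
  moreover have "Re (e - 1) \<noteq> 0"
    by (simp add: e_def)
  then have "e - 1 \<noteq> 0"
    by (metis zero_complex.simps(1))
  ultimately show ?thesis
    unfolding Suc by (rule cscal_mult_spanned_cancel[rotated])
qed

lemma X_Y_b_c: "X = cscal (\<i> / 2) * b_vec + cscal (\<i> / 2) * c_vec"
  "Y = cscal (1 / 2) * c_vec - cscal (1 / 2) * b_vec"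
proof -
  have "b_vec + c_vec = cscal (- (2 * \<i>)) * X"
    by (simp add: b_vec_def c_vec_def cscal_uminus cscal_double)
  then have "cscal (\<i> / 2) * (b_vec + c_vec) = cscal (\<i> / 2 * (- (2 * \<i>))) * X"
    by (simp only: cscal_mult mult.assoc)
  then show "X = cscal (\<i> / 2) * b_vec + cscal (\<i> / 2) * c_vec"
    by (simp add: distrib_left)
  have "c_vec - b_vec = cscal (2 * 1) * Y"
    unfolding cscal_double by (simp add: b_vec_def c_vec_def)
  then have "cscal (1 / 2) * (c_vec - b_vec) = cscal (1 / 2 * 2) * Y"
    by (simp only: cscal_mult mult.assoc mult_1_right)
  then show "Y = cscal (1 / 2) * c_vec - cscal (1 / 2) * b_vec"
    by (simp add: right_diff_distrib)
qed

lemma spanned_b_power_gen: "b_vec ^ k * gen g \<in> spanned"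
proof -
  have b: "b_vec ^ k * b_vec \<in> spanned"
    using spanned_b_power[of "Suc k"] by (simp only: power_Suc2)
  show ?thesis
  proof (cases g)
    case CX
    then show ?thesis
      by (subst CX, subst X_Y_b_c)
         (simp add: distrib_left cscal_left_commute[of "_ ^ _"] spanned_add spanned_cscal b spanned_b_power_c)
  next
    case CY
    then show ?thesis
      by (subst CY, subst X_Y_b_c)
         (simp add: right_diff_distrib cscal_left_commute[of "_ ^ _"] spanned_diff spanned_cscal b spanned_b_power_c)
  qed (simp add: spanned_b_power_Z)
qed

text \<open>By the Leibniz rule (lower w) g = lower (w g) - w (lower g), and lower g is again a
  combination of generators; hence the induction hypothesis is needed for all
  \<open>g\<close>.\<close>

lemma spanned_weight_vec_gen: "weight_vec k j * gen g \<in> spanned"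
proof (induction j arbitrary: g)
  case 0
  show ?case
    by (simp add: weight_vec_0 spanned_b_power_gen)
next
  case (Suc j)
  have uminus: "- p \<in> spanned" if "p \<in> spanned" for p
    using spanned_cscal[OF that, of "- 1"] by (simp add: cscal_uminus)
  have "weight_vec k j * su2_bracket a g \<in> spanned" for a
    by (cases a; cases g) (use Suc uminus spanned_ideal[of 0] in auto)
  then have "weight_vec k j * lower (gen g) \<in> spanned"
    by (simp add: lower_def distrib_left cscal_left_commute[of "weight_vec k j"] spanned_add spanned_cscal)
  then have "lower (weight_vec k j * gen g) - weight_vec k j * lower (gen g) \<in> spanned"
    using Suc by (intro spanned_diff spanned_lower)
  then show ?case
    by (simp add: lower_mult weight_vec_Suc)
qed

lemma spanned_UNIV: "p \<in> spanned"
proof (induction p rule: free_induct)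
  case (scal c)
  show ?case
    using spanned_scal[OF spanned_b_power[of 0], of c] by simp
next
  case (gen p g)
  show ?case
  proof (rule spanned_closed_if[where P = "\<lambda>p. p * gen g \<in> spanned", OF _ _ _ _ gen])
    show "scal F * weight_vec k j * gen g \<in> spanned" for F k j
      using spanned_scal[OF spanned_weight_vec_gen] by (simp add: mult.assoc)
  qed (use spanned_ideal[of 0] in \<open>simp_all add: distrib_right spanned_add spanned_ideal rel_ideal_rmult\<close>)
qed (rule spanned_add)

corollary eval_vec_surj: "\<exists>f. cls (rels_q h) p = cls (rels_q h) (eval_vec f)"
  using spanned_UNIV[of p] unfolding spanned_def cls_eq_iff by blast


section \<open>Additive maps prescribed on the isotypic components\<close>

inductive_set weight_span :: "nat \<Rightarrow> coord free set" for k where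
  vec: "weight_vec k j \<in> weight_span k"
| add: "p \<in> weight_span k \<Longrightarrow> q \<in> weight_span k \<Longrightarrow> p + q \<in> weight_span k"
| cscal: "p \<in> weight_span k \<Longrightarrow> cscal c * p \<in> weight_span k"

lemma weight_span_diff: "p \<in> weight_span k \<Longrightarrow> q \<in> weight_span k \<Longrightarrow> p - q \<in> weight_span k"
  using weight_span.add[OF _ weight_span.cscal[of q k "- 1"]] by (force simp: cscal_uminus)

lemma weight_span_su2_der: "p \<in> weight_span k \<Longrightarrow> su2_der g p \<in> weight_span k"
proof (induction p rule: weight_span.induct)
  case (vec j)
  have r: "raise (weight_vec k j) \<in> weight_span k"
    using raise_weight_vec[of k j] weight_span.intros by metis
  have l: "lower (weight_vec k j) \<in> weight_span k"
    using weight_span.vec[of k "Suc j"] by (simp add: weight_vec_Suc)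
  show ?case
    by (cases g) (simp_all only: su2_der_CX su2_der_CY weight_weight_vec weight_span.intros
        weight_span_diff r l)
qed (simp_all add: derivation_add weight_span.intros)

lemma V_q_weight_span: "u \<in> V_q h k \<Longrightarrow> \<exists>p\<in>weight_span k. u = cls (rels_q h) p"
  unfolding V_q_def
proof (induction u rule: su2_submodule.induct)
  case vec
  show ?case
    using weight_span.vec[of k 0] by (auto simp: weight_vec_0)
next
  case (add a b)
  then show ?case
    using weight_span.add by (force simp: cls_add)
next
  case (smult a c)
  then show ?case
    using weight_span.cscal by (force simp: smult_cls_cls cscal_def)
next
  case (act a g)
  then show ?case
    using weight_span_su2_der by (force simp: act_q_cls)
qed

lemma V_q_su2_der: "cls (rels_q h) p \<in> V_q h k \<Longrightarrow> cls (rels_q h) (su2_der g p) \<in> V_q h k"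
  using su2_submodule.act[of "cls (rels_q h) p" "rels_q h" "act_q h"] by (simp add: V_q_def act_q_cls)

lemma weight_vec_V_q: "cls (rels_q h) (weight_vec k j) \<in> V_q h k"
proof (induction j)
  case 0
  show ?case
    by (simp add: weight_vec_0 V_q_def su2_submodule.vec)
next
  case (Suc j)
  then show ?case
    using su2_submodule.add[of _ "rels_q h" "act_q h", OF V_q_su2_der[OF Suc, of CX, unfolded V_q_def]
        su2_submodule.smult[OF V_q_su2_der[OF Suc, of CY, unfolded V_q_def], of \<i>]]
    by (simp add: weight_vec_Suc lower_def V_q_def smult_cls_cls cls_add cscal_def)
qed

lemma isotypic_map_unique:
  assumes "L \<in> hom (add_monoid (A_q h)) (add_monoid (A_q h))"
    and "L' \<in> hom (add_monoid (A_q h)) (add_monoid (A_q h))"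
    and eq: "\<And>k F u. u \<in> V_q h k \<Longrightarrow> L (smult_cls (rels_q h) F u) = L' (smult_cls (rels_q h) F u)"
    and "a \<in> carrier (A_q h)"
  shows "L a = L' a"
proof -
  have hom: "M (cls (rels_q h) (p + q)) = M (cls (rels_q h) p) \<oplus>\<^bsub>A_q h\<^esub> M (cls (rels_q h) q)"
    if "M \<in> hom (add_monoid (A_q h)) (add_monoid (A_q h))" for M p q
    using that by (simp add: hom_def A_q_def flip: cls_add)
  have "L (cls (rels_q h) (eval_vec f)) = L' (cls (rels_q h) (eval_vec f))" for f
  proof (induction f rule: poly_mapping_induct)
    case (single i F)
    obtain k j where i: "i = (k, j)"
      by (cases i)
    show ?case
      using eq[OF weight_vec_V_q[of k j], of F] by (simp add: i eval_vec_single smult_cls_cls)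
  qed (simp add: eval_vec_add hom[OF assms(1)] hom[OF assms(2)])
  moreover obtain f where "a = cls (rels_q h) (eval_vec f)"
    using assms(4) eval_vec_surj by (auto simp: A_q_def carrier_presented)
  ultimately show ?thesis
    by simp
qed

text \<open>Complex linearity of \<open>G k\<close> is what is available, since shifts do not
  commute with multiplication by rational functions. It suffices because V^k is only a complex span:
  constants may pass between \<open>F\<close> and \<open>u\<close>.\<close>

lemma isotypic_map_exists:
  fixes G :: "nat \<Rightarrow> ratfun2 \<Rightarrow> ratfun2"
  assumes G_add: "\<And>k E F. G k (E + F) = G k E + G k F"
    and G_const: "\<And>k c F. G k (const c * F) = const c * G k F"
  shows "\<exists>L \<in> carrier (A_q h) \<rightarrow>\<^sub>E carrier (A_q h). L \<in> hom (add_monoid (A_q h)) (add_monoid (A_q h)) \<and>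
    (\<forall>k F. \<forall>u\<in>V_q h k. L (smult_cls (rels_q h) F u) = smult_cls (rels_q h) (G k F) u)"
proof -
  have G0 [simp]: "G k 0 = 0" for k
    using G_add[of k 0 0] by (simp only: add_0_left add_cancel_right_right)
  define ev where "ev = linear_ext (\<lambda>(k, j) F. scal (G k F) * weight_vec k j)"
  have ev_add: "ev (f + g) = ev f + ev g" for f g
    unfolding ev_def by (rule linear_ext_add) (auto simp: scal_add distrib_right G_add)
  then have ev: "Modules.additive ev"
    by (simp add: Modules.additive_def)
  have ev_single: "ev (Poly_Mapping.single (k, j) F) = scal (G k F) * weight_vec k j" for k j F
    by (simp add: ev_def)
  \<comment> \<open>The map is well defined: if the coefficient at (k, j) is nonzero, dividing by it
    shows that the weight vector itself is null, and then so is every multiple; if it is zero, its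
    image under \<open>G k\<close> is zero.\<close>
  have ev_ideal: "ev f \<in> I_q" if "eval_vec f \<in> I_q" for f
  proof -
    have "scal (G k (Poly_Mapping.lookup f (k, j))) * weight_vec k j \<in> I_q" for k j
    proof (cases "Poly_Mapping.lookup f (k, j) = 0")
      case False
      define F where "F = Poly_Mapping.lookup f (k, j)"
      have "scal (inverse F) * (scal F * weight_vec k j) \<in> I_q"
        using eval_vec_in_ideal[OF that] F_def rel_ideal_lmult by blast
      then have "weight_vec k j \<in> I_q"
        using False by (simp add: F_def flip: mult.assoc scal_mult)
      then show ?thesis
        by (rule rel_ideal_lmult)
    qed simp
    then show ?thesis
      unfolding ev_def linear_ext_def by (intro rel_ideal_sum) auto
  qed
  have ev_cong: "cls (rels_q h) (ev f) = cls (rels_q h) (ev g)"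
    if "cls (rels_q h) (eval_vec f) = cls (rels_q h) (eval_vec g)" for f g
    using that ev_ideal[of "f - g"]
    by (simp add: cls_eq_iff Modules.additive.diff[OF ev] Modules.additive.diff[OF additive_eval_vec])
  define L where "L = (\<lambda>a\<in>carrier (A_q h). cls (rels_q h) (ev (SOME f. a = cls (rels_q h) (eval_vec f))))"
  have L: "L (cls (rels_q h) p) = cls (rels_q h) (ev f)"
    if "cls (rels_q h) p = cls (rels_q h) (eval_vec f)" for p f
  proof -
    have "cls (rels_q h) p = cls (rels_q h) (eval_vec (SOME f. cls (rels_q h) p = cls (rels_q h) (eval_vec f)))"
      using that by (rule someI[where P = "\<lambda>f. cls (rels_q h) p = cls (rels_q h) (eval_vec f)"])
    then show ?thesis
      using that by (auto simp: L_def A_q_def intro!: ev_cong)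
  qed
  have L_add: "L (cls (rels_q h) (p + q)) = L (cls (rels_q h) p) \<oplus>\<^bsub>A_q h\<^esub> L (cls (rels_q h) q)" for p q
  proof -
    obtain f g where fg: "cls (rels_q h) p = cls (rels_q h) (eval_vec f)"
      "cls (rels_q h) q = cls (rels_q h) (eval_vec g)"
      using eval_vec_surj by metis
    then have "cls (rels_q h) (p + q) = cls (rels_q h) (eval_vec (f + g))"
      by (simp add: eval_vec_add flip: cls_add)
    then show ?thesis
      by (simp add: L[OF fg(1)] L[OF fg(2)] L ev_add A_q_def cls_add)
  qed
  have L_carrier: "L \<in> carrier (A_q h) \<rightarrow>\<^sub>E carrier (A_q h)"
    by (auto simp: L_def A_q_def)
  moreover have "L \<in> hom (add_monoid (A_q h)) (add_monoid (A_q h))"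
    using L_carrier L_add by (auto simp: hom_def A_q_def carrier_presented cls_add)
  moreover have "L (smult_cls (rels_q h) F (cls (rels_q h) p)) = smult_cls (rels_q h) (G k F) (cls (rels_q h) p)"
    if "p \<in> weight_span k" for k F p
    using that
  proof (induction p arbitrary: F rule: weight_span.induct)
    case (vec j)
    show ?case
      by (simp add: smult_cls_cls L[OF arg_cong[OF eval_vec_single[symmetric], of "cls (rels_q h)"]] ev_single)
  next
    case (add p q)
    then show ?case
      by (simp add: smult_cls_cls distrib_left L_add A_q_def cls_add)
  next
    case (cscal p c)
    have "scal F * (cscal c * p) = scal (const c * F) * p"
      by (simp add: cscal_def scal_mult scal_central[of "scal F"] flip: mult.assoc)
    then show ?case
      using cscal.IH[of "const c * F"]
      by (simp add: smult_cls_cls G_const cscal_def scal_mult scal_central[of "scal _"] flip: mult.assoc)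
  qed
  ultimately show ?thesis
    using V_q_weight_span by blast
qed

end

section \<open>Normally ordered operators\<close>

text \<open>Derivatives are commuting indeterminates, coefficients stay noncommutative and stand on
  the left. They are taken in the free algebra; the relations are imposed later through
  \<open>symbol_ideal\<close>.\<close>

type_synonym symbol = "(opgen \<Rightarrow>\<^sub>0 nat) \<Rightarrow>\<^sub>0 coord free"

definition coeff_sym :: "coord free \<Rightarrow> symbol"
  where "coeff_sym a = Poly_Mapping.single 0 a"

definition csym :: "complex \<Rightarrow> symbol"
  where "csym c = coeff_sym (cscal c)"

definition var_sym :: "opgen \<Rightarrow> symbol"
  where "var_sym D = Poly_Mapping.single (Poly_Mapping.single D 1) 1"

lemma coeff_sym_zero [simp]: "coeff_sym 0 = 0"
  and coeff_sym_one [simp]: "coeff_sym 1 = 1"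
  and coeff_sym_add: "coeff_sym (a + b) = coeff_sym a + coeff_sym b"
  and coeff_sym_diff: "coeff_sym (a - b) = coeff_sym a - coeff_sym b"
  and coeff_sym_mult: "coeff_sym (a * b) = coeff_sym a * coeff_sym b"
  by (simp_all add: coeff_sym_def single_add single_diff single_uminus mult_single flip: single_one)

lemma csym_zero [simp]: "csym 0 = 0"
  and csym_one [simp]: "csym 1 = 1"
  and csym_mult: "csym (a * b) = csym a * csym b"
  and csym_add: "csym (a + b) = csym a + csym b"
  by (simp_all add: csym_def cscal_mult cscal_add coeff_sym_mult coeff_sym_add)

lemma single_eq_coeff_sym: "Poly_Mapping.single \<beta> a = coeff_sym a * Poly_Mapping.single \<beta> 1"
  by (simp add: coeff_sym_def mult_single)

lemma var_sym_central: "n * var_sym D = var_sym D * n"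
  by (induction n rule: poly_mapping_induct)
     (simp_all add: var_sym_def mult_single add.commute distrib_left distrib_right)

lemma csym_central: "n * csym c = csym c * n"
  by (induction n rule: poly_mapping_induct)
     (simp_all add: csym_def coeff_sym_def mult_single cscal_central distrib_left distrib_right)

lemma scal_sym_central: "n * coeff_sym (scal c) = coeff_sym (scal c) * n"
  by (induction n rule: poly_mapping_induct)
     (simp_all add: coeff_sym_def mult_single scal_central distrib_left distrib_right)

lemma var_sym_power: "var_sym D ^ i = Poly_Mapping.single (Poly_Mapping.single D i) 1"
  by (induction i) (simp_all add: var_sym_def mult_single flip: single_add)

lemma symbol_induct [case_names coeff var add]:
  assumes "\<And>a. P (coeff_sym a)" "\<And>n D. P n \<Longrightarrow> P (n * var_sym D)" "\<And>m n. P m \<Longrightarrow> P n \<Longrightarrow> P (m + n)"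
  shows "P n"
proof (induction n rule: poly_mapping_induct)
  case (single \<beta> a)
  have "P (m * Poly_Mapping.single \<beta> 1)" if "P m" for m
    using that
  proof (induction \<beta> arbitrary: m rule: poly_mapping_induct)
    case (single D i)
    then show ?case
      unfolding var_sym_power[symmetric]
      by (induction i arbitrary: m) (simp_all add: assms flip: mult.assoc)
  next
    case (add \<beta> \<gamma>)
    have "Poly_Mapping.single (\<beta> + \<gamma>) 1 = Poly_Mapping.single \<beta> (1 :: coord free) * Poly_Mapping.single \<gamma> 1"
      by (simp add: mult_single)
    then show ?case
      using add by (simp flip: mult.assoc)
  qed
  then show ?case
    using assms(1) single_eq_coeff_sym by metis
qed (rule assms(3))

text \<open>The formal partial derivative. At exponent 0 the truncated subtraction leaves the
  monomial alone, and the factor 0 removes the term.\<close>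

definition pd_sym :: "opgen \<Rightarrow> symbol \<Rightarrow> symbol"
  where "pd_sym D = linear_ext (\<lambda>\<beta> a. Poly_Mapping.single (\<beta> - Poly_Mapping.single D 1)
           (of_nat (Poly_Mapping.lookup \<beta> D) * a))"

lemma pd_sym_add: "pd_sym D (m + n) = pd_sym D m + pd_sym D n"
  unfolding pd_sym_def by (rule linear_ext_add) (simp add: distrib_left single_add)

lemma pd_sym_single: "pd_sym D (Poly_Mapping.single \<beta> a) =
    Poly_Mapping.single (\<beta> - Poly_Mapping.single D 1) (of_nat (Poly_Mapping.lookup \<beta> D) * a)"
  by (simp add: pd_sym_def)

lemma pd_sym_coeff [simp]: "pd_sym D (coeff_sym a) = 0"
  by (simp add: coeff_sym_def pd_sym_single)

lemma pd_sym_var: "pd_sym D (var_sym E) = (if D = E then 1 else 0)"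
  by (simp add: var_sym_def pd_sym_single lookup_single)

lemma of_nat_free_central: "(a :: coord free) * (of_nat n * b) = of_nat n * (a * b)"
  by (metis mult.assoc mult_of_nat_commute)

lemma pd_sym_mult: "pd_sym D (m * n) = pd_sym D m * n + m * pd_sym D n"
proof (induction m rule: poly_mapping_induct)
  case (single \<beta> a)
  show ?case
  proof (induction n rule: poly_mapping_induct)
    case (single \<gamma> b)
    have comm: "\<beta> - Poly_Mapping.single D 1 + \<gamma> = \<beta> + \<gamma> - Poly_Mapping.single D 1"
      if "Poly_Mapping.lookup \<beta> D \<noteq> 0" for \<beta> \<gamma> :: "opgen \<Rightarrow>\<^sub>0 nat"
      by (rule poly_mapping_eqI)
         (use that in \<open>auto simp: lookup_add lookup_minus lookup_single when_def\<close>)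
    have 1: "Poly_Mapping.single (\<beta> - Poly_Mapping.single D 1 + \<gamma>) (of_nat (Poly_Mapping.lookup \<beta> D) * a * b) =
        Poly_Mapping.single (\<beta> + \<gamma> - Poly_Mapping.single D 1) (of_nat (Poly_Mapping.lookup \<beta> D) * a * b)"
      using comm[of \<beta> \<gamma>] by (cases "Poly_Mapping.lookup \<beta> D = 0") simp_all
    have 2: "Poly_Mapping.single (\<beta> + (\<gamma> - Poly_Mapping.single D 1)) (a * (of_nat (Poly_Mapping.lookup \<gamma> D) * b)) =
        Poly_Mapping.single (\<beta> + \<gamma> - Poly_Mapping.single D 1) (of_nat (Poly_Mapping.lookup \<gamma> D) * a * b)"
      using comm[of \<gamma> \<beta>]
      by (cases "Poly_Mapping.lookup \<gamma> D = 0") (simp_all add: add.commute of_nat_free_central mult.assoc)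
    show ?case
      unfolding pd_sym_single mult_single 1 2
      by (simp add: lookup_add distrib_right mult.assoc flip: single_add)
  qed (simp_all add: pd_sym_add distrib_left algebra_simps)
qed (simp_all add: pd_sym_add distrib_right algebra_simps)

abbreviation diff_letters :: "opgen set"
  where "diff_letters \<equiv> {DT, DD CX, DD CY, DD CZ}"

text \<open>\<open>d g D\<close> plays the role of the commutator \<open>[D, g]\<close>. The letters act on symbols from the right,
  because rational functions of \<open>t\<close>, \<open>r\<close> may only stand on the left.\<close>

definition derive_sym :: "(opgen \<Rightarrow> symbol) \<Rightarrow> symbol \<Rightarrow> symbol"
  where "derive_sym d n = (\<Sum>D\<in>diff_letters. d D * pd_sym D n)"

fun right_act :: "(opgen \<Rightarrow> opgen \<Rightarrow> symbol) \<Rightarrow> opgen \<Rightarrow> symbol \<Rightarrow> symbol" where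
  "right_act d (Pos g) n = n * coeff_sym (gen g) + derive_sym (d (Pos g)) n"
| "right_act d Tm n = n * coeff_sym (scal t_var) + derive_sym (d Tm) n"
| "right_act d D n = n * var_sym D"

text \<open>\<open>fold\<close> consumes a word from its left end, so this is a right action:
  \<open>p * q\<close> acts by \<open>p\<close> first. Applied to the symbol 1 it yields the
  normally ordered form of an operator.\<close>

definition right_op :: "(opgen \<Rightarrow> opgen \<Rightarrow> symbol) \<Rightarrow> symbol \<Rightarrow> opgen free \<Rightarrow> symbol"
  where "right_op d n = linear_ext (\<lambda>w f. coeff_sym (scal f) * fold (right_act d) (letters w) n)"

lemma derive_sym_add: "derive_sym d (m + n) = derive_sym d m + derive_sym d n"
  by (simp add: derive_sym_def pd_sym_add algebra_simps)

lemma derive_sym_zero [simp]: "derive_sym d 0 = 0"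
  using derive_sym_add[of d 0 0] by (simp only: add_0_left add_cancel_right_right)

lemma derive_sym_coeff [simp]: "derive_sym d (coeff_sym a) = 0" "derive_sym d (csym c) = 0"
  "derive_sym d 1 = 0"
  using pd_sym_coeff[of _ 1] by (simp_all add: derive_sym_def csym_def)

lemma derive_sym_coeff_mult: "derive_sym d (coeff_sym a * n) = coeff_sym a * derive_sym d n"
  if "\<And>D m. d D * m = m * d D"
  by (simp add: derive_sym_def pd_sym_mult distrib_left that mult.assoc)

lemma derive_sym_mult:
  assumes "\<And>D m. d D * m = m * d D"
  shows "derive_sym d (m * n) = derive_sym d m * n + m * derive_sym d n"
proof -
  have *: "d D * pd_sym D (m * n) = d D * pd_sym D m * n + m * (d D * pd_sym D n)" for D
    by (simp add: pd_sym_mult distrib_left assms mult.assoc flip: assms[of D m])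
  show ?thesis
    unfolding derive_sym_def * by (simp add: sum.distrib distrib_left distrib_right)
qed

lemma right_op_add: "right_op d n (p + q) = right_op d n p + right_op d n q"
  unfolding right_op_def by (rule linear_ext_add) (simp add: scal_add coeff_sym_add distrib_right)

lemma additive_right_op: "Modules.additive (right_op d n)"
  by (simp add: Modules.additive_def right_op_add)

lemmas right_op_zero [simp] = Modules.additive.zero[OF additive_right_op]
  and right_op_diff = Modules.additive.diff[OF additive_right_op]
  and right_op_uminus = Modules.additive.minus[OF additive_right_op]
  and right_op_sum = Modules.additive.sum[OF additive_right_op]

lemma right_op_single: "right_op d n (Poly_Mapping.single w f) = coeff_sym (scal f) * fold (right_act d) (letters w) n"
  by (simp add: right_op_def)

lemma right_op_scal [simp]: "right_op d n (scal f) = coeff_sym (scal f) * n"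
  by (subst scal_def) (simp add: right_op_single zero_word_def)

text \<open>Centrality of the brackets makes \<open>derive_sym (d g)\<close> a derivation even
  though the coefficients of symbols do not commute.\<close>

locale symbol_action =
  fixes d :: "opgen \<Rightarrow> opgen \<Rightarrow> symbol"
  assumes central: "d g D * m = m * d g D"
begin

lemmas derive_mult = derive_sym_mult[OF central]
  and derive_coeff_mult = derive_sym_coeff_mult[OF central]

lemma right_act_add: "right_act d g (m + n) = right_act d g m + right_act d g n"
  by (cases g) (simp_all add: distrib_right derive_sym_add algebra_simps)

lemma right_act_coeff_mult: "right_act d g (coeff_sym a * n) = coeff_sym a * right_act d g n"
  by (cases g) (simp_all add: derive_coeff_mult distrib_left mult.assoc)

lemma right_op_scal_mult: "right_op d n (scal f * p) = coeff_sym (scal f) * right_op d n p"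
proof (induction p rule: poly_mapping_induct)
  case (single w c)
  have "scal f * Poly_Mapping.single w c = Poly_Mapping.single w (f * c)"
    by (simp add: scal_def mult_single)
  then show ?case
    by (simp add: right_op_single scal_mult coeff_sym_mult mult.assoc)
qed (simp add: right_op_add distrib_left)

lemma right_op_mult_gen: "right_op d n (p * gen g) = right_act d g (right_op d n p)"
proof (induction p rule: poly_mapping_induct)
  case (single w c)
  show ?case
    by (cases w) (simp add: gen_def monom_word_def mult_single plus_word_def right_op_single
        right_act_coeff_mult)
qed (simp add: right_op_add distrib_right right_act_add)

lemma right_op_gen: "right_op d n (gen g) = right_act d g n"
  using right_op_mult_gen[of n 1 g] right_op_scal[of d n 1] by simp

lemma right_op_mult: "right_op d n (p * q) = right_op d (right_op d n p) q"
  by (induction q rule: free_induct)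
     (simp_all add: right_op_mult_gen right_op_add distrib_left scal_central right_op_scal_mult
       flip: mult.assoc)

lemma right_op_emb: "right_op d (coeff_sym b) (emb a) = coeff_sym (b * a)"
  by (induction a rule: free_induct)
     (simp_all add: emb_add emb_mult right_op_add right_op_mult_gen coeff_sym_add coeff_sym_mult
       distrib_left scal_central derive_coeff_mult flip: mult.assoc scal_sym_central)

lemma right_op_power:
  assumes "D \<in> diff_letters"
  shows "right_op d n (gen D ^ i) = n * var_sym D ^ i"
proof (induction i)
  case 0
  show ?case
    using right_op_scal[of d n 1] by simp
next
  case (Suc i)
  have "right_op d n (gen D ^ Suc i) = right_act d D (n * var_sym D ^ i)"
    by (simp only: power_Suc2 right_op_mult_gen Suc)
  also have "\<dots> = n * var_sym D ^ Suc i"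
    using assms by (auto simp: power_Suc2 mult.assoc simp del: power_Suc)
  finally show ?case .
qed

end

definition d_exp :: "nat \<times> nat \<times> nat \<times> nat \<Rightarrow> opgen \<Rightarrow>\<^sub>0 nat"
  where "d_exp = (\<lambda>(i, j, k, l). Poly_Mapping.single DT i + Poly_Mapping.single (DD CX) j +
           Poly_Mapping.single (DD CY) k + Poly_Mapping.single (DD CZ) l)"

lemma inj_d_exp: "inj d_exp"
proof (rule injI)
  fix \<beta> \<gamma>
  assume eq: "d_exp \<beta> = d_exp \<gamma>"
  obtain i j k l i' j' k' l' where "\<beta> = (i, j, k, l)" "\<gamma> = (i', j', k', l')"
    by (cases \<beta>; cases \<gamma>)
  moreover have "Poly_Mapping.lookup (d_exp \<beta>) D = Poly_Mapping.lookup (d_exp \<gamma>) D" for D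
    using eq by simp
  from this[of DT] this[of "DD CX"] this[of "DD CY"] this[of "DD CZ"] calculation show "\<beta> = \<gamma>"
    by (simp add: d_exp_def lookup_add lookup_single)
qed

text \<open>The symbols all of whose coefficients lie in \<open>I\<close>, in generated form so that
  closure properties follow by induction.\<close>

inductive_set symbol_ideal :: "coord free set \<Rightarrow> symbol set" for I where
  single: "a \<in> I \<Longrightarrow> Poly_Mapping.single \<beta> a \<in> symbol_ideal I"
| add: "m \<in> symbol_ideal I \<Longrightarrow> n \<in> symbol_ideal I \<Longrightarrow> m + n \<in> symbol_ideal I"

lemma symbol_ideal_lookup:
  "n \<in> symbol_ideal (rel_ideal R) \<Longrightarrow> Poly_Mapping.lookup n \<beta> \<in> rel_ideal R"
  by (induction rule: symbol_ideal.induct) (auto simp: lookup_single when_def lookup_add rel_ideal_add)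

lemma symbol_ideal_zero [simp]: "0 \<in> symbol_ideal (rel_ideal R)"
  using symbol_ideal.single[of 0 "rel_ideal R" 0] by simp

lemma symbol_ideal_lmult: "n \<in> symbol_ideal (rel_ideal R) \<Longrightarrow> m * n \<in> symbol_ideal (rel_ideal R)"
proof (induction rule: symbol_ideal.induct)
  case (single a \<beta>)
  then show ?case
    by (induction m rule: poly_mapping_induct)
       (simp_all add: mult_single distrib_right symbol_ideal.intros rel_ideal_lmult)
qed (simp add: distrib_left symbol_ideal.intros)

lemma symbol_ideal_rmult: "n \<in> symbol_ideal (rel_ideal R) \<Longrightarrow> n * m \<in> symbol_ideal (rel_ideal R)"
proof (induction rule: symbol_ideal.induct)
  case (single a \<beta>)
  then show ?case
    by (induction m rule: poly_mapping_induct)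
       (simp_all add: mult_single distrib_left symbol_ideal.intros rel_ideal_rmult)
qed (simp add: distrib_right symbol_ideal.intros)

lemma symbol_ideal_uminus: "n \<in> symbol_ideal (rel_ideal R) \<Longrightarrow> - n \<in> symbol_ideal (rel_ideal R)"
  using symbol_ideal_lmult[of n R "- 1"] by simp

lemma symbol_ideal_pd: "n \<in> symbol_ideal (rel_ideal R) \<Longrightarrow> pd_sym D n \<in> symbol_ideal (rel_ideal R)"
  by (induction rule: symbol_ideal.induct)
     (simp_all add: pd_sym_single pd_sym_add symbol_ideal.intros rel_ideal_lmult)

lemma symbol_ideal_derive: "n \<in> symbol_ideal (rel_ideal R) \<Longrightarrow> derive_sym d n \<in> symbol_ideal (rel_ideal R)"
  by (simp add: derive_sym_def symbol_ideal.add symbol_ideal_lmult symbol_ideal_pd)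

lemma coeff_sym_ideal: "a \<in> rel_ideal R \<Longrightarrow> coeff_sym a \<in> symbol_ideal (rel_ideal R)"
  by (simp add: coeff_sym_def symbol_ideal.single)

text \<open>The two hypotheses mirror the two kinds of generators of \<open>op_null\<close>. A
  relation in \<open>weyl\<close> may follow any word, which has already turned 1 into an arbitrary
  symbol; a relation in \<open>coef\<close> stands at the left end and meets only 1.\<close>

locale symbol_module = symbol_action d for d +
  fixes R :: "coord free set" and weyl coef :: "opgen free set"
  assumes weyl: "\<And>p n. p \<in> weyl \<Longrightarrow> right_op d n p \<in> symbol_ideal (rel_ideal R)"
    and coef: "\<And>p. p \<in> coef \<Longrightarrow> right_op d 1 p \<in> symbol_ideal (rel_ideal R)"
begin

lemma right_op_ideal:
  assumes "n \<in> symbol_ideal (rel_ideal R)"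
  shows "right_op d n p \<in> symbol_ideal (rel_ideal R)"
proof (induction p rule: free_induct)
  case (gen p g)
  then show ?case
    by (cases g) (simp_all add: right_op_mult_gen symbol_ideal.add symbol_ideal_rmult symbol_ideal_derive)
qed (use assms in \<open>simp_all add: symbol_ideal_lmult right_op_add symbol_ideal.add\<close>)

lemma right_op_null:
  assumes "p \<in> op_null weyl coef"
  shows "right_op d 1 p \<in> symbol_ideal (rel_ideal R)"
proof -
  have incl: "right_op d 1 p \<in> symbol_ideal (rel_ideal R)"
    if "p \<in> {scal f * monom_word u * p * monom_word v | f u p v. p \<in> weyl} \<union>
     {scal f * p * monom_word v | f p v. p \<in> coef}" for p
  proof -
    from that consider
      f u q v where "q \<in> weyl" "p = scal f * monom_word u * q * monom_word v" |
      f q v where "q \<in> coef" "p = scal f * q * monom_word v"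
      by blast
    then show ?thesis
      by cases (simp_all only: mult.assoc right_op_scal_mult,
          simp_all add: right_op_mult symbol_ideal_lmult right_op_ideal weyl coef)
  qed
  show ?thesis
    using assms unfolding op_null_def
  proof (induction p rule: generate.induct)
    case (inv p)
    have "inv\<^bsub>add_monoid free_ring\<^esub> p = - p"
      using a_inv_free_ring[of p] by (simp add: a_inv_def)
    then show ?case
      using incl[OF inv] by (simp add: right_op_uminus symbol_ideal_uminus)
  qed (use incl in \<open>simp_all add: right_op_add symbol_ideal.add\<close>)
qed

text \<open>A normally ordered word acts on 1 without any bracket: the coordinates come first, when
  there is no derivative yet to differentiate. So its coefficient can be read off from the
  symbol.\<close>

lemma right_op_normal: "right_op d 1 (emb a * d_mon \<beta>) = Poly_Mapping.single (d_exp \<beta>) a"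
proof -
  obtain i j k l where \<beta>: "\<beta> = (i, j, k, l)"
    by (cases \<beta>)
  have "right_op d 1 (emb a * d_mon \<beta>) =
      coeff_sym a * var_sym DT ^ i * var_sym (DD CX) ^ j * var_sym (DD CY) ^ k * var_sym (DD CZ) ^ l"
    using right_op_emb[of 1 a] by (simp add: \<beta> d_mon_def right_op_mult right_op_power)
  also have "\<dots> = Poly_Mapping.single (d_exp \<beta>) a"
    by (simp add: \<beta> d_exp_def coeff_sym_def var_sym_power mult_single)
  finally show ?thesis .
qed

lemma normal_form_unique:
  assumes "finite B" "(\<Sum>\<beta>\<in>B. emb (a \<beta>) * d_mon \<beta>) \<in> op_null weyl coef" "\<beta> \<in> B"
  shows "a \<beta> \<in> rel_ideal R"
proof -
  have "(\<Sum>\<beta>\<in>B. Poly_Mapping.single (d_exp \<beta>) (a \<beta>)) \<in> symbol_ideal (rel_ideal R)"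
    using right_op_null[OF assms(2)] by (simp add: right_op_sum right_op_normal)
  then have "Poly_Mapping.lookup (\<Sum>\<beta>\<in>B. Poly_Mapping.single (d_exp \<beta>) (a \<beta>)) (d_exp \<beta>) \<in> rel_ideal R"
    by (rule symbol_ideal_lookup)
  also have "Poly_Mapping.lookup (\<Sum>\<beta>\<in>B. Poly_Mapping.single (d_exp \<beta>) (a \<beta>)) (d_exp \<beta>) =
      (\<Sum>\<gamma>\<in>B. if \<gamma> = \<beta> then a \<gamma> else 0)"
    unfolding lookup_sum
    by (rule sum.cong) (auto simp: lookup_single when_def dest: injD[OF inj_d_exp])
  also have "\<dots> = a \<beta>"
    using assms by simp
  finally show ?thesis .
qed

end

section \<open>The classical and the quantum module of operators\<close>

lemma derive_sym_var: "derive_sym d (var_sym D) = (if D \<in> diff_letters then d D else 0)"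
  by (auto simp: derive_sym_def pd_sym_var)

context symbol_action
begin

text \<open>A commutator of derivations is a derivation, so the indeterminates decide.
  \<open>d g\<close> is applied before \<open>d g'\<close>, as right multiplication by the word g g'
  requires.\<close>

lemma derive_commutator:
  assumes "\<And>D. D \<in> diff_letters \<Longrightarrow>
      derive_sym (d g') (d g D) - derive_sym (d g) (d g' D) = csym c * d g'' D"
  shows "derive_sym (d g') (derive_sym (d g) n) - derive_sym (d g) (derive_sym (d g') n) =
      csym c * derive_sym (d g'') n"
proof (induction n rule: symbol_induct)
  case (var n D)
  let ?c = "\<lambda>n. derive_sym (d g') (derive_sym (d g) n) - derive_sym (d g) (derive_sym (d g') n)"
  have "?c (n * var_sym D) = ?c n * var_sym D + n * ?c (var_sym D)"
    by (simp add: derive_mult derive_sym_add algebra_simps)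
  also have "?c (var_sym D) = csym c * derive_sym (d g'') (var_sym D)"
    using assms[of D] by (auto simp: derive_sym_var simp del: insert_iff)
  finally show ?case
    by (simp add: var derive_mult distrib_left mult.assoc csym_central flip: mult.assoc[of n])
next
  case (add m n)
  then show ?case
    by (simp add: derive_sym_add algebra_simps)
qed simp

lemma right_op_cscal_mult: "right_op d n (cscal c * p) = csym c * right_op d n p"
  by (simp add: cscal_def csym_def right_op_scal_mult)

lemma right_op_commutator: "right_op d n (commutator (gen g) (gen g')) =
    right_act d g' (right_act d g n) - right_act d g (right_act d g' n)"
  by (simp add: commutator_def right_op_diff right_op_mult right_op_gen)

lemma right_op_commutator_Pos: "right_op d n (commutator (gen (Pos g)) (gen (Pos g'))) =
    n * coeff_sym (commutator (gen g) (gen g')) +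
    (derive_sym (d (Pos g')) (derive_sym (d (Pos g)) n) - derive_sym (d (Pos g)) (derive_sym (d (Pos g')) n))"
  unfolding right_op_commutator
  by (simp add: commutator_def derive_sym_add derive_mult coeff_sym_diff coeff_sym_mult algebra_simps)

lemma right_op_commutator_Tm: "right_op d n (commutator (gen (Pos g)) tm) =
    derive_sym (d Tm) (derive_sym (d (Pos g)) n) - derive_sym (d (Pos g)) (derive_sym (d Tm) n)"
  unfolding right_op_commutator
  by (simp add: derive_sym_add derive_mult scal_sym_central[of "coeff_sym (gen g)"] algebra_simps)

lemma right_act_diff: "D \<in> diff_letters \<Longrightarrow> right_act d D n = n * var_sym D"
  by auto

lemma right_op_commutator_diff:
  assumes "D \<in> diff_letters" "D' \<in> diff_letters"
  shows "right_op d n (commutator (gen D) (gen D')) = 0"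
  unfolding right_op_commutator right_act_diff[OF assms(1)] right_act_diff[OF assms(2)]
  by (simp add: mult.assoc var_sym_central[of "var_sym D"])

lemma right_op_commutator_diff_coord:
  assumes "D \<in> diff_letters" "g = Tm \<or> g = Pos a"
  shows "right_op d n (commutator (gen D) (gen g)) = n * d g D"
  using assms(2) unfolding right_op_commutator right_act_diff[OF assms(1)]
  by (auto simp: derive_mult derive_sym_var[of _ D] assms(1) mult.assoc
      var_sym_central[of "coeff_sym _"] distrib_right simp del: insert_iff)

end

section \<open>Classical operators acting on symbols\<close>

fun d_cl :: "opgen \<Rightarrow> opgen \<Rightarrow> symbol" where
  "d_cl (Pos g) (DD g') = (if g' = g then 1 else 0)"
| "d_cl Tm DT = 1"
| "d_cl _ _ = 0"

interpretation cl: symbol_action d_cl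
proof
  show "d_cl g D * m = m * d_cl g D" for g D m
    by (cases "(g, D)" rule: d_cl.cases) auto
qed

lemma derive_d_cl: "derive_sym (d_cl g) (d_cl g' D) = 0"
  by (cases "(g', D)" rule: d_cl.cases) auto

lemma derive_d_cl_commute: "derive_sym (d_cl g) (derive_sym (d_cl g') n) = derive_sym (d_cl g') (derive_sym (d_cl g) n)"
  using cl.derive_commutator[where g' = g and g = g' and c = 0 and n = n] by (simp add: derive_d_cl)

abbreviation coef_cl :: "opgen free set"
  where "coef_cl \<equiv> {tm - scal t_var, xo^2 + yo^2 + zo^2 - scal (r_var ^ 2)}"

abbreviation coef_q :: "complex \<Rightarrow> opgen free set"
  where "coef_q h \<equiv> {tm - scal t_var, xo^2 + yo^2 + zo^2 + cscal (h^2) - scal (r_var ^ 2)}"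

lemma commutator_rels_cl: "commutator (gen g) (gen g') \<in> rel_ideal rels_cl"
proof -
  have base: "commutator X Y \<in> rel_ideal rels_cl" "commutator Y Z \<in> rel_ideal rels_cl"
    "commutator Z X \<in> rel_ideal rels_cl"
    by (auto intro!: rel_ideal_base simp: rels_cl_def)
  note base = base base[THEN rel_ideal_uminus]
  show ?thesis
    by (cases g; cases g') (use base in \<open>simp_all add: commutator_def\<close>)
qed

interpretation cl: symbol_module d_cl rels_cl weyl_cl coef_cl
proof
  fix p n
  assume "p \<in> weyl_cl"
  then consider
      g g' where "p = commutator (gen (Pos g)) (gen (Pos g'))"
    | g where "p = commutator (gen (Pos g)) tm"
    | g g' where "p = commutator (gen (DD g)) (gen (DD g'))"
    | g where "p = commutator dt (gen (DD g))"
    | "p = commutator dt tm - 1"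
    | g where "p = commutator dt (gen (Pos g))"
    | g where "p = commutator (gen (DD g)) tm"
    | g g' where "p = commutator (gen (DD g)) (gen (Pos g')) - (if g = g' then 1 else 0)"
    unfolding weyl_cl_def by blast
  then show "right_op d_cl n p \<in> symbol_ideal (rel_ideal rels_cl)"
  proof cases
    case 1
    then show ?thesis
      by (simp add: cl.right_op_commutator_Pos derive_d_cl_commute symbol_ideal_lmult coeff_sym_ideal
          commutator_rels_cl)
  next
    case 2
    then show ?thesis
      by (simp add: cl.right_op_commutator_Tm derive_d_cl_commute)
  next
    case (3 g g')
    then show ?thesis
      by (cases g; cases g') (simp_all add: cl.right_op_commutator_diff)
  next
    case (4 g)
    then show ?thesis
      by (cases g) (simp_all add: cl.right_op_commutator_diff)
  next
    case 5
    then show ?thesis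
      using right_op_scal[of d_cl n 1]
      by (simp add: right_op_diff cl.right_op_commutator_diff_coord)
  next
    case (6 g)
    then show ?thesis
      by (simp add: cl.right_op_commutator_diff_coord)
  next
    case (7 g)
    then show ?thesis
      by (cases g) (simp_all add: cl.right_op_commutator_diff_coord)
  next
    case (8 g g')
    then show ?thesis
      using right_op_scal[of d_cl n 1]
      by (cases g; cases g') (simp_all add: right_op_diff cl.right_op_commutator_diff_coord)
  qed
next
  fix p
  assume "p \<in> coef_cl"
  then consider "p = tm - scal t_var" | "p = emb (X^2 + Y^2 + Z^2 - scal (r_var ^ 2))"
    by (auto simp: emb_add emb_diff emb_power)
  then show "right_op d_cl 1 p \<in> symbol_ideal (rel_ideal rels_cl)"
  proof cases
    case 1
    then show ?thesis
      by (simp add: right_op_diff cl.right_op_gen)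
  next
    case 2
    then show ?thesis
      using cl.right_op_emb[of 1 "X^2 + Y^2 + Z^2 - scal (r_var ^ 2)"]
      by (simp add: coeff_sym_ideal rel_ideal_base rels_cl_def)
  qed
qed


text \<open>The entry at \<open>g\<close>, \<open>D\<close> is the bracket [D, g].
  \<open>var_sym DT + csym (2 / H)\<close> is the shifted time derivative, while \<open>DT\<close>
  is the indeterminate; the two have the same brackets because they differ by a constant.\<close>

fun d_q :: "complex \<Rightarrow> opgen \<Rightarrow> opgen \<Rightarrow> symbol" where
  "d_q H (Pos g) DT = - (csym (H / 2) * var_sym (DD g))"
| "d_q H Tm DT = csym (H / 2) * (var_sym DT + csym (2 / H))"
| "d_q H Tm (DD g) = csym (H / 2) * var_sym (DD g)"
| "d_q H (Pos CX) (DD CX) = csym (H / 2) * (var_sym DT + csym (2 / H))"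
| "d_q H (Pos CY) (DD CY) = csym (H / 2) * (var_sym DT + csym (2 / H))"
| "d_q H (Pos CZ) (DD CZ) = csym (H / 2) * (var_sym DT + csym (2 / H))"
| "d_q H (Pos CY) (DD CX) = csym (H / 2) * var_sym (DD CZ)"
| "d_q H (Pos CZ) (DD CX) = - (csym (H / 2) * var_sym (DD CY))"
| "d_q H (Pos CX) (DD CY) = - (csym (H / 2) * var_sym (DD CZ))"
| "d_q H (Pos CZ) (DD CY) = csym (H / 2) * var_sym (DD CX)"
| "d_q H (Pos CX) (DD CZ) = csym (H / 2) * var_sym (DD CY)"
| "d_q H (Pos CY) (DD CZ) = - (csym (H / 2) * var_sym (DD CX))"
| "d_q H _ _ = 0"

lemma symbol_action_d_q: "symbol_action (d_q H)"
proof
  have *: "csym c * var_sym D * m = m * (csym c * var_sym D)" for c D m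
    unfolding mult.assoc[of m, symmetric] csym_central[of m] unfolding mult.assoc var_sym_central[of m] ..
  show "d_q H g D * m = m * d_q H g D" for g D m
    by (cases "(H, g, D)" rule: d_q.cases)
       (simp_all add: * distrib_left distrib_right csym_central[of m] flip: csym_mult)
qed

context
  fixes h :: complex
begin

interpretation q: symbol_action "d_q (hbar h)"
  by (rule symbol_action_d_q)

lemma derive_q_csym_mult: "derive_sym (d_q H g) (csym c * n) = csym c * derive_sym (d_q H g) n"
  using symbol_action.derive_coeff_mult[OF symbol_action_d_q] by (simp add: csym_def)

lemma derive_q_uminus: "derive_sym d (- n) = - derive_sym d n"
  using derive_sym_add[of d n "- n"] by (simp add: eq_neg_iff_add_eq_0 add.commute)

lemma derive_q_commute_Tm:
  "derive_sym (d_q (hbar h) Tm) (derive_sym (d_q (hbar h) (Pos g)) n) =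
   derive_sym (d_q (hbar h) (Pos g)) (derive_sym (d_q (hbar h) Tm) n)"
proof -
  have "derive_sym (d_q (hbar h) Tm) (d_q (hbar h) (Pos g) D) -
      derive_sym (d_q (hbar h) (Pos g)) (d_q (hbar h) Tm D) = csym 0 * d_q (hbar h) Tm D"
    if "D \<in> diff_letters" for D
    using that
    by (cases g; elim insertE)
       (simp_all add: derive_q_csym_mult derive_q_uminus derive_sym_var derive_sym_add)
  from q.derive_commutator[OF this, of n] show ?thesis
    by simp
qed

lemma csym_half: "csym c = csym (c / 2) + csym (c / 2)"
  using csym_add[of "c / 2" "c / 2"] by simp

text \<open>This is the Jacobi identity of a derivative D with the relation [g, g'] = hbar g'',
  checked on the four derivatives. With a = hbar/2 and the shifted derivative as abbreviations it is
  an identity of polynomials.\<close>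

lemma derive_q_commutator:
  assumes "(g, g', g'') \<in> {(CX, CY, CZ), (CY, CZ, CX), (CZ, CX, CY)}"
  shows "derive_sym (d_q (hbar h) (Pos g')) (derive_sym (d_q (hbar h) (Pos g)) n) -
      derive_sym (d_q (hbar h) (Pos g)) (derive_sym (d_q (hbar h) (Pos g')) n) =
      csym (hbar h) * derive_sym (d_q (hbar h) (Pos g'')) n"
proof (rule q.derive_commutator)
  fix D
  assume D: "D \<in> diff_letters"
  define a where "a = csym (hbar h / 2)"
  define t where "t = var_sym DT + csym (2 / hbar h)"
  have a: "csym (hbar h) = a + a"
    unfolding a_def by (rule csym_half)
  have der_a: "derive_sym (d_q (hbar h) g) (a * n) = a * derive_sym (d_q (hbar h) g) n" for g n
    by (simp add: a_def derive_q_csym_mult)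
  have t: "derive_sym (d_q (hbar h) (Pos g)) t = - (a * var_sym (DD g))" for g
    by (simp add: t_def derive_sym_add derive_sym_var a_def)
  show "derive_sym (d_q (hbar h) (Pos g')) (d_q (hbar h) (Pos g) D) -
      derive_sym (d_q (hbar h) (Pos g)) (d_q (hbar h) (Pos g') D) =
      csym (hbar h) * d_q (hbar h) (Pos g'') D"
    using assms D unfolding a
    by (elim insertE; simp add: derive_q_uminus derive_sym_var der_a t distrib_right
        flip: a_def t_def)
qed

lemma commutator_scal: "commutator (p + cscal c) q = commutator p q"
  by (simp add: commutator_def algebra_simps cscal_central)

text \<open>A bracket of a derivative with t or a coordinate acts as multiplication by the table
  entry, by construction of \<open>right_act\<close>. The relations among t and the coordinates need
  an argument: the coefficients contribute a relator, and the derivation parts match by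
  \<open>derive_q_commutator\<close> and \<open>derive_q_commute_Tm\<close>.\<close>

lemma symbol_module_q: "symbol_module (d_q (hbar h)) (rels_q h) (weyl_q h) (coef_q h)"
proof
  let ?d = "d_q (hbar h)" and ?I = "symbol_ideal (rel_ideal (rels_q h))"
  have rot: "right_op ?d n (commutator (gen (Pos g)) (gen (Pos g')) - cscal (hbar h) * gen (Pos g'')) \<in> ?I"
    if g: "(g, g', g'') \<in> {(CX, CY, CZ), (CY, CZ, CX), (CZ, CX, CY)}" for g g' g'' n
  proof -
    have rel: "commutator (gen g) (gen g') - cscal (hbar h) * gen g'' \<in> rel_ideal (rels_q h)"
      by (rule rel_ideal_base) (use g in \<open>auto simp: rels_q_def\<close>)
    have "right_op ?d n (commutator (gen (Pos g)) (gen (Pos g')) - cscal (hbar h) * gen (Pos g'')) =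
        n * coeff_sym (commutator (gen g) (gen g')) - csym (hbar h) * (n * coeff_sym (gen g''))"
      using derive_q_commutator[OF g, of n]
      by (simp add: right_op_diff q.right_op_cscal_mult q.right_op_commutator_Pos q.right_op_gen distrib_left)
    also have "\<dots> = n * coeff_sym (commutator (gen g) (gen g') - cscal (hbar h) * gen g'')"
      by (simp add: coeff_sym_diff coeff_sym_mult right_diff_distrib csym_central csym_def[symmetric]
          flip: mult.assoc)
    finally show ?thesis
      by (simp add: symbol_ideal_lmult coeff_sym_ideal rel)
  qed
  have dtt: "right_op ?d n (dtt h) = n * (var_sym DT + csym (2 / hbar h))" for n
    by (simp add: dtt_def right_op_add q.right_op_gen cscal_def csym_def distrib_left scal_sym_central)
  fix p n
  assume "p \<in> weyl_q h"
  then consider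
      "p \<in> {commutator xo yo - cscal (hbar h) * zo, commutator yo zo - cscal (hbar h) * xo,
        commutator zo xo - cscal (hbar h) * yo}"
    | g where "p = commutator (gen (Pos g)) tm"
    | g g' where "p = commutator (gen (DD g)) (gen (DD g'))"
    | g where "p = commutator (dtt h) (gen (DD g))"
    | "p = commutator (dtt h) tm - cscal (hbar h / 2) * dtt h"
    | g where "p = commutator (dtt h) (gen (Pos g)) + cscal (hbar h / 2) * gen (DD g)"
    | g where "p = commutator (gen (DD g)) tm - cscal (hbar h / 2) * gen (DD g)"
    | g where "p = commutator (gen (DD g)) (gen (Pos g)) - cscal (hbar h / 2) * dtt h"
    | "p \<in> {commutator dx yo - cscal (hbar h / 2) * dz, commutator dx zo + cscal (hbar h / 2) * dy,
     commutator dy xo + cscal (hbar h / 2) * dz, commutator dy zo - cscal (hbar h / 2) * dx,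
     commutator dz xo - cscal (hbar h / 2) * dy, commutator dz yo + cscal (hbar h / 2) * dx}"
    unfolding weyl_q_def Let_def by blast
  then show "right_op ?d n p \<in> ?I"
  proof cases
    case 1
    then show ?thesis
      using rot[of CX CY CZ] rot[of CY CZ CX] rot[of CZ CX CY] by auto
  next
    case 2
    then show ?thesis
      by (simp add: q.right_op_commutator_Tm derive_q_commute_Tm)
  next
    case (3 g g')
    then show ?thesis
      by (cases g; cases g') (simp_all add: q.right_op_commutator_diff)
  next
    case (4 g)
    then show ?thesis
      unfolding dtt_def commutator_scal
      by (cases g) (simp_all add: q.right_op_commutator_diff)
  next
    case 5
    have "commutator (dtt h) tm = commutator dt tm"
      by (simp only: dtt_def commutator_scal)
    then show ?thesis
      by (simp add: 5 right_op_diff q.right_op_commutator_diff_coord q.right_op_cscal_mult dtt csym_central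
          flip: mult.assoc)
  next
    case (6 g)
    then show ?thesis
      unfolding dtt_def commutator_scal
      by (cases g) (simp_all add: right_op_add q.right_op_commutator_diff_coord q.right_op_cscal_mult
          q.right_op_gen csym_central flip: mult.assoc)
  next
    case (7 g)
    then show ?thesis
      by (cases g) (simp_all add: right_op_diff q.right_op_commutator_diff_coord q.right_op_cscal_mult
          q.right_op_gen csym_central flip: mult.assoc)
  next
    case (8 g)
    then show ?thesis
      by (cases g) (simp_all add: right_op_diff q.right_op_commutator_diff_coord
          q.right_op_cscal_mult dtt csym_central flip: mult.assoc)
  next
    case 9
    then show ?thesis
      by (elim insertE) (simp_all add: right_op_diff right_op_add q.right_op_commutator_diff_coord
          q.right_op_cscal_mult q.right_op_gen csym_central flip: mult.assoc)
  qed
next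
  fix p
  assume "p \<in> coef_q h"
  then consider "p = tm - scal t_var" | "p = emb (X^2 + Y^2 + Z^2 + cscal (h^2) - scal (r_var ^ 2))"
    by (auto simp: emb_add emb_diff emb_power)
  then show "right_op (d_q (hbar h)) 1 p \<in> symbol_ideal (rel_ideal (rels_q h))"
  proof cases
    case 1
    then show ?thesis
      by (simp add: right_op_diff q.right_op_gen)
  next
    case 2
    then show ?thesis
      using q.right_op_emb[of 1 "X^2 + Y^2 + Z^2 + cscal (h^2) - scal (r_var ^ 2)"]
      by (simp add: coeff_sym_ideal rel_ideal_base rels_q_def)
  qed
qed

end

section \<open>Calculating with operators\<close>

lemma subgroup_op_null: "subgroup (op_null weyl coef) (add_monoid free_ring)"
proof -
  interpret ring "free_ring :: opgen free ring"
    by (rule ring_free_ring)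
  show ?thesis
    unfolding op_null_def by (rule add.generate_is_subgroup) simp
qed

lemma op_null_add: "p \<in> op_null weyl coef \<Longrightarrow> q \<in> op_null weyl coef \<Longrightarrow> p + q \<in> op_null weyl coef"
  using subgroup.m_closed[OF subgroup_op_null, of p weyl coef q] by simp

lemma op_null_zero [simp]: "0 \<in> op_null weyl coef"
  using subgroup.one_closed[OF subgroup_op_null, of weyl coef] by simp

lemma op_null_uminus: "p \<in> op_null weyl coef \<Longrightarrow> - p \<in> op_null weyl coef"
  using subgroup.m_inv_closed[OF subgroup_op_null, of p weyl coef] a_inv_free_ring[of p]
  by (simp add: a_inv_def)

lemma op_null_diff: "p \<in> op_null weyl coef \<Longrightarrow> q \<in> op_null weyl coef \<Longrightarrow> p - q \<in> op_null weyl coef"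
  using op_null_add[of p weyl coef "- q"] op_null_uminus[of q] by simp

lemma op_null_sum: "(\<And>i. i \<in> A \<Longrightarrow> f i \<in> op_null weyl coef) \<Longrightarrow> sum f A \<in> op_null weyl coef"
  by (induction A rule: infinite_finite_induct) (simp_all add: op_null_add)

lemma op_null_weyl:
  assumes "p \<in> weyl"
  shows "u * p * v \<in> op_null weyl coef"
proof (induction u rule: poly_mapping_induct)
  case (single w f)
  show ?case
  proof (induction v rule: poly_mapping_induct)
    case (single w' g)
    have "Poly_Mapping.single w f * p * Poly_Mapping.single w' g =
        scal (f * g) * monom_word w * p * monom_word w'"
      unfolding single_eq_scal_monom
      by (simp add: scal_mult mult.assoc scal_left_commute[of p] scal_left_commute[of "monom_word w"])
    also have "\<dots> \<in> op_null weyl coef"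
      unfolding op_null_def by (rule generate.incl) (use assms in blast)
    finally show ?case .
  qed (simp add: distrib_left op_null_add)
qed (simp add: distrib_right op_null_add)

lemma op_null_coef:
  assumes "p \<in> coef"
  shows "p * v \<in> op_null weyl coef"
proof (induction v rule: poly_mapping_induct)
  case (single w g)
  have "p * Poly_Mapping.single w g = scal g * p * monom_word w"
    unfolding single_eq_scal_monom by (simp add: mult.assoc scal_left_commute[of p])
  also have "\<dots> \<in> op_null weyl coef"
    unfolding op_null_def by (rule generate.incl) (use assms in blast)
  finally show ?case .
qed (simp add: distrib_left op_null_add)

lemma op_null_induct [consumes 1, case_names zero weyl coef add uminus]:
  assumes "q \<in> op_null weyl coef" and zero: "P 0"
    and "\<And>f u p v. p \<in> weyl \<Longrightarrow> P (scal f * (u * p * v))"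
    and "\<And>f p v. p \<in> coef \<Longrightarrow> P (scal f * (p * v))"
    and "\<And>p q. P p \<Longrightarrow> P q \<Longrightarrow> P (p + q)" "\<And>p. P p \<Longrightarrow> P (- p)"
  shows "P q"
proof -
  have incl: "P p"
    if "p \<in> {scal f * monom_word u * p * monom_word v | f u p v. p \<in> weyl} \<union>
     {scal f * p * monom_word v | f p v. p \<in> coef}" for p
  proof -
    from that consider
      f u q v where "q \<in> weyl" "p = scal f * monom_word u * q * monom_word v" |
      f q v where "q \<in> coef" "p = scal f * q * monom_word v"
      by blast
    then show ?thesis
      by cases (use assms(3,4) in \<open>simp_all add: mult.assoc\<close>)
  qed
  show ?thesis
    using assms(1) unfolding op_null_def
  proof (induction q rule: generate.induct)
    case (inv p)
    have "inv\<^bsub>add_monoid free_ring\<^esub> p = - p"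
      using a_inv_free_ring[of p] by (simp add: a_inv_def)
    then show ?case
      using incl[OF inv] by (simp add: assms(6))
  qed (use incl zero assms(5) in simp_all)
qed


lemma op_null_rmult: "p \<in> op_null weyl coef \<Longrightarrow> p * q \<in> op_null weyl coef"
proof (induction p rule: op_null_induct)
  case (weyl f u p v)
  then show ?case
    using op_null_weyl[of p weyl "scal f * u" "v * q" coef] by (simp add: mult.assoc)
next
  case (coef f p v)
  then show ?case
    using op_null_coef[of p coef "scal f * (v * q)" weyl]
    by (simp add: mult.assoc scal_left_commute[of p])
qed (simp_all add: distrib_right op_null_add op_null_uminus)

lemma op_null_scal: "p \<in> op_null weyl coef \<Longrightarrow> scal f * p \<in> op_null weyl coef"
  using op_null_rmult[of p weyl coef "scal f"] by (simp add: scal_central)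

text \<open>A coordinate on the left pushes a left-end relation into the word. It can be moved back
  because t and the Casimir element commute with coordinates; derivatives allow no such
  step.\<close>

locale operator_module =
  fixes R :: "coord free set" and weyl coef :: "opgen free set"
  assumes Pos_coef: "\<And>g p. p \<in> coef \<Longrightarrow> gen (Pos g) * p \<in> op_null weyl coef"
    and emb_rels: "\<And>a. a \<in> R \<Longrightarrow> emb a \<in> weyl \<union> coef"
begin

lemma op_null_Pos: "p \<in> op_null weyl coef \<Longrightarrow> gen (Pos g) * p \<in> op_null weyl coef"
proof (induction p rule: op_null_induct)
  case (weyl f u p v)
  then show ?case
    using op_null_scal[OF op_null_weyl[of p weyl "gen (Pos g) * u" v coef], of f]
    by (simp add: mult.assoc scal_left_commute[of "gen _"])
next
  case (coef f p v)
  then show ?case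
    using op_null_scal[OF op_null_rmult[OF Pos_coef[of p g], of v], of f]
    by (simp add: mult.assoc scal_left_commute[of "gen _"])
qed (simp_all add: distrib_left op_null_add op_null_uminus)

lemma op_null_emb: "p \<in> op_null weyl coef \<Longrightarrow> emb a * p \<in> op_null weyl coef"
  by (induction a arbitrary: p rule: free_induct)
     (simp_all add: op_null_scal emb_mult emb_add mult.assoc op_null_Pos distrib_right op_null_add)

text \<open>The converse direction to \<open>normal_form_unique\<close>: a null coefficient makes
  the operator null, so coefficients on the left may be taken in the quotient algebra.\<close>

lemma emb_rel_ideal:
  assumes "a \<in> rel_ideal R"
  shows "emb a * q \<in> op_null weyl coef"
proof -
  have "rel_ideal R \<subseteq> {a. \<forall>q. emb a * q \<in> op_null weyl coef}"
  proof (rule rel_ideal_minimal)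
    show "R \<subseteq> {a. \<forall>q. emb a * q \<in> op_null weyl coef}"
      using emb_rels op_null_weyl[of _ weyl 1 _ coef] op_null_coef[of _ coef _ weyl] by fastforce
  qed (auto simp: distrib_right op_null_add emb_add emb_mult mult.assoc op_null_emb)
  then show ?thesis
    using assms by blast
qed

end

lemma coset_op_null_eq_iff:
  "op_null weyl coef +>\<^bsub>free_ring\<^esub> p = op_null weyl coef +>\<^bsub>free_ring\<^esub> q \<longleftrightarrow> p - q \<in> op_null weyl coef"
proof -
  have coset: "op_null weyl coef +>\<^bsub>free_ring\<^esub> p = {r. r - p \<in> op_null weyl coef}" for p
    by (force simp: a_r_coset_def')
  show ?thesis
  proof
    assume "op_null weyl coef +>\<^bsub>free_ring\<^esub> p = op_null weyl coef +>\<^bsub>free_ring\<^esub> q"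
    then have "p \<in> {r. r - q \<in> op_null weyl coef}"
      unfolding coset by force
    then show "p - q \<in> op_null weyl coef"
      by simp
  next
    assume pq: "p - q \<in> op_null weyl coef"
    have "r - p \<in> op_null weyl coef \<longleftrightarrow> r - q \<in> op_null weyl coef" for r
      using op_null_add[OF _ pq, of "r - p"] op_null_diff[OF _ pq, of "r - q"] by auto
    then show "op_null weyl coef +>\<^bsub>free_ring\<^esub> p = op_null weyl coef +>\<^bsub>free_ring\<^esub> q"
      unfolding coset by blast
  qed
qed

lemma op_cl_eq_iff: "op_cl p = op_cl q \<longleftrightarrow> p - q \<in> op_null weyl_cl coef_cl"
  unfolding op_cl_def by (rule coset_op_null_eq_iff)

lemma op_q_eq_iff: "op_q h p = op_q h q \<longleftrightarrow> p - q \<in> op_null (weyl_q h) (coef_q h)"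
  unfolding op_q_def by (rule coset_op_null_eq_iff)

interpretation q: operator_module "rels_q h" "weyl_q h" "coef_q h" for h
proof
  have weyl: "u * p * v \<in> op_null (weyl_q h) (coef_q h)" if "p \<in> weyl_q h" for u p v
    using that by (rule op_null_weyl)
  have xyz: "commutator xo yo - cscal (hbar h) * zo \<in> weyl_q h"
    "commutator yo zo - cscal (hbar h) * xo \<in> weyl_q h"
    "commutator zo xo - cscal (hbar h) * yo \<in> weyl_q h"
    "commutator (gen (Pos g)) tm \<in> weyl_q h" for g
    by (auto simp: weyl_q_def Let_def)
  let ?xy = "commutator xo yo - cscal (hbar h) * zo" and ?yz = "commutator yo zo - cscal (hbar h) * xo"
    and ?zx = "commutator zo xo - cscal (hbar h) * yo"
  let ?C = "xo^2 + yo^2 + zo^2 + cscal (h^2) - scal (r_var ^ 2)"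
  \<comment> \<open>The Casimir element is central. Each bracket is written as a combination of two
    commutation relations, with one letter on either side, in which the multiples of hbar
    cancel.\<close>
  have comm: "commutator (gen (Pos g)) ?C \<in> op_null (weyl_q h) (coef_q h)" for g
  proof (cases g)
    case CX
    have "commutator xo ?C = 1 * ?xy * yo + yo * ?xy * 1 - 1 * ?zx * zo - zo * ?zx * 1"
      by (simp add: commutator_def power2_eq_square cscal_central cscal_left_commute[of "gen _"]
          scal_central[of "gen _"] algebra_simps)
    then show ?thesis
      unfolding CX by (simp only:) (intro op_null_add op_null_diff weyl xyz)
  next
    case CY
    have "commutator yo ?C = 1 * ?yz * zo + zo * ?yz * 1 - 1 * ?xy * xo - xo * ?xy * 1"
      by (simp add: commutator_def power2_eq_square cscal_central cscal_left_commute[of "gen _"]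
          scal_central[of "gen _"] algebra_simps)
    then show ?thesis
      unfolding CY by (simp only:) (intro op_null_add op_null_diff weyl xyz)
  next
    case CZ
    have "commutator zo ?C = 1 * ?zx * xo + xo * ?zx * 1 - 1 * ?yz * yo - yo * ?yz * 1"
      by (simp add: commutator_def power2_eq_square cscal_central cscal_left_commute[of "gen _"]
          scal_central[of "gen _"] algebra_simps)
    then show ?thesis
      unfolding CZ by (simp only:) (intro op_null_add op_null_diff weyl xyz)
  qed
  fix g p
  assume "p \<in> coef_q h"
  then show "gen (Pos g) * p \<in> op_null (weyl_q h) (coef_q h)"
  proof (elim insertE emptyE)
    assume p: "p = tm - scal t_var"
    have "gen (Pos g) * p = 1 * commutator (gen (Pos g)) tm * 1 + p * gen (Pos g)"
      by (simp add: p commutator_def algebra_simps scal_central[of "gen _"])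
    then show ?thesis
      using p by (simp only:) (intro op_null_add op_null_coef weyl xyz; simp)
  next
    assume p: "p = ?C"
    have "gen (Pos g) * p = commutator (gen (Pos g)) p + p * gen (Pos g)"
      by (simp add: commutator_def)
    then show ?thesis
      using p comm[of g] by (simp only:) (intro op_null_add op_null_coef; simp)
  qed
next
  fix a
  assume "a \<in> rels_q h"
  then show "emb a \<in> weyl_q h \<union> coef_q h"
    by (auto simp: rels_q_def weyl_q_def Let_def commutator_def emb_add emb_diff emb_mult emb_power)
qed

section \<open>The quantizing map in low degree\<close>

lemma mem_cls_iff: "q \<in> cls R p \<longleftrightarrow> q - p \<in> rel_ideal R"
  by (force simp: cls_def a_r_coset_def')

text \<open>Classically the derivations are not inner, so invariance is checked on the relators:
  brackets go to sums of brackets, and x^2 + y^2 + z^2 is annihilated already in the free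
  algebra.\<close>

lemma su2_der_ideal_cl: "p \<in> rel_ideal rels_cl \<Longrightarrow> su2_der g p \<in> rel_ideal rels_cl"
proof -
  let ?J = "{p \<in> rel_ideal rels_cl. \<forall>g. su2_der g p \<in> rel_ideal rels_cl}"
  have comm: "commutator a b \<in> rel_ideal rels_cl \<and> - commutator a b \<in> rel_ideal rels_cl"
    if "a \<in> range gen" "b \<in> range gen" for a b
    using that commutator_rels_cl by (auto intro: rel_ideal_uminus)
  have base: "su2_der g (commutator (gen a) (gen b)) =
      commutator (su2_bracket g a) (gen b) + commutator (gen a) (su2_bracket g b)" for g a b
    by (simp add: commutator_def derivation_diff derivation_mult algebra_simps)
  have zero: "commutator 0 a = 0" "commutator a 0 = 0" "commutator (- a) b = - commutator a b"
    "commutator a (- b) = - commutator a b" for a b :: "coord free"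
    by (simp_all add: commutator_def)
  have "su2_der g (commutator (gen a) (gen b)) \<in> rel_ideal rels_cl" for g a b
    unfolding base
    by (intro rel_ideal_add; cases g; cases a; cases b) (simp_all add: zero comm)
  moreover have "su2_der g (X^2 + Y^2 + Z^2 - scal (r_var ^ 2)) = 0" for g
    by (cases g) (simp_all add: derivation_diff derivation_add derivation_mult power2_eq_square)
  ultimately have "rels_cl \<subseteq> ?J"
    using rel_ideal_base[of _ rels_cl] by (auto simp: rels_cl_def)
  then have "rel_ideal rels_cl \<subseteq> ?J"
    by (rule rel_ideal_minimal)
       (auto simp: derivation_add derivation_mult rel_ideal_add rel_ideal_lmult rel_ideal_rmult)
  then show "p \<in> rel_ideal rels_cl \<Longrightarrow> su2_der g p \<in> rel_ideal rels_cl"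
    by blast
qed

text \<open>Invariance of the ideal makes all classes in the union over representatives
  coincide.\<close>

lemma act_cl_cls: "act_cl g (cls rels_cl p) = cls rels_cl (su2_der g p)"
proof -
  have "cls rels_cl (su2_der g q) = cls rels_cl (su2_der g p)" if "q \<in> cls rels_cl p" for q
    using su2_der_ideal_cl[of "q - p" g] that by (simp add: mem_cls_iff cls_eq_iff derivation_diff)
  moreover have "p \<in> cls rels_cl p"
    by (simp add: mem_cls_iff)
  ultimately show ?thesis
    unfolding act_cl_def by blast
qed

lemma V_cl_add: "a \<in> V_cl k \<Longrightarrow> b \<in> V_cl k \<Longrightarrow> a \<oplus>\<^bsub>presented rels_cl\<^esub> b \<in> V_cl k"
  and V_cl_smult: "a \<in> V_cl k \<Longrightarrow> smult_cls rels_cl (const c) a \<in> V_cl k"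
  and V_cl_act: "a \<in> V_cl k \<Longrightarrow> act_cl g a \<in> V_cl k"
  and V_cl_vec: "cls rels_cl (b_vec ^ k) \<in> V_cl k"
  unfolding V_cl_def by (fact su2_submodule.intros)+

lemma cscal_triple: "cscal 3 * p = p + p + p"
proof -
  have "cscal (1 + 1 + 1) * p = p + p + p"
    by (simp only: cscal_add cscal_one distrib_right mult_1_left)
  then show ?thesis
    by simp
qed

locale quantization =
  fixes h :: complex and \<alpha> :: "coord free set \<Rightarrow> coord free set"
  assumes h: "hbar h \<noteq> 0" and \<alpha>: "quantizing_map h \<alpha>"
begin

lemma alpha_hom: "\<alpha> \<in> hom (add_monoid A_cl) (add_monoid (A_q h))"
  and alpha_smult: "a \<in> carrier A_cl \<Longrightarrow> \<alpha> (smult_cls rels_cl f a) = smult_cls (rels_q h) f (\<alpha> a)"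
  and alpha_b_power: "\<alpha> (cls rels_cl (b_vec ^ k)) = cls (rels_q h) (b_vec ^ k)"
  and alpha_act: "u \<in> V_cl k \<Longrightarrow> \<alpha> (act_cl g u) = act_q h g (\<alpha> u)"
  using \<alpha> unfolding quantizing_map_def by blast+

definition quantizes :: "coord free \<Rightarrow> coord free \<Rightarrow> bool"
  where "quantizes p q \<longleftrightarrow> \<alpha> (cls rels_cl p) = cls (rels_q h) q"

lemma quantizes_add: "quantizes p q \<Longrightarrow> quantizes p' q' \<Longrightarrow> quantizes (p + p') (q + q')"
  using alpha_hom by (simp add: quantizes_def hom_def A_cl_def A_q_def flip: cls_add)

lemma quantizes_scal: "quantizes p q \<Longrightarrow> quantizes (scal f * p) (scal f * q)"
  using alpha_smult[of "cls rels_cl p" f] by (simp add: quantizes_def A_cl_def smult_cls_cls)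

lemma quantizes_cscal: "quantizes p q \<Longrightarrow> quantizes (cscal c * p) (cscal c * q)"
  by (simp add: cscal_def quantizes_scal)

lemma quantizes_one: "quantizes 1 1"
  using alpha_b_power[of 0] by (simp add: quantizes_def)

lemma quantizes_scal': "quantizes (scal f) (scal f)"
  using quantizes_scal[OF quantizes_one, of f] by simp

lemma quantizes_uminus: "quantizes p q \<Longrightarrow> quantizes (- p) (- q)"
  using quantizes_cscal[of p q "- 1"] by (simp add: cscal_uminus)

lemma quantizes_diff: "quantizes p q \<Longrightarrow> quantizes p' q' \<Longrightarrow> quantizes (p - p') (q - q')"
  using quantizes_add[of p q "- p'" "- q'"] quantizes_uminus[of p' q'] by simp

lemma quantizes_zero: "quantizes 0 0"
  using quantizes_scal'[of 0] by simp

lemma quantizes_cong: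
  assumes "quantizes p q" "p - p' \<in> rel_ideal rels_cl" "q - q' \<in> rel_ideal (rels_q h)"
  shows "quantizes p' q'"
  using assms by (simp add: quantizes_def flip: cls_eq_iff)

lemma quantizes_cscal_cancel:
  assumes "quantizes (cscal c * p) (cscal c * q)" "c \<noteq> 0"
  shows "quantizes p q"
  using quantizes_cscal[OF assms(1), of "inverse c"] assms(2) by (simp flip: mult.assoc cscal_mult)

text \<open>Equivariance of \<alpha> is assumed only on each V^k, so membership has to be carried
  along with the statement that \<alpha> fixes the representative.\<close>

definition preserved :: "nat \<Rightarrow> coord free \<Rightarrow> bool"
  where "preserved k p \<longleftrightarrow> cls rels_cl p \<in> V_cl k \<and> quantizes p p"

lemma preserved_b_power: "preserved k (b_vec ^ k)"
  by (simp add: preserved_def V_cl_vec quantizes_def alpha_b_power)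

lemma preserved_add: "preserved k p \<Longrightarrow> preserved k q \<Longrightarrow> preserved k (p + q)"
  using V_cl_add[of "cls rels_cl p" k "cls rels_cl q"] by (simp add: preserved_def quantizes_add cls_add)

lemma preserved_cscal: "preserved k p \<Longrightarrow> preserved k (cscal c * p)"
  using V_cl_smult[of "cls rels_cl p" k c]
  by (simp add: preserved_def quantizes_scal smult_cls_cls cscal_def)

lemma preserved_su2_der: "preserved k p \<Longrightarrow> preserved k (su2_der g p)"
  using V_cl_act[of "cls rels_cl p" k g] alpha_act[of "cls rels_cl p" k g]
  by (simp add: preserved_def quantizes_def act_cl_cls act_q_cls[OF h])

lemma preserved_uminus: "preserved k p \<Longrightarrow> preserved k (- p)"
  using preserved_cscal[of k p "- 1"] by (simp add: cscal_uminus)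

lemma preserved_cscal_cancel:
  assumes "preserved k (cscal c * p)" "c \<noteq> 0"
  shows "preserved k p"
  using preserved_cscal[OF assms(1), of "inverse c"] assms(2) by (simp flip: mult.assoc cscal_mult)

lemma preserved_if_su2_der:
  assumes "su2_der g p = cscal c * q" "c \<noteq> 0" "preserved k p"
  shows "preserved k q"
  by (rule preserved_cscal_cancel[OF _ assms(2)]) (use preserved_su2_der[OF assms(3), of g] in \<open>simp only: assms(1)\<close>)

lemma quantizes_gen: "quantizes (gen g) (gen g)"
proof -
  have "su2_der CX (b_vec ^ 1) = - Z"
    by (simp add: b_vec_def derivation_diff)
  then have Z: "preserved 1 Z"
    using preserved_uminus[OF preserved_su2_der[OF preserved_b_power[of 1], of CX]] by simp
  then have "preserved 1 X" "preserved 1 Y"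
    using preserved_su2_der[OF Z, of CY] preserved_uminus[OF preserved_su2_der[OF Z, of CX]] by simp_all
  with Z show ?thesis
    by (cases g) (simp_all add: preserved_def)
qed

text \<open>All five elements arise from b^2 by derivations and complex combinations inside the free
  algebra. No commutation relation is applied, so the same symmetric words represent them on both
  sides.\<close>

lemma preserved_degree_2:
  "preserved 2 (X * Y + Y * X)" "preserved 2 (X * Z + Z * X)" "preserved 2 (Y * Z + Z * Y)"
  "preserved 2 (X * X + Y * Y - 2 * (Z * Z))" "preserved 2 (X * X - Y * Y)"
proof -
  have b: "b_vec ^ 2 = Y * Y - X * X + cscal \<i> * (X * Y + Y * X)"
    by (simp add: b_vec_def power2_eq_square algebra_simps cscal_left_commute[of X]
        cscal_left_commute[of Y] cscal_i_i)
  have "su2_der CY (su2_der CX (b_vec ^ 2)) + cscal \<i> * b_vec ^ 2 =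
      cscal \<i> * (X * X + Y * Y - 2 * (Z * Z))"
    unfolding b mult_2 by (simp add: derivation_add derivation_diff derivation_mult cscal_i_i algebra_simps)
  moreover have "preserved 2 (su2_der CY (su2_der CX (b_vec ^ 2)) + cscal \<i> * b_vec ^ 2)"
    by (intro preserved_add preserved_su2_der preserved_cscal preserved_b_power)
  ultimately have "preserved 2 (cscal \<i> * (X * X + Y * Y - 2 * (Z * Z)))"
    by (simp only:)
  then have 4: "preserved 2 (X * X + Y * Y - 2 * (Z * Z))"
    by (rule preserved_cscal_cancel) simp
  have "su2_der CX (X * X + Y * Y - 2 * (Z * Z)) = cscal 3 * (Y * Z + Z * Y)"
    unfolding mult_2 cscal_triple by (simp add: derivation_add derivation_diff derivation_mult algebra_simps)
  then have 3: "preserved 2 (Y * Z + Z * Y)"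
    by (rule preserved_if_su2_der) (simp_all add: 4)
  have 2: "preserved 2 (X * Z + Z * X)"
    using preserved_uminus[OF preserved_su2_der[OF 3, of CZ]]
    by (simp add: derivation_add derivation_mult algebra_simps)
  have 1: "preserved 2 (X * Y + Y * X)"
    using preserved_su2_der[OF 3, of CY] by (simp add: derivation_add derivation_mult algebra_simps)
  have "su2_der CZ (X * Y + Y * X) = cscal (- (2 * 1)) * (X * X - Y * Y)"
    unfolding cscal_uminus mult_minus_left cscal_double
    by (simp add: derivation_add derivation_mult algebra_simps)
  then have 5: "preserved 2 (X * X - Y * Y)"
    by (rule preserved_if_su2_der) (simp_all add: 1)
  show "preserved 2 (X * Y + Y * X)" "preserved 2 (X * Z + Z * X)" "preserved 2 (Y * Z + Z * Y)"
    "preserved 2 (X * X + Y * Y - 2 * (Z * Z))" "preserved 2 (X * X - Y * Y)"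
    by (fact 1 2 3 4 5)+
qed

lemma quantizes_product: "quantizes (2 * (gen g * gen g')) (gen g * gen g' + gen g' * gen g)" if "g \<noteq> g'"
proof -
  have "quantizes (gen g * gen g' + gen g' * gen g) (gen g * gen g' + gen g' * gen g)"
    using that preserved_degree_2(1-3) by (cases g; cases g') (auto simp: preserved_def add.commute)
  then show ?thesis
    using commutator_rels_cl[of g' g]
    by (elim quantizes_cong) (simp_all add: commutator_def mult_2)
qed

lemma quantizes_square: "quantizes (gen g * gen g) (gen g * gen g + cscal (h^2 / 3))"
proof -
  let ?s = "X * X + Y * Y + Z * Z"
  have "preserved 2 (cscal 3 * (gen g * gen g) - ?s)"
  proof (cases g)
    case CX
    have "cscal 3 * (X * X) - ?s = cscal (1/2) * (X * X + Y * Y - 2 * (Z * Z)) + cscal (3/2) * (X * X - Y * Y)"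
    proof -
      have "cscal 2 * (cscal 3 * (X * X) - ?s) =
          (X * X + Y * Y - 2 * (Z * Z)) + cscal 3 * (X * X - Y * Y)"
        unfolding cscal_triple mult_2 cscal_double[of 1, simplified] by simp
      then have "cscal (1/2) * (cscal 2 * (cscal 3 * (X * X) - ?s)) =
          cscal (1/2) * ((X * X + Y * Y - 2 * (Z * Z)) + cscal 3 * (X * X - Y * Y))"
        by (rule arg_cong)
      then show ?thesis
        by (simp add: distrib_left flip: mult.assoc cscal_mult)
    qed
    then show ?thesis
      using preserved_degree_2 by (simp add: CX preserved_add preserved_cscal)
  next
    case CY
    have "cscal 3 * (Y * Y) - ?s = cscal (1/2) * (X * X + Y * Y - 2 * (Z * Z)) + cscal (- (3/2)) * (X * X - Y * Y)"
    proof -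
      have "cscal 2 * (cscal 3 * (Y * Y) - ?s) =
          (X * X + Y * Y - 2 * (Z * Z)) + cscal (- 3) * (X * X - Y * Y)"
        unfolding cscal_triple mult_2 cscal_double[of 1, simplified] cscal_uminus mult_minus_left by simp
      then have "cscal (1/2) * (cscal 2 * (cscal 3 * (Y * Y) - ?s)) =
          cscal (1/2) * ((X * X + Y * Y - 2 * (Z * Z)) + cscal (- 3) * (X * X - Y * Y))"
        by (rule arg_cong)
      then show ?thesis
        by (simp add: distrib_left flip: mult.assoc cscal_mult)
    qed
    then show ?thesis
      using preserved_degree_2 by (simp add: CY preserved_add preserved_cscal)
  next
    case CZ
    have "cscal 3 * (Z * Z) - ?s = - (X * X + Y * Y - 2 * (Z * Z))"
      unfolding cscal_triple mult_2 by simp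
    then show ?thesis
      unfolding CZ using preserved_uminus[OF preserved_degree_2(4)] by (simp only:)
  qed
  \<comment> \<open>The sum of squares is the scalar r^2 classically, but r^2 - h^2 in the quantum
    algebra. Added to the preserved traceless part and divided by 3, this gives the summand
    h^2/3.\<close>
  moreover have "quantizes ?s (?s + cscal (h^2))"
  proof (rule quantizes_cong[OF quantizes_scal'[of "r_var ^ 2"]])
    show "scal (r_var ^ 2) - ?s \<in> rel_ideal rels_cl"
      using rel_ideal_uminus[OF rel_ideal_base[of "X^2 + Y^2 + Z^2 - scal (r_var ^ 2)" rels_cl]]
      by (simp add: rels_cl_def power2_eq_square)
    show "scal (r_var ^ 2) - (?s + cscal (h^2)) \<in> rel_ideal (rels_q h)"
      using rel_ideal_uminus[OF rel_ideal_base[of "X^2 + Y^2 + Z^2 + cscal (h^2) - scal (r_var ^ 2)" "rels_q h"]]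
      by (simp add: rels_q_def power2_eq_square)
  qed
  ultimately have "quantizes (cscal 3 * (gen g * gen g) - ?s + ?s)
      (cscal 3 * (gen g * gen g) - ?s + (?s + cscal (h^2)))"
    unfolding preserved_def by (blast intro: quantizes_add)
  also have "cscal 3 * (gen g * gen g) - ?s + (?s + cscal (h^2)) =
      cscal 3 * (gen g * gen g + cscal (h^2 / 3))"
    by (simp add: distrib_left flip: cscal_mult)
  finally have "quantizes (cscal 3 * (gen g * gen g)) (cscal 3 * (gen g * gen g + cscal (h^2 / 3)))"
    by (simp only: diff_add_cancel)
  then show ?thesis
    by (rule quantizes_cscal_cancel) simp
qed

text \<open>Two normally ordered forms of \<open>D\<close> have the same coefficient classes by the
  classical normal form theorem; \<alpha> sends equal classes to equal classes, and null differences
  of quantum coefficients give null operators.\<close>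

lemma is_quantization_unique:
  assumes "is_quantization h \<alpha> D E" "is_quantization h \<alpha> D E'"
  shows "E = E'"
proof -
  obtain B a a' where B: "finite B" "\<And>\<beta>. \<beta> \<in> B \<Longrightarrow> quantizes (a \<beta>) (a' \<beta>)"
      "D = op_cl (\<Sum>\<beta>\<in>B. emb (a \<beta>) * d_mon \<beta>)" "E = op_q h (\<Sum>\<beta>\<in>B. emb (a' \<beta>) * d_mon \<beta>)"
    using assms(1) unfolding is_quantization_def quantizes_def by blast
  obtain C b b' where C: "finite C" "\<And>\<beta>. \<beta> \<in> C \<Longrightarrow> quantizes (b \<beta>) (b' \<beta>)"
      "D = op_cl (\<Sum>\<beta>\<in>C. emb (b \<beta>) * d_mon \<beta>)" "E' = op_q h (\<Sum>\<beta>\<in>C. emb (b' \<beta>) * d_mon \<beta>)"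
    using assms(2) unfolding is_quantization_def quantizes_def by blast
  \<comment> \<open>Both families are extended by 0 to the union of their index sets so that they
    can be subtracted.\<close>
  let ?on = "\<lambda>S (a :: _ \<Rightarrow> coord free) \<beta>. if \<beta> \<in> S then a \<beta> else 0"
  have ext: "(\<Sum>\<beta>\<in>S. emb (a \<beta>) * d_mon \<beta>) = (\<Sum>\<beta>\<in>B \<union> C. emb (?on S a \<beta>) * d_mon \<beta>)"
    if "S \<subseteq> B \<union> C" for S a
    using B(1) C(1) that by (intro sum.mono_neutral_cong_left) auto
  have fin: "finite (B \<union> C)"
    using B(1) C(1) by simp
  have quant: "quantizes (?on B a \<beta>) (?on B a' \<beta>)" "quantizes (?on C b \<beta>) (?on C b' \<beta>)" for \<beta>
    using B(2) C(2) quantizes_zero by auto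
  have "(\<Sum>\<beta>\<in>B \<union> C. emb (?on B a \<beta> - ?on C b \<beta>) * d_mon \<beta>) \<in> op_null weyl_cl coef_cl"
    using trans[OF B(3)[symmetric] C(3)]
    by (simp only: op_cl_eq_iff ext[OF Un_upper1] ext[OF Un_upper2] emb_diff left_diff_distrib
        sum_subtractf)
  then have "?on B a \<beta> - ?on C b \<beta> \<in> rel_ideal rels_cl" if "\<beta> \<in> B \<union> C" for \<beta>
    by (rule cl.normal_form_unique[OF fin _ that])
  note diff = this
  have diff': "?on B a' \<beta> - ?on C b' \<beta> \<in> rel_ideal (rels_q h)" if "\<beta> \<in> B \<union> C" for \<beta>
  proof -
    have "cls rels_cl (?on B a \<beta>) = cls rels_cl (?on C b \<beta>)"
      using diff[OF that] unfolding cls_eq_iff .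
    then show ?thesis
      using quant[of \<beta>] unfolding quantizes_def cls_eq_iff[symmetric] by argo
  qed
  have "(\<Sum>\<beta>\<in>B \<union> C. emb (?on B a' \<beta> - ?on C b' \<beta>) * d_mon \<beta>) \<in> op_null (weyl_q h) (coef_q h)"
    by (intro op_null_sum q.emb_rel_ideal diff')
  then show ?thesis
    by (simp only: B(4) C(4) op_q_eq_iff ext[OF Un_upper1] ext[OF Un_upper2] emb_diff
        left_diff_distrib sum_subtractf)
qed

lemma quantize_eqI: "is_quantization h \<alpha> D E \<Longrightarrow> quantize h \<alpha> D = E"
  unfolding quantize_def by (rule the_equality) (simp, rule is_quantization_unique)

end

section \<open>Normal ordering\<close>

text \<open>The second-order part of Q^2. The derivatives are in the fixed order of
  \<open>d_mon\<close>, so the two orders of a pair of coordinates are added; these are exactly the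
  symmetric words that \<alpha> preserves.\<close>

abbreviation xx_dd :: "opgen free"
  where "xx_dd \<equiv> xo * xo * (dx * dx) + yo * yo * (dy * dy) + zo * zo * (dz * dz) +
    (xo * yo + yo * xo) * (dx * dy) + (xo * zo + zo * xo) * (dx * dz) + (yo * zo + zo * yo) * (dy * dz)"

lemma Q_square_cl: "Q_op ^ 2 - (xx_dd + Q_op) \<in> op_null weyl_cl coef"
proof -
  have "commutator (gen (DD g)) (gen (Pos g')) - (if g = g' then 1 else 0) \<in> weyl_cl" for g g'
    unfolding weyl_cl_def by blast
  then have dx: "u * (commutator (gen (DD g)) (gen (Pos g')) - (if g = g' then 1 else 0)) * v \<in> op_null weyl_cl coef"
    for g g' u v
    by (rule op_null_weyl)
  have "commutator (gen (DD g)) (gen (DD g')) \<in> weyl_cl" for g g'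
    unfolding weyl_cl_def by blast
  then have dd: "u * commutator (gen (DD g)) (gen (DD g')) * v \<in> op_null weyl_cl coef" for g g' u v
    by (rule op_null_weyl)
  have "Q_op ^ 2 - (xx_dd + Q_op) =
      xo * (commutator dx xo - 1) * dx + xo * commutator dx yo * dy + xo * commutator dx zo * dz +
      yo * commutator dy xo * dx + yo * (commutator dy yo - 1) * dy + yo * commutator dy zo * dz +
      zo * commutator dz xo * dx + zo * commutator dz yo * dy + zo * (commutator dz zo - 1) * dz -
      (yo * xo * commutator dx dy * 1 + zo * xo * commutator dx dz * 1 + zo * yo * commutator dy dz * 1)"
    by (simp add: Q_op_def commutator_def power2_eq_square algebra_simps)
  also have "\<dots> \<in> op_null weyl_cl coef"
    using dx[where g = CX and g' = CX] dx[where g = CX and g' = CY] dx[where g = CX and g' = CZ]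
      dx[where g = CY and g' = CX] dx[where g = CY and g' = CY] dx[where g = CY and g' = CZ]
      dx[where g = CZ and g' = CX] dx[where g = CZ and g' = CY] dx[where g = CZ and g' = CZ]
    by (intro op_null_add op_null_diff dd) simp_all
  finally show ?thesis .
qed

text \<open>The mixed term comes from [d_g, g] = (hbar/2) dtt = (hbar/2) dt + 1 in each diagonal
  bracket. The off-diagonal brackets contribute commutators of spatial derivatives, which are
  null.\<close>

lemma Q_square_q:
  assumes h: "hbar h \<noteq> 0"
  shows "Q_op ^ 2 - (xx_dd + Q_op + cscal (hbar h / 2) * (Q_op * dt)) \<in> op_null (weyl_q h) coef"
proof -
  define H where "H = (cscal (hbar h / 2) :: opgen free)"
  have H: "gen a * (H * p) = H * (gen a * p)" "gen a * H = H * gen a" for a p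
    by (simp_all add: H_def cscal_central cscal_left_commute[of "gen a"])
  have H_dtt: "H * dtt h = H * dt + 1" "H * (dtt h * p) = H * (dt * p) + p" for p
    using h by (simp_all add: H_def dtt_def distrib_left distrib_right flip: cscal_mult mult.assoc)
  have weyl: "u * p * v \<in> op_null (weyl_q h) coef" if "p \<in> weyl_q h" for u p v
    using that by (rule op_null_weyl)
  have rels: "commutator (gen (DD g)) (gen (Pos g)) - H * dtt h \<in> weyl_q h"
    "commutator dx yo - H * dz \<in> weyl_q h" "commutator dx zo + H * dy \<in> weyl_q h"
    "commutator dy xo + H * dz \<in> weyl_q h" "commutator dy zo - H * dx \<in> weyl_q h"
    "commutator dz xo - H * dy \<in> weyl_q h" "commutator dz yo + H * dx \<in> weyl_q h"
    "commutator (gen (DD g)) (gen (DD g')) \<in> weyl_q h"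
    "commutator (dtt h) (gen (DD g)) \<in> weyl_q h" for g g'
    by (auto simp: weyl_q_def Let_def H_def)
  have dtt: "commutator dt (gen (DD g)) = commutator (dtt h) (gen (DD g))" for g
    by (simp only: dtt_def commutator_scal)
  have "Q_op ^ 2 - (xx_dd + Q_op + H * (Q_op * dt)) =
      xo * (commutator dx xo - H * dtt h) * dx + xo * (commutator dx yo - H * dz) * dy +
      xo * (commutator dx zo + H * dy) * dz + yo * (commutator dy xo + H * dz) * dx +
      yo * (commutator dy yo - H * dtt h) * dy + yo * (commutator dy zo - H * dx) * dz +
      zo * (commutator dz xo - H * dy) * dx + zo * (commutator dz yo + H * dx) * dy +
      zo * (commutator dz zo - H * dtt h) * dz +
      (H * xo * commutator dt dx * 1 + H * yo * commutator dt dy * 1 + H * zo * commutator dt dz * 1) -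
      (yo * xo * commutator dx dy * 1 + zo * xo * commutator dx dz * 1 + zo * yo * commutator dy dz * 1) +
      (H * xo * commutator dz dy * 1 + H * yo * commutator dx dz * 1 + H * zo * commutator dy dx * 1)"
    by (simp add: Q_op_def commutator_def power2_eq_square H H_dtt algebra_simps)
  also have "\<dots> \<in> op_null (weyl_q h) coef"
    unfolding dtt by (intro op_null_add op_null_diff weyl rels)
  finally show ?thesis
    by (simp only: H_def)
qed

definition order2_index :: "(nat \<times> nat \<times> nat \<times> nat) set"
  where "order2_index = {(0,0,0,0), (1,0,0,0), (2,0,0,0), (0,1,0,0), (0,0,1,0), (0,0,0,1),
    (1,1,0,0), (1,0,1,0), (1,0,0,1), (0,2,0,0), (0,0,2,0), (0,0,0,2), (0,1,1,0), (0,1,0,1), (0,0,1,1)}"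

text \<open>\<open>a\<close> holds the powers of dt, \<open>b\<close> the spatial first order,
  \<open>c\<close> the mixed terms and \<open>d\<close> the spatial second order. The final branch
  also covers indices outside \<open>order2_index\<close>, so that coefficients quantize at every
  index.\<close>

definition order2_coeffs :: "(nat \<Rightarrow> coord free) \<Rightarrow> (coord \<Rightarrow> coord free) \<Rightarrow> (coord \<Rightarrow> coord free) \<Rightarrow>
    (coord \<Rightarrow> coord \<Rightarrow> coord free) \<Rightarrow> nat \<times> nat \<times> nat \<times> nat \<Rightarrow> coord free"
  where "order2_coeffs a b c d = (\<lambda>(i, j, k, l).
    if (j, k, l) = (0,0,0) then a i
    else if (j, k, l) = (1,0,0) then (if i = 0 then b CX else c CX)
    else if (j, k, l) = (0,1,0) then (if i = 0 then b CY else c CY)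
    else if (j, k, l) = (0,0,1) then (if i = 0 then b CZ else c CZ)
    else if (j, k, l) = (2,0,0) then d CX CX else if (j, k, l) = (0,2,0) then d CY CY
    else if (j, k, l) = (0,0,2) then d CZ CZ else if (j, k, l) = (1,1,0) then d CX CY
    else if (j, k, l) = (1,0,1) then d CX CZ else d CY CZ)"

lemma sum_order2: "(\<Sum>\<beta>\<in>order2_index. emb (order2_coeffs a b c d \<beta>) * d_mon \<beta>) =
    emb (a 0) + emb (a 1) * dt + emb (a 2) * dt ^ 2 + emb (b CX) * dx + emb (b CY) * dy + emb (b CZ) * dz +
    emb (c CX) * (dt * dx) + emb (c CY) * (dt * dy) + emb (c CZ) * (dt * dz) +
    emb (d CX CX) * (dx * dx) + emb (d CY CY) * (dy * dy) + emb (d CZ CZ) * (dz * dz) +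
    emb (d CX CY) * (dx * dy) + emb (d CX CZ) * (dx * dz) + emb (d CY CZ) * (dy * dz)"
  by (simp add: order2_index_def order2_coeffs_def d_mon_def power2_eq_square add.assoc)

context quantization
begin

lemma quantizes_order2:
  assumes "\<And>i. quantizes (a i) (a' i)" "\<And>g. quantizes (b g) (b' g)" "\<And>g. quantizes (c g) (c' g)"
    and "\<And>g g'. quantizes (d g g') (d' g g')"
  shows "quantizes (order2_coeffs a b c d \<beta>) (order2_coeffs a' b' c' d' \<beta>)"
  using assms by (cases \<beta>) (simp add: order2_coeffs_def)

text \<open>The rational coefficients are arbitrary here; the metric enters only when they are
  specialised. The proof exhibits matching coefficients on the 15 multi-indices of order at most
  two.\<close>

lemma quantize_second_order:
  "quantize h \<alpha> (op_cl (scal a * dt^2 - scal g * Q_op^2 - scal e * Q_op - Lap)) =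
   op_q h (scal a * dt^2 - scal g * Q_op^2 - scal e * Q_op + scal (const (hbar h / 2) * g) * (Q_op * dt)
     - scal (1 - const (hbar h ^ 2 / 12) * g) * Lap)"
proof (rule quantize_eqI)
  \<comment> \<open>The diagonal -1 is -Lap. Off the diagonal both orders of the coordinates agree
    classically, hence the factor 2, which \<open>b'\<close> resolves into the symmetric
    sum.\<close>
  define b where "b i j = (if i = j then - (scal g * (gen i * gen j)) - 1
      else - (scal g * (2 * (gen i * gen j))))" for i j :: coord
  define b' where "b' i j = (if i = j then - (scal g * (gen i * gen j + cscal (h^2 / 3))) - 1
      else - (scal g * (gen i * gen j + gen j * gen i)))" for i j :: coord
  \<comment> \<open>The summand \<open>g\<close> is the first-order term Q in the classical Q^2. The
    quantum Q^2 contains the same term, so only \<open>e\<close> remains in front of Q in the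
    result.\<close>
  define c where "c i = - (scal (g + e) * gen i)" for i :: coord
  let ?a = "\<lambda>i :: nat. if i = 2 then scal a else 0" and ?z = "\<lambda>_ :: coord. 0 :: coord free"
  let ?D = "scal a * dt^2 - scal g * Q_op^2 - scal e * Q_op - Lap"
  let ?E = "scal a * dt^2 - scal g * Q_op^2 - scal e * Q_op + scal (const (hbar h / 2) * g) * (Q_op * dt)
     - scal (1 - const (hbar h ^ 2 / 12) * g) * Lap"
  have 1: "quantizes (order2_coeffs ?a c ?z b \<beta>) (order2_coeffs ?a c ?z b' \<beta>)" for \<beta>
  proof (rule quantizes_order2)
    show "quantizes (b i j) (b' i j)" for i j
      by (simp add: b_def b'_def quantizes_uminus quantizes_diff quantizes_scal quantizes_one
          quantizes_square quantizes_product)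
  qed (simp_all add: c_def quantizes_uminus quantizes_scal quantizes_scal' quantizes_zero quantizes_gen)
  have "?D - (\<Sum>\<beta>\<in>order2_index. emb (order2_coeffs ?a c ?z b \<beta>) * d_mon \<beta>) =
      - (scal g * (Q_op ^ 2 - (xx_dd + Q_op))) +
      scal g * (1 * commutator xo yo * (dx * dy) + 1 * commutator xo zo * (dx * dz) +
        1 * commutator yo zo * (dy * dz))"
    unfolding sum_order2
    by (simp add: b_def c_def emb_diff emb_uminus emb_mult emb_add commutator_def Lap_def
        power2_eq_square scal_add mult_2 algebra_simps) (simp add: Q_op_def algebra_simps)
  also have "\<dots> \<in> op_null weyl_cl coef_cl"
  proof -
    have "commutator (gen (Pos g)) (gen (Pos g')) \<in> weyl_cl" for g g'
      unfolding weyl_cl_def by blast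
    then show ?thesis
      by (intro op_null_add op_null_diff op_null_uminus op_null_scal Q_square_cl op_null_weyl)
  qed
  finally have 2: "op_cl ?D = op_cl (\<Sum>\<beta>\<in>order2_index. emb (order2_coeffs ?a c ?z b \<beta>) * d_mon \<beta>)"
    by (simp only: op_cl_eq_iff)
  \<comment> \<open>The h^2/3 in \<open>b'\<close> contributes -g h^2/3 = g hbar^2/12 to each
    squared derivative; with -Lap this makes -(1 - (hbar^2/12) g).\<close>
  have hh: "hbar h ^ 2 / 12 = - (h ^ 2 / 3)"
    by (simp add: hbar_def power2_eq_square)
  have g: "scal g * (cscal s * p) = cscal s * (scal g * p)" "scal g * cscal s = cscal s * scal g" for s p
    by (simp_all add: cscal_central cscal_left_commute[of "scal g"])
  have "?E - (\<Sum>\<beta>\<in>order2_index. emb (order2_coeffs ?a c ?z b' \<beta>) * d_mon \<beta>) =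
      - (scal g * (Q_op ^ 2 - (xx_dd + Q_op + cscal (hbar h / 2) * (Q_op * dt))))"
    unfolding sum_order2 hh
    by (simp add: b'_def c_def emb_diff emb_uminus emb_mult emb_add Lap_def const_uminus
        power2_eq_square scal_add scal_diff scal_mult g algebra_simps flip: cscal_def)
       (simp add: Q_op_def algebra_simps)
  also have "\<dots> \<in> op_null (weyl_q h) (coef_q h)"
    by (intro op_null_uminus op_null_scal Q_square_q h)
  finally have 3: "op_q h ?E = op_q h (\<Sum>\<beta>\<in>order2_index. emb (order2_coeffs ?a c ?z b' \<beta>) * d_mon \<beta>)"
    by (simp only: op_q_eq_iff)
  have "finite order2_index"
    by (simp add: order2_index_def)
  then show "is_quantization h \<alpha> (op_cl ?D) (op_q h ?E)"
    unfolding is_quantization_def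
    by (intro exI[of _ order2_index] exI[of _ "order2_coeffs ?a c ?z b"] exI[of _ "order2_coeffs ?a c ?z b'"]
        conjI ballI 1[unfolded quantizes_def] 2 3)
qed

end

section \<open>Independence of the invariant operators\<close>

context
  fixes h :: complex
  assumes h: "hbar h \<noteq> 0"
begin

lemma scal_cancel: "F \<noteq> 0 \<Longrightarrow> scal F * p \<in> rel_ideal R \<Longrightarrow> p \<in> rel_ideal R"
  using rel_ideal_lmult[of "scal F * p" R "scal (inverse F)"] by (simp flip: mult.assoc scal_mult)

lemma r_var_square_ne: "r_var ^ 2 - const c \<noteq> 0"
proof -
  have "[:0, 1:] ^ 2 - [:[:c:]:] \<noteq> (0 :: complex poly poly)"
    by (simp add: power2_eq_square)
  then have "to_fract ([:0, 1:] ^ 2 - [:[:c:]:]) \<noteq> (0 :: ratfun2)"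
    by (simp only: to_fract_eq_0_iff not_False_eq_True)
  then show ?thesis
    by (simp only: r_var_def const_def to_fract_diff power2_eq_square to_fract_mult not_False_eq_True)
qed

lemma mult_square_sum: "d * (X * X + Y * Y + Z * Z) - scal (Cas h) * d \<in> rel_ideal (rels_q h)"
proof -
  have "d * (X * X + Y * Y + Z * Z) - scal (Cas h) * d =
      d * (X^2 + Y^2 + Z^2 + cscal (h^2) - scal (r_var ^ 2))"
    by (simp add: Cas_def scal_diff cscal_def scal_central[of d] power2_eq_square algebra_simps)
  also have "\<dots> \<in> rel_ideal (rels_q h)"
    by (intro rel_ideal_lmult rel_ideal_base) (simp add: rels_q_def)
  finally show ?thesis .
qed

text \<open>Multiplying once more by the coordinates and adding gives d times the sum of squares,
  and this sum is the nonzero scalar Cas.\<close>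

lemma mult_coords_cancel:
  assumes "\<And>g. d * gen g \<in> rel_ideal (rels_q h)"
  shows "d \<in> rel_ideal (rels_q h)"
proof -
  have "d * (X * X + Y * Y + Z * Z) \<in> rel_ideal (rels_q h)"
    using assms[THEN rel_ideal_rmult] by (simp add: distrib_left rel_ideal_add flip: mult.assoc)
  then have "scal (Cas h) * d \<in> rel_ideal (rels_q h)"
    using rel_ideal_diff[OF _ mult_square_sum[of d], of "d * (X * X + Y * Y + Z * Z)"] by simp
  then show ?thesis
    using r_var_square_ne[of "h^2"] scal_cancel unfolding Cas_def by blast
qed

text \<open>If the symmetric traceless products annihilate \<open>d\<close>, then \<open>4 d x\<^sup>2 y = - \<hbar>\<^sup>2 d y\<close> by the commutation
  relations, while \<open>3 d x\<^sup>2 = Cas d\<close>; hence \<open>(4 Cas + 3 \<hbar>\<^sup>2) d y = 0\<close>.\<close>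

lemma symmetric_products_cancel:
  assumes sym: "\<And>g g'. g \<noteq> g' \<Longrightarrow> d * (gen g * gen g' + gen g' * gen g) \<in> rel_ideal (rels_q h)"
    and sq: "\<And>g. e + d * (gen g * gen g) \<in> rel_ideal (rels_q h)"
  shows "d \<in> rel_ideal (rels_q h)"
proof -
  let ?I = "rel_ideal (rels_q h)" and ?H = "cscal (hbar h) :: coord free"
  have xy: "commutator X Y - ?H * Z \<in> ?I" and yz: "commutator Y Z - ?H * X \<in> ?I"
    and zx: "commutator Z X - ?H * Y \<in> ?I"
    by (auto intro!: rel_ideal_base simp: rels_q_def)
  have H: "gen g * (?H * p) = ?H * (gen g * p)" "d * (?H * p) = ?H * (d * p)" for g p
    by (simp_all add: cscal_left_commute[of d] cscal_left_commute[of "gen g"])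
  define K where "K = (cscal (hbar h / 2) :: coord free)"
  have HK: "?H * p = K * p + K * p" for p
    using cscal_double[of "hbar h / 2" p] by (simp add: K_def)
  have half: "p \<in> ?I" if "p + p \<in> ?I" for p
    using rel_ideal_lmult[OF that, of "cscal (1 / 2)"]
    by (simp add: distrib_left flip: distrib_right cscal_add)
  have xz': "d * (X * Z) + K * (d * Y) \<in> ?I"
  proof (rule half)
    have "(d * (X * Z) + K * (d * Y)) + (d * (X * Z) + K * (d * Y)) =
        d * (X * Z + Z * X) - d * (commutator Z X - ?H * Y)"
      by (simp add: commutator_def H HK[of "_ * _"] algebra_simps)
    also have "\<dots> \<in> ?I"
      by (intro rel_ideal_diff rel_ideal_lmult zx sym) simp
    finally show "(d * (X * Z) + K * (d * Y)) + (d * (X * Z) + K * (d * Y)) \<in> ?I" .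
  qed
  have zx': "d * (Z * X) - K * (d * Y) \<in> ?I"
  proof (rule half)
    have "(d * (Z * X) - K * (d * Y)) + (d * (Z * X) - K * (d * Y)) =
        d * (X * Z + Z * X) + d * (commutator Z X - ?H * Y)"
      by (simp add: commutator_def H HK[of "_ * _"] algebra_simps)
    also have "\<dots> \<in> ?I"
      by (intro rel_ideal_add rel_ideal_lmult zx sym) simp
    finally show "(d * (Z * X) - K * (d * Y)) + (d * (Z * X) - K * (d * Y)) \<in> ?I" .
  qed
  have yx': "d * (Y * X) + K * (d * Z) \<in> ?I"
  proof (rule half)
    have "(d * (Y * X) + K * (d * Z)) + (d * (Y * X) + K * (d * Z)) =
        d * (X * Y + Y * X) - d * (commutator X Y - ?H * Z)"
      by (simp add: commutator_def H HK[of "_ * _"] algebra_simps)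
    also have "\<dots> \<in> ?I"
      by (intro rel_ideal_diff rel_ideal_lmult xy sym) simp
    finally show "(d * (Y * X) + K * (d * Z)) + (d * (Y * X) + K * (d * Z)) \<in> ?I" .
  qed
  have xxy: "d * (X * (X * Y)) - ?H * (d * (X * Z)) + d * (Y * (X * X)) \<in> ?I"
  proof -
    have "d * (X * (X * Y)) - ?H * (d * (X * Z)) + d * (Y * (X * X)) =
        d * (X * Y + Y * X) * X + (d * X) * (commutator X Y - ?H * Z)"
      by (simp add: commutator_def H algebra_simps)
    then show ?thesis
      by (simp add: sym rel_ideal_add rel_ideal_lmult rel_ideal_rmult xy)
  qed
  have one: "d * (X * (X * Y)) + K * (K * (d * Y)) \<in> ?I"
  proof -
    have "d * (X * (X * Y)) + K * (K * (d * Y)) =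
        (d * (X * (X * Y)) - ?H * (d * (X * Z)) + d * (Y * (X * X)))
        + ?H * (d * (X * Z) + K * (d * Y)) - (d * (Y * X) + K * (d * Z)) * X
        + K * (d * (Z * X) - K * (d * Y))"
      unfolding HK by (simp add: algebra_simps)
    also have "\<dots> \<in> ?I"
      by (intro rel_ideal_add rel_ideal_diff rel_ideal_lmult rel_ideal_rmult xxy xz' yx' zx')
    finally show ?thesis .
  qed
  have three: "cscal 3 * (d * (X * (X * Y))) - scal (Cas h) * (d * Y) \<in> ?I"
  proof -
    have "cscal 3 * (d * (X * (X * Y))) - scal (Cas h) * (d * Y) =
        ((d * (X * X + Y * Y + Z * Z) - scal (Cas h) * d) +
        ((e + d * (X * X)) - (e + d * (Y * Y))) + ((e + d * (X * X)) - (e + d * (Z * Z)))) * Y"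
      by (simp add: cscal_triple algebra_simps)
    also have "\<dots> \<in> ?I"
      by (intro rel_ideal_add rel_ideal_diff rel_ideal_rmult mult_square_sum sq)
    finally show ?thesis .
  qed
  have "scal (Cas h + 3 * const (hbar h / 2) ^ 2) * (d * Y) =
      cscal 3 * (d * (X * (X * Y)) + K * (K * (d * Y))) -
      (cscal 3 * (d * (X * (X * Y))) - scal (Cas h) * (d * Y))"
    by (simp add: K_def cscal_def scal_add scal_mult power2_eq_square algebra_simps)
  also have "\<dots> \<in> ?I"
    by (intro rel_ideal_diff rel_ideal_lmult one three)
  \<comment> \<open>Since hbar^2 = -4 h^2, the correction 3 hbar^2/4 equals -3 h^2, and Cas = r^2 -
    h^2 turns into the nonzero scalar r^2 - 4 h^2.\<close>
  also have "Cas h + 3 * const (hbar h / 2) ^ 2 = r_var ^ 2 - const (4 * h^2)"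
  proof -
    have "3 * const (hbar h / 2) ^ 2 = const (3 * (hbar h / 2) ^ 2)"
      by (simp add: const_mult const_power)
    also have "\<dots> = const (h^2) - const (4 * h^2)"
      unfolding const_diff[symmetric] by (simp add: hbar_def power_mult_distrib)
    finally show ?thesis
      by (simp add: Cas_def)
  qed
  finally have Y: "d * Y \<in> ?I"
    by (rule scal_cancel[OF r_var_square_ne])
  \<comment> \<open>With d y null, the symmetric products make d z y and d x y null as well. The
    brackets [y, z] and [x, y] then give d x and d z, because hbar is invertible.\<close>
  have ZY: "d * Z * Y \<in> ?I"
    using rel_ideal_diff[OF sym[of CZ CY] rel_ideal_rmult[OF Y, of Z]] by (simp add: algebra_simps)
  have XY: "d * X * Y \<in> ?I"
    using rel_ideal_diff[OF sym[of CX CY] rel_ideal_rmult[OF Y, of X]] by (simp add: algebra_simps)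
  have "?H * (d * X) = d * Y * Z - d * Z * Y - d * (commutator Y Z - ?H * X)"
    by (simp add: commutator_def H algebra_simps)
  also have "\<dots> \<in> ?I"
    by (rule rel_ideal_diff[OF rel_ideal_diff[OF rel_ideal_rmult[OF Y] ZY] rel_ideal_lmult[OF yz]])
  finally have X: "d * X \<in> ?I"
    by (rule cscal_hbar_cancel[OF h])
  have "?H * (d * Z) = d * X * Y - d * Y * X - d * (commutator X Y - ?H * Z)"
    by (simp add: commutator_def H algebra_simps)
  also have "\<dots> \<in> ?I"
    by (rule rel_ideal_diff[OF rel_ideal_diff[OF XY rel_ideal_rmult[OF Y]] rel_ideal_lmult[OF xy]])
  finally have "d * Z \<in> ?I"
    by (rule cscal_hbar_cancel[OF h])
  with X Y have "d * gen g \<in> ?I" for g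
    by (cases g) simp_all
  then show ?thesis
    by (rule mult_coords_cancel)
qed

text \<open>In normal order the system is triangular. Both Lap and Q^2 meet the squared derivatives,
  so \<open>d4\<close> is isolated first with the help of the off-diagonal products; then the mixed
  terms give \<open>d3\<close>, the first-order ones \<open>c2\<close>, the powers of dt give
  \<open>d1\<close>, \<open>c1\<close>, \<open>c0\<close>, and a square gives
  \<open>d2\<close>.\<close>

lemma invariant_ops_independent:
  assumes null: "emb c0 + emb c1 * dtt h + emb c2 * Q_op + emb d1 * dtt h ^ 2 + emb d2 * Lap +
    emb d3 * (Q_op * dtt h) + emb d4 * Q_op ^ 2 \<in> op_null (weyl_q h) (coef_q h)" (is "?p \<in> ?N")
  shows "c0 \<in> rel_ideal (rels_q h)" "c1 \<in> rel_ideal (rels_q h)" "c2 \<in> rel_ideal (rels_q h)"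
    "d1 \<in> rel_ideal (rels_q h)" "d2 \<in> rel_ideal (rels_q h)" "d3 \<in> rel_ideal (rels_q h)"
    "d4 \<in> rel_ideal (rels_q h)"
proof -
  let ?I = "rel_ideal (rels_q h)"
  define t where "t = (cscal (2 / hbar h) :: coord free)"
  define s where "s = (cscal (hbar h / 2) :: coord free)"
  \<comment> \<open>These coefficients result from substituting dtt = dt + t with t = 2/hbar, and
    Q^2 = \<open>xx_dd\<close> + Q + s Q dt with s = hbar/2.\<close>
  let ?a = "\<lambda>i :: nat. if i = 0 then c0 + c1 * t + d1 * t * t else if i = 1 then c1 + d1 * t + d1 * t else d1"
  let ?b = "\<lambda>g. (c2 + d3 * t + d4) * gen g" and ?c = "\<lambda>g. (d3 + d4 * s) * gen g"
  let ?d = "\<lambda>g g'. if g = g' then d2 + d4 * (gen g * gen g) else d4 * (gen g * gen g' + gen g' * gen g)"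
  let ?q = "\<Sum>\<beta>\<in>order2_index. emb (order2_coeffs ?a ?b ?c ?d \<beta>) * d_mon \<beta>"
  have t: "gen g * emb t = emb t * gen g" "gen g * (emb t * p) = emb t * (gen g * p)"
    "gen g * emb s = emb s * gen g" "gen g * (emb s * p) = emb s * (gen g * p)" for g and p :: "opgen free"
    by (simp_all add: t_def s_def cscal_central cscal_left_commute[of "gen g"])
  have ts: "cscal (2 / hbar h) = emb t" "cscal (hbar h / 2) = emb s"
    by (simp_all add: t_def s_def)
  \<comment> \<open>The commutators put dt in front of the spatial derivatives, as in
    \<open>d_mon\<close>; in Q dt it stands behind them.\<close>
  have "?q = ?p - emb d4 * (Q_op ^ 2 - (xx_dd + Q_op + cscal (hbar h / 2) * (Q_op * dt)))
      + emb (?c CX) * commutator (dtt h) dx * 1 + emb (?c CY) * commutator (dtt h) dy * 1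
      + emb (?c CZ) * commutator (dtt h) dz * 1"
    unfolding sum_order2 dtt_def commutator_scal ts
    by (simp add: emb_add emb_mult Lap_def Q_op_def commutator_def power2_eq_square t algebra_simps)
  also have "\<dots> \<in> ?N"
  proof -
    have "commutator (dtt h) (gen (DD g)) \<in> weyl_q h" for g
      by (auto simp: weyl_q_def Let_def)
    then have comm: "u * commutator (dtt h) (gen (DD g)) * v \<in> ?N" for g u v
      by (rule op_null_weyl)
    show ?thesis
      by (rule op_null_add[OF op_null_add[OF op_null_add[OF op_null_diff[OF null
            q.op_null_emb[OF Q_square_q[OF h]]] comm] comm] comm])
  qed
  finally have "?q \<in> ?N" .
  moreover have "finite order2_index"
    by (simp add: order2_index_def)
  ultimately have coeff: "order2_coeffs ?a ?b ?c ?d \<beta> \<in> ?I" if "\<beta> \<in> order2_index" for \<beta>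
    using symbol_module.normal_form_unique[OF symbol_module_q _ _ that] by blast
  have a: "?a 0 \<in> ?I" "?a 1 \<in> ?I" "?a 2 \<in> ?I"
    using coeff[of "(0,0,0,0)"] coeff[of "(1,0,0,0)"] coeff[of "(2,0,0,0)"]
    by (simp_all add: order2_index_def order2_coeffs_def)
  have b: "?b CX \<in> ?I" "?b CY \<in> ?I" "?b CZ \<in> ?I"
    using coeff[of "(0,1,0,0)"] coeff[of "(0,0,1,0)"] coeff[of "(0,0,0,1)"]
    by (simp_all add: order2_index_def order2_coeffs_def)
  have c: "?c CX \<in> ?I" "?c CY \<in> ?I" "?c CZ \<in> ?I"
    using coeff[of "(1,1,0,0)"] coeff[of "(1,0,1,0)"] coeff[of "(1,0,0,1)"]
    by (simp_all add: order2_index_def order2_coeffs_def)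
  have sq: "d2 + d4 * (X * X) \<in> ?I" "d2 + d4 * (Y * Y) \<in> ?I" "d2 + d4 * (Z * Z) \<in> ?I"
    using coeff[of "(0,2,0,0)"] coeff[of "(0,0,2,0)"] coeff[of "(0,0,0,2)"]
    by (simp_all add: order2_index_def order2_coeffs_def)
  have prod: "d4 * (X * Y + Y * X) \<in> ?I" "d4 * (X * Z + Z * X) \<in> ?I" "d4 * (Y * Z + Z * Y) \<in> ?I"
    using coeff[of "(0,1,1,0)"] coeff[of "(0,1,0,1)"] coeff[of "(0,0,1,1)"]
    by (simp_all add: order2_index_def order2_coeffs_def)
  have d4: "d4 \<in> ?I"
  proof (rule symmetric_products_cancel[of d4 d2])
    show "d4 * (gen g * gen g' + gen g' * gen g) \<in> ?I" if "g \<noteq> g'" for g g'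
      using that prod by (cases g; cases g') (simp_all add: add.commute)
    show "d2 + d4 * (gen g * gen g) \<in> ?I" for g
      using sq by (cases g) simp_all
  qed
  have "?b g \<in> ?I" "?c g \<in> ?I" for g
    using b c by (cases g; simp)+
  then have "d3 + d4 * s \<in> ?I" "c2 + d3 * t + d4 \<in> ?I"
    by (blast intro: mult_coords_cancel)+
  from rel_ideal_diff[OF this(1) rel_ideal_rmult[OF d4, of s]] this(2)
  have d3: "d3 \<in> ?I" and "c2 + d3 * t + d4 \<in> ?I"
    by simp_all
  from rel_ideal_diff[OF rel_ideal_diff[OF this(2) d4] rel_ideal_rmult[OF d3, of t]]
  have c2: "c2 \<in> ?I"
    by simp
  have d1: "d1 \<in> ?I"
    using a(3) by simp
  note d1t = rel_ideal_rmult[OF d1, of t]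
  have c1: "c1 \<in> ?I"
    using rel_ideal_diff[OF rel_ideal_diff[OF a(2) d1t] d1t] by simp
  have c0: "c0 \<in> ?I"
    using rel_ideal_diff[OF rel_ideal_diff[OF a(1) rel_ideal_rmult[OF d1t, of t]] rel_ideal_rmult[OF c1, of t]]
    by simp
  have d2: "d2 \<in> ?I"
    using rel_ideal_diff[OF sq(1) rel_ideal_rmult[OF d4, of "X * X"]] by simp
  show "c0 \<in> ?I" "c1 \<in> ?I" "c2 \<in> ?I" "d1 \<in> ?I" "d2 \<in> ?I" "d3 \<in> ?I" "d4 \<in> ?I"
    by fact+
qed

end

section \<open>Shifts of rational functions\<close>

lemma num_den: "snd (num_den F) \<noteq> 0 \<and> F = Fraction_Field.Fract (fst (num_den F)) (snd (num_den F))"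
proof -
  obtain p q where "F = Fraction_Field.Fract p q" "q \<noteq> 0"
    by (cases F rule: Fract_cases) auto
  then have "case (p, q) of (p, q) \<Rightarrow> q \<noteq> 0 \<and> F = Fraction_Field.Fract p q"
    by simp
  then have "case num_den F of (p, q) \<Rightarrow> q \<noteq> 0 \<and> F = Fraction_Field.Fract p q"
    unfolding num_den_def by (rule someI)
  then show ?thesis
    by (simp add: case_prod_beta)
qed

lemma shift_poly_add: "shift_poly a b (p + q) = shift_poly a b p + shift_poly a b q"
proof -
  have "map_poly (\<lambda>q. pcompose q [:a, 1:]) (p + q) =
      map_poly (\<lambda>q. pcompose q [:a, 1:]) p + map_poly (\<lambda>q. pcompose q [:a, 1:]) q"
    by (rule poly_eqI) (simp add: coeff_map_poly pcompose_add)
  then show ?thesis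
    by (simp add: shift_poly_def pcompose_add)
qed

lemma shift_poly_mult: "shift_poly a b (p * q) = shift_poly a b p * shift_poly a b q"
proof -
  have "map_poly (\<lambda>q. pcompose q [:a, 1:]) (p * q) =
      map_poly (\<lambda>q. pcompose q [:a, 1:]) p * map_poly (\<lambda>q. pcompose q [:a, 1:]) q"
    by (rule poly_eqI) (simp add: coeff_map_poly coeff_mult pcompose_sum pcompose_mult)
  then show ?thesis
    by (simp add: shift_poly_def pcompose_mult)
qed

lemma shift_poly_eq_0_iff: "shift_poly a b p = 0 \<longleftrightarrow> p = 0"
proof
  assume "shift_poly a b p = 0"
  then have "map_poly (\<lambda>q. pcompose q [:a, 1:]) p = 0"
    unfolding shift_poly_def by (rule pcompose_eq_0) simp
  then have "pcompose (coeff p n) [:a, 1:] = 0" for n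
    by (metis coeff_0 coeff_map_poly pcompose_0)
  then have "coeff p n = 0" for n
    using pcompose_eq_0[of "coeff p n" "[:a, 1:]"] by simp
  then show "p = 0"
    by (simp add: poly_eq_iff)
qed (simp add: shift_poly_def)

lemma to_fract_divide: "q \<noteq> 0 \<Longrightarrow> to_fract p / to_fract q = Fraction_Field.Fract p q"
  by (simp add: to_fract_def divide_fract)

text \<open>\<open>shift_poly\<close> is an injective ring homomorphism, so it preserves cross
  multiplication and nonzero denominators; the numerator and denominator chosen by
  \<open>num_den\<close> do not matter.\<close>

lemma shift_Fract:
  assumes "q \<noteq> 0"
  shows "shift a c (Fraction_Field.Fract p q) =
    Fraction_Field.Fract (shift_poly a (c / (2 * \<i>)) p) (shift_poly a (c / (2 * \<i>)) q)"
proof -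
  let ?b = "c / (2 * \<i>)"
  obtain p' q' where pq: "num_den (Fraction_Field.Fract p q) = (p', q')"
    by fastforce
  then have q': "q' \<noteq> 0" and eq: "Fraction_Field.Fract p q = Fraction_Field.Fract p' q'"
    using num_den[of "Fraction_Field.Fract p q"] by simp_all
  then have "p * q' = p' * q"
    using assms by (simp add: eq_fract)
  then have "shift_poly a ?b p * shift_poly a ?b q' = shift_poly a ?b p' * shift_poly a ?b q"
    by (simp flip: shift_poly_mult)
  then show ?thesis
    using assms q' by (simp add: shift_def pq Let_def to_fract_divide shift_poly_eq_0_iff eq_fract)
qed

lemma shift_add: "shift a c (F + G) = shift a c F + shift a c G"
proof -
  obtain p q p' q' where "F = Fraction_Field.Fract p q" "q \<noteq> 0" "G = Fraction_Field.Fract p' q'" "q' \<noteq> 0"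
    by (cases F rule: Fract_cases; cases G rule: Fract_cases) auto
  then show ?thesis
    by (simp add: shift_Fract shift_poly_add shift_poly_mult shift_poly_eq_0_iff)
qed

lemma shift_const_mult: "shift a c (const d * F) = const d * shift a c F"
proof -
  obtain p q where "F = Fraction_Field.Fract p q" "q \<noteq> 0"
    by (cases F rule: Fract_cases) auto
  moreover have "shift_poly a b [:[:d:]:] = [:[:d:]:]" for b
    by (simp add: shift_poly_def map_poly_pCons)
  then have "shift_poly a b (smult [:d:] p) = smult [:d:] (shift_poly a b p)" for b p
    using shift_poly_mult[of a b "[:[:d:]:]" p] by simp
  ultimately show ?thesis
    by (simp add: const_def to_fract_def shift_Fract shift_poly_eq_0_iff)
qed

text \<open>The projected vectors are fixed, so \<open>F\<close> enters through its shifts alone,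
  and these are additive and leave complex constants unchanged.\<close>

lemma inv_coeff1_add: "inv_coeff1 h k (E + F) = inv_coeff1 h k E + inv_coeff1 h k F"
  and inv_coeff1_const: "inv_coeff1 h k (const c * F) = const c *s inv_coeff1 h k F"
  by (simp_all add: inv_coeff1_def Let_def shift_add shift_const_mult vector_sadd_rdistrib
      vector_smult_assoc vector_add_ldistrib)

lemma inv_coeff2_add: "inv_coeff2 h k (E + F) = inv_coeff2 h k E + inv_coeff2 h k F"
  and inv_coeff2_const: "inv_coeff2 h k (const c * F) = const c *s inv_coeff2 h k F"
  by (simp_all add: inv_coeff2_def Let_def shift_add shift_const_mult vector_sadd_rdistrib
      vector_smult_assoc vector_add_ldistrib)

section \<open>The action of invariant operators\<close>

lemma vector_4:
  fixes a b c d :: "'a::zero"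
  shows "(vector [a, b, c, d] :: 'a ^ 4) $ 1 = a" "(vector [a, b, c, d] :: 'a ^ 4) $ 2 = b"
    "(vector [a, b, c, d] :: 'a ^ 4) $ 3 = c" "(vector [a, b, c, d] :: 'a ^ 4) $ 4 = d"
  unfolding vector_def by simp_all

definition invariant_op :: "complex \<Rightarrow> coord free \<Rightarrow> (2 \<Rightarrow> coord free) \<Rightarrow> (4 \<Rightarrow> coord free) \<Rightarrow> opgen free"
  where "invariant_op h c0 c d = emb c0 + (\<Sum>j\<in>UNIV. emb (c j) * inv_ops1 h $ j)
    + (\<Sum>j\<in>UNIV. emb (d j) * inv_ops2 h $ j)"

text \<open>The value prescribed by \<open>acts_as\<close>, written on representatives in the free
  algebra instead of on classes.\<close>

definition invariant_value ::
  "complex \<Rightarrow> coord free \<Rightarrow> (2 \<Rightarrow> coord free) \<Rightarrow> (4 \<Rightarrow> coord free) \<Rightarrow> nat \<Rightarrow> ratfun2 \<Rightarrow> coord free \<Rightarrow> coord free"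
  where "invariant_value h c0 c d k F p = c0 * (scal F * p)
    + (\<Sum>j\<in>UNIV. c j * (scal (inv_coeff1 h k F $ j) * p))
    + (\<Sum>j\<in>UNIV. d j * (scal (inv_coeff2 h k F $ j) * p))"

context
  fixes h :: complex
  assumes h: "hbar h \<noteq> 0"
begin

lemma V_q_ball_iff: "(\<forall>u\<in>V_q h k. P u) \<longleftrightarrow> (\<forall>p. cls (rels_q h) p \<in> V_q h k \<longrightarrow> P (cls (rels_q h) p))"
  using V_q_weight_span[OF h] by blast

lemma acts_as_iff: "acts_as h D L \<longleftrightarrow>
    L \<in> carrier (A_q h) \<rightarrow>\<^sub>E carrier (A_q h) \<and>
    L \<in> hom (add_monoid (A_q h)) (add_monoid (A_q h)) \<and>
    (\<exists>c0 c d. D = op_q h (invariant_op h c0 c d) \<and>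
      (\<forall>k F p. cls (rels_q h) p \<in> V_q h k \<longrightarrow>
         L (cls (rels_q h) (scal F * p)) = cls (rels_q h) (invariant_value h c0 c d k F p)))"
  unfolding acts_as_def invariant_op_def invariant_value_def V_q_ball_iff A_q_def
  by (simp add: smult_cls_cls cls_mult cls_finsum cls_add)

text \<open>\<open>acts_as\<close> quantifies existentially over the coefficients. Independence of
  the invariant operators shows that equal operators have congruent coefficients, hence prescribe
  the same values.\<close>

lemma invariant_op_unique:
  assumes "op_q h (invariant_op h c0 c d) = op_q h (invariant_op h c0' c' d')"
  shows "cls (rels_q h) (invariant_value h c0 c d k F p) = cls (rels_q h) (invariant_value h c0' c' d' k F p)"
proof -
  let ?I = "rel_ideal (rels_q h)"
  have "emb (c0 - c0') + emb (c 1 - c' 1) * dtt h + emb (c 2 - c' 2) * Q_op + emb (d 1 - d' 1) * dtt h ^ 2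
      + emb (d 2 - d' 2) * Lap + emb (d 3 - d' 3) * (Q_op * dtt h) + emb (d 4 - d' 4) * Q_op ^ 2
      = invariant_op h c0 c d - invariant_op h c0' c' d'"
    by (simp add: invariant_op_def sum_2 sum_4 inv_ops1_def inv_ops2_def vector_4 emb_diff algebra_simps)
  then have "emb (c0 - c0') + emb (c 1 - c' 1) * dtt h + emb (c 2 - c' 2) * Q_op + emb (d 1 - d' 1) * dtt h ^ 2
      + emb (d 2 - d' 2) * Lap + emb (d 3 - d' 3) * (Q_op * dtt h) + emb (d 4 - d' 4) * Q_op ^ 2
      \<in> op_null (weyl_q h) (coef_q h)"
    using assms by (simp only: op_q_eq_iff)
  from invariant_ops_independent[OF h this]
  have 0: "c0 - c0' \<in> ?I" and 1: "c j - c' j \<in> ?I" and 2: "d i - d' i \<in> ?I" for j i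
    using exhaust_2[of j] exhaust_4[of i] by auto
  have "invariant_value h c0 c d k F p - invariant_value h c0' c' d' k F p = invariant_value h
      (c0 - c0') (\<lambda>j. c j - c' j) (\<lambda>j. d j - d' j) k F p"
    by (simp add: invariant_value_def left_diff_distrib sum_subtractf)
  also have "\<dots> \<in> ?I"
    unfolding invariant_value_def by (intro rel_ideal_add rel_ideal_sum rel_ideal_rmult 0 1 2)
  finally show ?thesis
    by (simp only: cls_eq_iff)
qed

lemma acts_as_unique:
  assumes "acts_as h D L" "acts_as h D L'"
  shows "L = L'"
proof -
  obtain c0 c d where D: "D = op_q h (invariant_op h c0 c d)"
    and L: "\<And>k F p. cls (rels_q h) p \<in> V_q h k \<Longrightarrow>
      L (cls (rels_q h) (scal F * p)) = cls (rels_q h) (invariant_value h c0 c d k F p)"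
    using assms(1) unfolding acts_as_iff by blast
  obtain c0' c' d' where D': "D = op_q h (invariant_op h c0' c' d')"
    and L': "\<And>k F p. cls (rels_q h) p \<in> V_q h k \<Longrightarrow>
      L' (cls (rels_q h) (scal F * p)) = cls (rels_q h) (invariant_value h c0' c' d' k F p)"
    using assms(2) unfolding acts_as_iff by blast
  have L_L': "L \<in> carrier (A_q h) \<rightarrow>\<^sub>E carrier (A_q h)" "L' \<in> carrier (A_q h) \<rightarrow>\<^sub>E carrier (A_q h)"
    "L \<in> hom (add_monoid (A_q h)) (add_monoid (A_q h))" "L' \<in> hom (add_monoid (A_q h)) (add_monoid (A_q h))"
    using assms unfolding acts_as_iff by blast+
  have "L (smult_cls (rels_q h) F u) = L' (smult_cls (rels_q h) F u)" if u: "u \<in> V_q h k" for k F u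
  proof -
    obtain p where p: "u = cls (rels_q h) p"
      using V_q_weight_span[OF h u] by blast
    show ?thesis
      using u L[of p k F] L'[of p k F] invariant_op_unique[OF trans[OF D[symmetric] D'], of k F p]
      by (simp add: p smult_cls_cls)
  qed
  then show ?thesis
    using isotypic_map_unique[OF h L_L'(3,4)] by (intro PiE_ext[OF L_L'(1,2)]) blast
qed

text \<open>With coefficients in the field, and not just in the quantum algebra, the prescribed
  value of \<open>F u\<close> is again a rational multiple of \<open>u\<close>; this multiple is
  \<open>G k F\<close>.\<close>

lemma acts_as_exists:
  fixes c0 :: ratfun2 and c :: "2 \<Rightarrow> ratfun2" and d :: "4 \<Rightarrow> ratfun2"
  shows "\<exists>L G. acts_as h (op_q h (invariant_op h (scal c0) (\<lambda>j. scal (c j)) (\<lambda>j. scal (d j)))) L \<and>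
    (\<forall>k F. \<forall>u\<in>V_q h k. L (smult_cls (rels_q h) F u) = smult_cls (rels_q h) (G k F) u)"
proof -
  define G where "G = (\<lambda>k F. c0 * F + (\<Sum>j\<in>UNIV. c j * inv_coeff1 h k F $ j) +
    (\<Sum>j\<in>UNIV. d j * inv_coeff2 h k F $ j))"
  have G_value: "invariant_value h (scal c0) (\<lambda>j. scal (c j)) (\<lambda>j. scal (d j)) k F p = scal (G k F) * p" for k F p
    by (simp add: invariant_value_def G_def sum_2 sum_4 scal_add scal_mult distrib_right mult.assoc)
  have "G k (E + F) = G k E + G k F" for k E F
    by (simp add: G_def inv_coeff1_add inv_coeff2_add distrib_left sum.distrib)
  moreover have "G k (const e * F) = const e * G k F" for k e F
    by (simp add: G_def inv_coeff1_const inv_coeff2_const distrib_left sum_distrib_left mult.left_commute)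
  ultimately obtain L where L: "L \<in> carrier (A_q h) \<rightarrow>\<^sub>E carrier (A_q h)"
    "L \<in> hom (add_monoid (A_q h)) (add_monoid (A_q h))"
    "\<And>k F u. u \<in> V_q h k \<Longrightarrow> L (smult_cls (rels_q h) F u) = smult_cls (rels_q h) (G k F) u"
    using isotypic_map_exists[OF h, of G] by blast
  have "acts_as h (op_q h (invariant_op h (scal c0) (\<lambda>j. scal (c j)) (\<lambda>j. scal (d j)))) L"
    unfolding acts_as_iff
    by (intro conjI L(1,2) exI[of _ "scal c0"] exI[of _ "\<lambda>j. scal (c j)"] exI[of _ "\<lambda>j. scal (d j)"])
       (simp_all add: G_value flip: smult_cls_cls L(3))
  with L(3) show ?thesis
    by blast
qed

lemma isotypic_invariant:
  assumes "L \<in> hom (add_monoid (A_q h)) (add_monoid (A_q h))"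
    and "\<And>F u. u \<in> V_q h k \<Longrightarrow> L (smult_cls (rels_q h) F u) = smult_cls (rels_q h) (g F) u"
  shows "L ` isotypic h k \<subseteq> isotypic h k"
proof -
  let ?K = "{smult_cls (rels_q h) F u | F u. u \<in> V_q h k}"
  interpret ring "A_q h"
    unfolding A_q_def by (rule ring_presented)
  interpret group_hom "add_monoid (A_q h)" "add_monoid (A_q h)" L
    by standard (rule assms(1))
  have "?K \<subseteq> carrier (add_monoid (A_q h))"
    using V_q_weight_span[OF h] by (force simp: A_q_def smult_cls_cls)
  then have "L ` isotypic h k = generate (add_monoid (A_q h)) (L ` ?K)"
    unfolding isotypic_def by (rule generate_img[symmetric])
  also have "L ` ?K \<subseteq> ?K"
    by (auto simp: assms(2)) blast
  then have "generate (add_monoid (A_q h)) (L ` ?K) \<subseteq> isotypic h k"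
    unfolding isotypic_def by (rule add.mono_generate)
  finally show ?thesis .
qed

text \<open>Substituting dt = dtt - 2/hbar expresses the operator through the invariant ones. In the
  mixed term (hbar/2) g (2/hbar) = g, which explains the coefficient -(e + g) of Q.\<close>

lemma box_invariant_op:
  "\<exists>c0 c d. scal a * dt^2 - scal g * Q_op^2 - scal e * Q_op + scal (const (hbar h / 2) * g) * (Q_op * dt)
     - scal s * Lap = invariant_op h (scal c0) (\<lambda>j. scal (c j)) (\<lambda>j. scal (d j))"
proof (intro exI)
  define t where "t = (cscal (2 / hbar h) :: opgen free)"
  have dt: "dt = dtt h - t"
    by (simp add: dtt_def t_def)
  have t: "dtt h * t = t * dtt h" "Q_op * t = t * Q_op"
    by (simp_all add: t_def cscal_central)
  have tt: "t + t = cscal (4 / hbar h)" "t * t = cscal (4 / hbar h ^ 2)"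
    by (simp_all add: t_def power2_eq_square flip: cscal_add cscal_mult)
  have "(dtt h - t) ^ 2 = dtt h ^ 2 - (t + t) * dtt h + t * t"
    by (simp add: power2_eq_square t algebra_simps)
  then have dt_dt: "dt ^ 2 = dtt h ^ 2 - cscal (4 / hbar h) * dtt h + cscal (4 / hbar h ^ 2)"
    by (simp only: tt flip: dt)
  have Q_dt: "Q_op * dt = Q_op * dtt h - cscal (2 / hbar h) * Q_op"
    unfolding dt by (simp add: right_diff_distrib t flip: t_def)
  have scal_cscal: "scal F * (cscal e * p) = scal (F * const e) * p" "scal F * cscal e = scal (F * const e)"
    for F e and p :: "opgen free"
    by (simp_all add: cscal_def scal_mult mult.assoc)
  have g: "const (hbar h / 2) * g * const (2 / hbar h) = g"
    using h by (simp add: mult.commute[of _ g] mult.assoc flip: const_mult)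
  show "scal a * dt^2 - scal g * Q_op^2 - scal e * Q_op + scal (const (hbar h / 2) * g) * (Q_op * dt)
     - scal s * Lap = invariant_op h (scal (a * const (4 / hbar h ^ 2)))
     (\<lambda>j. scal (if j = 1 then - (a * const (4 / hbar h)) else - (e + g)))
     (\<lambda>j. scal (if j = 1 then a else if j = 2 then - s else if j = 3 then const (hbar h / 2) * g else - g))"
    unfolding dt_dt Q_dt
    by (simp add: invariant_op_def inv_ops1_def inv_ops2_def vector_4 sum_2 sum_4 right_diff_distrib
        distrib_left scal_cscal g)
       (simp add: scal_uminus scal_diff algebra_simps)
qed

end

theorem mainTheorem7:
  fixes h :: complex and \<phi> :: ratfun1 and \<alpha> :: "coord free set \<Rightarrow> coord free set"
  assumes "hbar h \<noteq> 0" and "\<phi> \<noteq> 0" and "quantizing_map h \<alpha>"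
  shows "let f = at_r \<phi>; f' = at_r (deriv_rat \<phi>); r = r_var; H = hbar h;
             box = quantize h \<alpha> (op_cl (box_LB \<phi>))
    in box = op_q h
          (scal (inverse f) * dt^2
           - scal ((f - 1) / r^2) * Q_op^2
           - scal ((f - 1) / r^2 + f' / r) * Q_op
           + scal (const (H / 2) * ((f - 1) / r^2)) * (Q_op * dt)
           - scal (1 - const (H^2 / 12) * ((f - 1) / r^2)) * Lap)
     \<and> (\<exists>!L. acts_as h box L)
     \<and> (\<forall>L. acts_as h box L \<longrightarrow>
          (\<forall>k. L ` isotypic h k \<subseteq> isotypic h k) \<and>
          (\<exists>g :: nat \<Rightarrow> ratfun2 \<Rightarrow> ratfun2. \<forall>k F. \<forall>u\<in>V_q h k.
             L (smult_cls (rels_q h) F u) = smult_cls (rels_q h) (g k F) u))"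
proof -
  interpret quantization h \<alpha>
    by standard (fact assms)+
  define f f' where "f = at_r \<phi>" and "f' = at_r (deriv_rat \<phi>)"
  define g where "g = (f - 1) / r_var ^ 2"
  define e where "e = g + f' / r_var"
  define box where "box = quantize h \<alpha> (op_cl (box_LB \<phi>))"
  have "1 / r_var * ((f - 1) / r_var + f') = e"
    by (simp add: e_def g_def power2_eq_square distrib_left)
  then have "box_LB \<phi> = scal (inverse f) * dt^2 - scal g * Q_op^2 - scal e * Q_op - Lap"
    by (simp add: box_LB_def Let_def f_def f'_def g_def)
  then have box: "box = op_q h (scal (inverse f) * dt^2 - scal g * Q_op^2 - scal e * Q_op
      + scal (const (hbar h / 2) * g) * (Q_op * dt) - scal (1 - const (hbar h ^ 2 / 12) * g) * Lap)"
    by (simp add: box_def quantize_second_order)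
  obtain c0 c d where op: "scal (inverse f) * dt^2 - scal g * Q_op^2 - scal e * Q_op
      + scal (const (hbar h / 2) * g) * (Q_op * dt) - scal (1 - const (hbar h ^ 2 / 12) * g) * Lap =
      invariant_op h (scal c0) (\<lambda>j. scal (c j)) (\<lambda>j. scal (d j))"
    using box_invariant_op[OF h] by metis
  obtain L G where L: "acts_as h box L"
    "\<And>k F u. u \<in> V_q h k \<Longrightarrow> L (smult_cls (rels_q h) F u) = smult_cls (rels_q h) (G k F) u"
    using acts_as_exists[OF h, of c0 c d] unfolding box op by blast
  have unique: "M = L" if "acts_as h box M" for M
    using acts_as_unique[OF h that L(1)] .
  have "L ` isotypic h k \<subseteq> isotypic h k" for k
  proof (rule isotypic_invariant[OF h _ L(2)])
    show "L \<in> hom (add_monoid (A_q h)) (add_monoid (A_q h))"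
      using L(1) by (simp add: acts_as_def)
  qed
  then have "\<forall>M. acts_as h box M \<longrightarrow> (\<forall>k. M ` isotypic h k \<subseteq> isotypic h k) \<and>
      (\<exists>G. \<forall>k F. \<forall>u\<in>V_q h k. M (smult_cls (rels_q h) F u) = smult_cls (rels_q h) (G k F) u)"
    using unique L(2) by blast
  moreover have "\<exists>!M. acts_as h box M"
    using L(1) unique by blast
  ultimately show ?thesis
    unfolding Let_def f_def[symmetric] f'_def[symmetric] g_def[symmetric] e_def[symmetric] box_def[symmetric]
    by (intro conjI box)
qed

end
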